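(* Let $D\subset\mathbb{R}^d$ be a bounded domain with Lipschitz boundary, $(\Omega,\Sigma,P)$ a probability space, $A\in L^\infty(D,\mathbb{R}^{d\times d}_{\rm sym})$ such that there are $\alpha,\beta>0$ with $\alpha|\xi|^2\le\xi^\top A(x)\xi\le\beta|\xi|^2$ for all $\xi\in\mathbb{R}^d$ and a.e. $x\in D$, and let $f\in L^2(\Omega,dP;L^2(D))$. Let $u\in L^2(\Omega,dP;H^1_0(D))$ be the unique random solution of $$\int_\Omega\int_D\nabla_x v(x,\omega)\cdot A(x)\nabla_x u(x,\omega)\,dx\,dP(\omega)=\int_\Omega\int_D f(x,\omega)v(x,\omega)\,dx\,dP(\omega)\qquad\forall v\in L^2(\Omega,dP;H^1_0(D)).$$ Let $C_u(x,x')=\int_\Omega u(x,\omega)u(x',\omega)\,dP(\omega)$ and $C_f(x,x')=\int_\Omega f(x,\omega)f(x',\omega)\,dP(\omega)$, $x,x'\in D$, be the two-point correlation functions of $u$ and $f$. Then $C_u$ is the unique solution of the deterministic problem in $D\times D$: find $C_u\in H^{1,1}_{(0)}(D\times D)$ such that $$Q(C_u,C_v)=\int_{D\times D}C_f\,C_v\,dx\,dx'\qquad\forall C_v\in H^{1,1}_{(0)}(D\times D),$$ where $H^{1,1}_{(0)}(D\times D)$ and $Q$ are as defined in the context.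
   Context: $H^{1,1}_{(0)}(D\times D):=H^1_0(D)\otimes H^1_0(D)$ (Hilbert space tensor product). With $\nabla_{xy}:=\nabla_x\otimes\nabla_y$, i.e. $(\nabla_{xy}w)_{ij}=\partial_{x_i}\partial_{y_j}w(x,y)$, the bilinear form is $$Q(w,z)=\int_{D\times D}\nabla_{xy}z\cdot\big(A(x)\otimes A(y)\big)\nabla_{xy}w\,dx\,dy=\int_{D\times D}\sum_{i,j,k,l=1}^d A_{ik}(x)A_{jl}(y)\,\partial_{x_k}\partial_{y_l}w\;\partial_{x_i}\partial_{y_j}z\,dx\,dy .$$ Here $C_v$ is just notation for an arbitrary test function in $H^{1,1}_{(0)}(D\times D)$. Correlation functions are understood as functions defined a.e. on $D\times D$. *)

theory Defs
  imports "HOL-Probability.Probability"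
begin

(* Elements of Lebesgue, Sobolev and Bochner spaces are handled through representatives:
   the spaces below are sets of functions, and equality in them is equality a.e. *)

section \<open>Lipschitz domains\<close>

(* Near each boundary point D is, in suitably rotated coordinates, the strict epigraph of a
   Lipschitz function of the d-1 variables spanning the hyperplane orthogonal to e. *)
definition lipschitz_boundary :: "'a::euclidean_space set \<Rightarrow> bool" where
  "lipschitz_boundary D \<longleftrightarrow>
     (\<forall>p\<in>frontier D. \<exists>r>0. \<exists>e. norm e = 1 \<and>
        (\<exists>\<gamma>::'a \<Rightarrow> real. \<exists>L. L-lipschitz_on {z. z \<bullet> e = 0} \<gamma> \<and>
           D \<inter> ball p r = {x \<in> ball p r. \<gamma> (x - (x \<bullet> e) *\<^sub>R e) < x \<bullet> e}))"

definition bounded_lipschitz_domain :: "'a::euclidean_space set \<Rightarrow> bool" where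
  "bounded_lipschitz_domain D \<longleftrightarrow>
     open D \<and> connected D \<and> D \<noteq> {} \<and> bounded D \<and> lipschitz_boundary D"

section \<open>Test functions and square integrable functions\<close>

definition partial_deriv :: "'a::euclidean_space \<Rightarrow> ('a \<Rightarrow> real) \<Rightarrow> 'a \<Rightarrow> real" where
  "partial_deriv b \<phi> = (\<lambda>x. frechet_derivative \<phi> (at x) b)"

primrec C_k :: "nat \<Rightarrow> ('a::euclidean_space \<Rightarrow> real) \<Rightarrow> bool" where
  "C_k 0 \<phi> \<longleftrightarrow> continuous_on UNIV \<phi>"
| "C_k (Suc k) \<phi> \<longleftrightarrow>
     (\<forall>x. \<phi> differentiable (at x)) \<and> (\<forall>b\<in>Basis. C_k k (partial_deriv b \<phi>))"

(* C_c^\<infinity>(D), each function extended by 0 to the whole space *)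
definition test_functions :: "'a::euclidean_space set \<Rightarrow> ('a \<Rightarrow> real) set" where
  "test_functions D =
     {\<phi>. (\<forall>k. C_k k \<phi>) \<and> compact (closure {x. \<phi> x \<noteq> 0}) \<and> closure {x. \<phi> x \<noteq> 0} \<subseteq> D}"

definition L2 :: "'a::euclidean_space set \<Rightarrow> ('a \<Rightarrow> real) set" where
  "L2 D = {u. u \<in> borel_measurable (lebesgue_on D) \<and> integrable (lebesgue_on D) (\<lambda>x. (u x)\<^sup>2)}"

definition L2_norm :: "'a::euclidean_space set \<Rightarrow> ('a \<Rightarrow> real) \<Rightarrow> real" where
  "L2_norm D u = sqrt (\<integral>x. (u x)\<^sup>2 \<partial>lebesgue_on D)"

section \<open>The space of H1 functions with zero boundary values\<close>

definition is_weak_grad ::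
  "(real^'d) set \<Rightarrow> (real^'d \<Rightarrow> real) \<Rightarrow> (real^'d \<Rightarrow> real^'d) \<Rightarrow> bool" where
  "is_weak_grad D u g \<longleftrightarrow>
     (\<forall>i. (\<lambda>x. g x $ i) \<in> L2 D \<and>
        (\<forall>\<phi>\<in>test_functions D.
           (\<integral>x. u x * partial_deriv (axis i 1) \<phi> x \<partial>lebesgue_on D)
             = - (\<integral>x. g x $ i * \<phi> x \<partial>lebesgue_on D)))"

(* A representative: for u in H1 D the weak gradient is determined up to a null set. *)
definition weak_grad :: "(real^'d) set \<Rightarrow> (real^'d \<Rightarrow> real) \<Rightarrow> real^'d \<Rightarrow> real^'d" where
  "weak_grad D u = (SOME g. is_weak_grad D u g)"

definition H1 :: "(real^'d) set \<Rightarrow> (real^'d \<Rightarrow> real) set" where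
  "H1 D = {u \<in> L2 D. \<exists>g. is_weak_grad D u g}"

definition H1_inner ::
  "(real^'d) set \<Rightarrow> (real^'d \<Rightarrow> real) \<Rightarrow> (real^'d \<Rightarrow> real) \<Rightarrow> real" where
  "H1_inner D u v =
     (\<integral>x. u x * v x \<partial>lebesgue_on D) + (\<integral>x. weak_grad D u x \<bullet> weak_grad D v x \<partial>lebesgue_on D)"

definition H1_norm :: "(real^'d) set \<Rightarrow> (real^'d \<Rightarrow> real) \<Rightarrow> real" where
  "H1_norm D u = sqrt (H1_inner D u u)"

definition H10 :: "(real^'d) set \<Rightarrow> (real^'d \<Rightarrow> real) set" where
  "H10 D = {u \<in> H1 D. \<forall>\<epsilon>>0. \<exists>\<phi>\<in>test_functions D. H1_norm D (\<lambda>x. u x - \<phi> x) < \<epsilon>}"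

section \<open>The Bochner space of square integrable random fields\<close>

(* L2(Omega,dP;V) for a space V of functions on D with norm N.  Strong measurability is
   approximation by V-valued simple functions.  Each class of the Bochner space has a
   representative that takes values in V everywhere and is jointly measurable in (omega,x);
   joint measurability is what gives u(x,omega) u(x',omega) a meaning. *)
definition L2_random ::
  "'w measure \<Rightarrow> 'a::euclidean_space set \<Rightarrow> ('a \<Rightarrow> real) set \<Rightarrow> (('a \<Rightarrow> real) \<Rightarrow> real)
     \<Rightarrow> ('w \<Rightarrow> 'a \<Rightarrow> real) set" where
  "L2_random P D V N =
     {u. (\<forall>\<omega>\<in>space P. u \<omega> \<in> V) \<and>
         (\<lambda>(\<omega>, x). u \<omega> x) \<in> borel_measurable (P \<Otimes>\<^sub>M lebesgue_on D) \<and>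
         (\<exists>s. (\<forall>n::nat. simple_function P (s n) \<and> s n ` space P \<subseteq> V) \<and>
              (\<forall>\<omega>\<in>space P. (\<lambda>n. N (\<lambda>x. s n \<omega> x - u \<omega> x)) \<longlonglongrightarrow> 0)) \<and>
         integrable P (\<lambda>\<omega>. (N (u \<omega>))\<^sup>2)}"

definition random_solution ::
  "'w measure \<Rightarrow> (real^'d) set \<Rightarrow> (real^'d \<Rightarrow> real^'d^'d) \<Rightarrow> ('w \<Rightarrow> real^'d \<Rightarrow> real)
     \<Rightarrow> ('w \<Rightarrow> real^'d \<Rightarrow> real) \<Rightarrow> bool" where
  "random_solution P D A f u \<longleftrightarrow>
     u \<in> L2_random P D (H10 D) (H1_norm D) \<and>
     (\<forall>v\<in>L2_random P D (H10 D) (H1_norm D).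
        (\<integral>\<omega>. (\<integral>x. weak_grad D (v \<omega>) x \<bullet> (A x *v weak_grad D (u \<omega>) x) \<partial>lebesgue_on D) \<partial>P)
          = (\<integral>\<omega>. (\<integral>x. f \<omega> x * v \<omega> x \<partial>lebesgue_on D) \<partial>P))"

definition correlation :: "'w measure \<Rightarrow> ('w \<Rightarrow> 'a \<Rightarrow> real) \<Rightarrow> 'a \<times> 'a \<Rightarrow> real" where
  "correlation P u = (\<lambda>(x, x'). \<integral>\<omega>. u \<omega> x * u \<omega> x' \<partial>P)"

section \<open>The tensor product space and the bilinear form\<close>

(* A list [(a1,b1),...,(an,bn)] stands for the algebraic tensor a1 (x) b1 + ... + an (x) bn. *)
type_synonym 'a tensor = "(('a \<Rightarrow> real) \<times> ('a \<Rightarrow> real)) list"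

definition tensor_fun :: "'a tensor \<Rightarrow> 'a \<times> 'a \<Rightarrow> real" where
  "tensor_fun t = (\<lambda>(x, y). \<Sum>(a, b)\<leftarrow>t. a x * b y)"

definition tensor_diff :: "'a tensor \<Rightarrow> 'a tensor \<Rightarrow> 'a tensor" where
  "tensor_diff s t = s @ map (\<lambda>(a, b). (\<lambda>x. - a x, b)) t"

definition tensor_inner ::
  "(('a \<Rightarrow> real) \<Rightarrow> ('a \<Rightarrow> real) \<Rightarrow> real) \<Rightarrow> 'a tensor \<Rightarrow> 'a tensor \<Rightarrow> real" where
  "tensor_inner ip s t = (\<Sum>(a, b)\<leftarrow>s. \<Sum>(c, d)\<leftarrow>t. ip a c * ip b d)"

definition tensor_norm ::
  "(('a \<Rightarrow> real) \<Rightarrow> ('a \<Rightarrow> real) \<Rightarrow> real) \<Rightarrow> 'a tensor \<Rightarrow> real" where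
  "tensor_norm ip t = sqrt (tensor_inner ip t t)"

(* The Hilbert space tensor product of H10 D with itself: the completion of the algebraic tensor
   product in the norm induced by <a (x) b, c (x) d> = <a,c> <b,d>.  The limit of a Cauchy
   sequence of algebraic tensors is identified with its limit as a function in L2 (D x D); the
   identification is injective because H10 D embeds injectively into L2 D and L2 (D x D) is the
   Hilbert space tensor product of L2 D with itself. *)
definition H11 :: "(real^'d) set \<Rightarrow> ((real^'d) \<times> (real^'d) \<Rightarrow> real) set" where
  "H11 D =
     {w \<in> L2 (D \<times> D). \<exists>T :: nat \<Rightarrow> (real^'d) tensor.
        (\<forall>n. set (T n) \<subseteq> H10 D \<times> H10 D) \<and>
        (\<forall>\<epsilon>>0. \<exists>M. \<forall>m\<ge>M. \<forall>n\<ge>M. tensor_norm (H1_inner D) (tensor_diff (T m) (T n)) < \<epsilon>) \<and>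
        (\<lambda>n. L2_norm (D \<times> D) (\<lambda>z. tensor_fun (T n) z - w z)) \<longlonglongrightarrow> 0}"

(* G is the matrix of weak derivatives d_{x_i} d_{y_j} w; no sign, since two integrations by
   parts are involved. *)
definition is_weak_grad_xy ::
  "(real^'d) set \<Rightarrow> ((real^'d) \<times> (real^'d) \<Rightarrow> real) \<Rightarrow> ((real^'d) \<times> (real^'d) \<Rightarrow> real^'d^'d) \<Rightarrow> bool" where
  "is_weak_grad_xy D w G \<longleftrightarrow>
     (\<forall>i j. (\<lambda>z. G z $ i $ j) \<in> L2 (D \<times> D) \<and>
        (\<forall>\<phi>\<in>test_functions (D \<times> D).
           (\<integral>z. w z * partial_deriv (axis i 1, 0) (partial_deriv (0, axis j 1) \<phi>) z
              \<partial>lebesgue_on (D \<times> D))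
             = (\<integral>z. G z $ i $ j * \<phi> z \<partial>lebesgue_on (D \<times> D))))"

definition weak_grad_xy ::
  "(real^'d) set \<Rightarrow> ((real^'d) \<times> (real^'d) \<Rightarrow> real) \<Rightarrow> (real^'d) \<times> (real^'d) \<Rightarrow> real^'d^'d" where
  "weak_grad_xy D w = (SOME G. is_weak_grad_xy D w G)"

definition Q_form ::
  "(real^'d) set \<Rightarrow> (real^'d \<Rightarrow> real^'d^'d)
     \<Rightarrow> ((real^'d) \<times> (real^'d) \<Rightarrow> real) \<Rightarrow> ((real^'d) \<times> (real^'d) \<Rightarrow> real) \<Rightarrow> real" where
  "Q_form D A w z =
     (\<integral>(x, y). (\<Sum>i\<in>UNIV. \<Sum>j\<in>UNIV. \<Sum>k\<in>UNIV. \<Sum>l\<in>UNIV.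
          A x $ i $ k * A y $ j $ l
            * weak_grad_xy D w (x, y) $ k $ l * weak_grad_xy D z (x, y) $ i $ j)
        \<partial>lebesgue_on (D \<times> D))"

(* C solves the deterministic problem with right-hand side g *)
definition deterministic_solution ::
  "(real^'d) set \<Rightarrow> (real^'d \<Rightarrow> real^'d^'d) \<Rightarrow> ((real^'d) \<times> (real^'d) \<Rightarrow> real)
     \<Rightarrow> ((real^'d) \<times> (real^'d) \<Rightarrow> real) \<Rightarrow> bool" where
  "deterministic_solution D A g C \<longleftrightarrow>
     C \<in> H11 D \<and>
     (\<forall>Z\<in>H11 D. Q_form D A C Z = (\<integral>z. g z * Z z \<partial>lebesgue_on (D \<times> D)))"

end

(* The correlation C_u = E[u (x) u] is an average of elementary tensors, and on elementary tensors
   the form Q factorises into two copies of the energy form B(v,w) = int grad w . A grad v.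
   Testing the random equation with 1_E(omega) a(x) gives B(u(omega),a) = (f(omega),a) almost
   surely for each fixed a, and therefore
     Q(C_u, a (x) b) = E[B(u,a) B(u,b)] = E[(f,a) (f,b)] = int C_f (a (x) b),
   which extends to all test functions by density.  Since the gradient of u need not be jointly
   measurable in (omega,x), the first equality is obtained as a limit along simple random fields,
   for which C_u is an algebraic tensor.
   Uniqueness: A (x) A is elliptic with constant alpha^2, because a Hadamard product argument shows
   that tr(P G Q G^T) >= alpha^2 |G|^2 when P, Q >= alpha; and a Poincare inequality applied once
   in each variable shows that the mixed gradient determines an element of the tensor product. *)

theory Submission
  imports Defs
begin

text \<open>Functions are representatives, and \<open>weak_grad\<close> and
  \<open>weak_grad_xy\<close> are arbitrary choices, so linear relations between gradients hold only
  almost everywhere. The proof therefore works with jets: a function together with its d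
  derivatives, and for a tensor all (d+1)^2 products of such components. The H1 norm and the tensor
  norm are then Euclidean norms of L2 norms, and statements about \<open>H11 D\<close> become
  statements about L2 limits of arrays of functions.

  Membership in \<open>H11 D\<close> only asks for a Cauchy sequence of tensors with an L2 limit.
  What makes density arguments work is that the mixed gradients of those tensors converge to the
  chosen mixed gradient of the limit. This needs completeness of L2 and uniqueness of weak
  derivatives on D x D, which is why bump functions and the fundamental lemma are developed over an
  arbitrary Euclidean space.

  The form Q is studied on arrays of L2 functions rather than on functions, so that differences of
  gradients can be inserted without first identifying them as gradients.\<close>

section \<open>Square integrable functions\<close>

text \<open>\<open>L2\<close> is bound to \<open>lebesgue_on\<close>. An arbitrary measure lets the
  same lemmas serve D, D x D, the product measure, the probability space and its product with
  D.\<close>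

definition sq_int :: "'a measure \<Rightarrow> ('a \<Rightarrow> real) set" where
  "sq_int M = {u. u \<in> borel_measurable M \<and> integrable M (\<lambda>x. (u x)\<^sup>2)}"

definition nrm :: "'a measure \<Rightarrow> ('a \<Rightarrow> real) \<Rightarrow> real" where
  "nrm M u = sqrt (\<integral>x. (u x)\<^sup>2 \<partial>M)"

lemma L2_eq: "L2 D = sq_int (lebesgue_on D)"
  by (simp add: L2_def sq_int_def)

lemma L2_norm_eq: "L2_norm D u = nrm (lebesgue_on D) u"
  by (simp add: L2_norm_def nrm_def)

lemma sq_intD [dest]:
  assumes "u \<in> sq_int M"
  shows "u \<in> borel_measurable M" "integrable M (\<lambda>x. (u x)\<^sup>2)"
  using assms by (auto simp: sq_int_def)

lemma sq_intI: "u \<in> borel_measurable M \<Longrightarrow> integrable M (\<lambda>x. (u x)\<^sup>2) \<Longrightarrow> u \<in> sq_int M"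
  by (auto simp: sq_int_def)

lemma nrm_nonneg [simp]: "nrm M u \<ge> 0"
  by (simp add: nrm_def)

lemma nrm_power2: "(nrm M u)\<^sup>2 = (\<integral>x. (u x)\<^sup>2 \<partial>M)"
  by (simp add: nrm_def)

lemma sq_int_mult_integrable:
  assumes u: "u \<in> sq_int M" and v: "v \<in> sq_int M"
  shows "integrable M (\<lambda>x. u x * v x)"
proof (rule Bochner_Integration.integrable_bound)
  show "integrable M (\<lambda>x. (u x)\<^sup>2 + (v x)\<^sup>2)"
    using u v by auto
  show "(\<lambda>x. u x * v x) \<in> borel_measurable M"
    using u v by (auto dest!: sq_intD(1))
  have "\<bar>a * b\<bar> \<le> \<bar>a\<^sup>2 + b\<^sup>2\<bar>" for a b :: real
  proof -
    have "0 \<le> (\<bar>a\<bar> - \<bar>b\<bar>)\<^sup>2" "0 \<le> \<bar>a\<bar> * \<bar>b\<bar>" by simp_all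
    then have "\<bar>a\<bar> * \<bar>b\<bar> \<le> a\<^sup>2 + b\<^sup>2" unfolding power2_diff power2_abs by linarith
    then show ?thesis by (simp add: abs_mult)
  qed
  then show "AE x in M. norm (u x * v x) \<le> norm ((u x)\<^sup>2 + (v x)\<^sup>2)"
    by simp
qed

lemma sq_int_cmult:
  assumes "u \<in> sq_int M" shows "(\<lambda>x. c * u x) \<in> sq_int M"
  using assms by (auto simp: sq_int_def power_mult_distrib)

text \<open>Meant for the entries of A and for the coordinate function in the Poincare inequality. K
  carries no sign, since over a null space it may be negative; hence \<bar>K\<bar> in the
  estimate.\<close>

lemma sq_int_bounded_mult:
  assumes u: "u \<in> sq_int M" and c: "c \<in> borel_measurable M" "AE x in M. \<bar>c x\<bar> \<le> K"
  shows "(\<lambda>x. c x * u x) \<in> sq_int M" "nrm M (\<lambda>x. c x * u x) \<le> \<bar>K\<bar> * nrm M u"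
proof -
  have m: "(\<lambda>x. c x * u x) \<in> borel_measurable M"
    using u c by (auto dest!: sq_intD(1))
  have b: "AE x in M. (c x * u x)\<^sup>2 \<le> K\<^sup>2 * (u x)\<^sup>2"
    using c(2)
  proof eventually_elim
    case (elim x)
    then have "(c x)\<^sup>2 \<le> K\<^sup>2" by (simp add: abs_le_square_iff[symmetric])
    then show ?case by (simp add: power_mult_distrib mult_right_mono)
  qed
  have i: "integrable M (\<lambda>x. K\<^sup>2 * (u x)\<^sup>2)" using u by auto
  have i2: "integrable M (\<lambda>x. (c x * u x)\<^sup>2)"
    by (rule Bochner_Integration.integrable_bound[OF i]) (use m b in \<open>auto elim!: eventually_mono\<close>)
  then show "(\<lambda>x. c x * u x) \<in> sq_int M" using m by (intro sq_intI)
  have "(\<integral>x. (c x * u x)\<^sup>2 \<partial>M) \<le> (\<integral>x. K\<^sup>2 * (u x)\<^sup>2 \<partial>M)"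
    by (rule integral_mono_AE[OF i2 i b])
  then have "nrm M (\<lambda>x. c x * u x) \<le> sqrt (K\<^sup>2 * (\<integral>x. (u x)\<^sup>2 \<partial>M))"
    unfolding nrm_def by simp
  then show "nrm M (\<lambda>x. c x * u x) \<le> \<bar>K\<bar> * nrm M u"
    by (simp add: nrm_def real_sqrt_mult)
qed

lemma sq_int_add:
  assumes u: "u \<in> sq_int M" and v: "v \<in> sq_int M"
  shows "(\<lambda>x. u x + v x) \<in> sq_int M"
  using assms sq_int_mult_integrable[OF u v]
  by (auto simp: sq_int_def power2_sum mult.assoc)

lemma sq_int_diff:
  assumes u: "u \<in> sq_int M" and v: "v \<in> sq_int M"
  shows "(\<lambda>x. u x - v x) \<in> sq_int M"
  using sq_int_add[OF u sq_int_cmult[OF v, of "-1"]] by simp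

lemma sq_int_zero [simp]: "(\<lambda>x. 0) \<in> sq_int M"
  by (auto intro!: sq_intI)

lemma nrm_cong_AE:
  assumes "u \<in> borel_measurable M" "v \<in> borel_measurable M" "AE x in M. u x = v x"
  shows "nrm M u = nrm M v"
proof -
  have "(\<integral>x. (u x)\<^sup>2 \<partial>M) = (\<integral>x. (v x)\<^sup>2 \<partial>M)"
    by (rule integral_cong_AE) (use assms in \<open>auto elim!: eventually_mono\<close>)
  then show ?thesis by (simp add: nrm_def)
qed

lemma nrm_zero_AE:
  assumes u: "u \<in> sq_int M" and "nrm M u = 0" shows "AE x in M. u x = 0"
proof -
  have "(\<integral>x. (u x)\<^sup>2 \<partial>M) = 0" using assms(2) nrm_power2[of M u] by simp
  then have "AE x in M. (u x)\<^sup>2 = 0"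
    using u by (subst (asm) integral_nonneg_eq_0_iff_AE) auto
  then show ?thesis by simp
qed

lemma nrm_cmult: "nrm M (\<lambda>x. c * u x) = \<bar>c\<bar> * nrm M u"
  by (simp add: nrm_def power_mult_distrib real_sqrt_mult)

lemma nrm_minus_commute: "nrm M (\<lambda>x. u x - v x) = nrm M (\<lambda>x. v x - u x)"
  by (simp add: nrm_def power2_commute)

text \<open>Expand the integral of (a u - b v)^2 and choose as a the norm of v and as b plus or
  minus the norm of u. If one of the norms is 0 these weights give nothing, but then the product
  vanishes almost everywhere.\<close>

lemma nrm_Cauchy_Schwarz:
  assumes u: "u \<in> sq_int M" and v: "v \<in> sq_int M"
  shows "\<bar>\<integral>x. u x * v x \<partial>M\<bar> \<le> nrm M u * nrm M v"
proof -
  define s where "s = nrm M u"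
  define t where "t = nrm M v"
  define I where "I = (\<integral>x. u x * v x \<partial>M)"
  have int: "integrable M (\<lambda>x. (u x)\<^sup>2)" "integrable M (\<lambda>x. (v x)\<^sup>2)"
    "integrable M (\<lambda>x. u x * v x)"
    using u v sq_int_mult_integrable[OF u v] by auto
  have *: "2 * (a * b * I) \<le> a\<^sup>2 * s\<^sup>2 + b\<^sup>2 * t\<^sup>2" for a b
  proof -
    have "0 \<le> (\<integral>x. (a * u x - b * v x)\<^sup>2 \<partial>M)" by simp
    also have "\<dots> = (\<integral>x. a\<^sup>2 * (u x)\<^sup>2 + b\<^sup>2 * (v x)\<^sup>2 - 2 * a * b * (u x * v x) \<partial>M)"
      by (intro Bochner_Integration.integral_cong refl) (simp add: power2_eq_square algebra_simps)
    also have "\<dots> = a\<^sup>2 * s\<^sup>2 + b\<^sup>2 * t\<^sup>2 - 2 * (a * b * I)"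
      using int by (simp add: s_def t_def I_def nrm_power2)
    finally show ?thesis by simp
  qed
  have nn: "s \<ge> 0" "t \<ge> 0" by (simp_all add: s_def t_def)
  have z: "I = 0" if "s = 0 \<or> t = 0"
  proof -
    have "AE x in M. u x * v x = 0"
      using that nrm_zero_AE[OF u] nrm_zero_AE[OF v] unfolding s_def t_def
      by (auto elim!: eventually_mono)
    then show ?thesis unfolding I_def by (simp add: integral_eq_zero_AE)
  qed
  show ?thesis
  proof (cases "s = 0 \<or> t = 0")
    case True
    then show ?thesis using z nn by (auto simp: I_def[symmetric] s_def[symmetric] t_def[symmetric])
  next
    case False
    then have st: "s * t > 0" using nn by auto
    have "2 * (s * t) * I \<le> 2 * (s * t) * (s * t)"
      using *[of t s] by (simp add: power2_eq_square algebra_simps)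
    then have 1: "I \<le> s * t" using st by (metis mult_le_cancel_left_pos zero_less_mult_iff zero_less_numeral)
    have "2 * (s * t) * (- I) \<le> 2 * (s * t) * (s * t)"
      using *[of t "- s"] by (simp add: power2_eq_square algebra_simps)
    then have 2: "- I \<le> s * t" using st by (metis mult_le_cancel_left_pos zero_less_mult_iff zero_less_numeral)
    show ?thesis using 1 2 by (simp add: I_def s_def t_def)
  qed
qed

lemma nrm_triangle:
  assumes u: "u \<in> sq_int M" and v: "v \<in> sq_int M"
  shows "nrm M (\<lambda>x. u x + v x) \<le> nrm M u + nrm M v"
proof (rule power2_le_imp_le)
  have int: "integrable M (\<lambda>x. (u x)\<^sup>2)" "integrable M (\<lambda>x. (v x)\<^sup>2)"
    "integrable M (\<lambda>x. u x * v x)"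
    using u v sq_int_mult_integrable[OF u v] by auto
  have "(nrm M (\<lambda>x. u x + v x))\<^sup>2 = (\<integral>x. (u x)\<^sup>2 + (v x)\<^sup>2 + 2 * (u x * v x) \<partial>M)"
    unfolding nrm_power2 by (intro Bochner_Integration.integral_cong refl) (simp add: power2_sum mult.assoc)
  also have "\<dots> = (nrm M u)\<^sup>2 + (nrm M v)\<^sup>2 + 2 * (\<integral>x. u x * v x \<partial>M)"
    using int by (simp add: nrm_power2)
  also have "\<dots> \<le> (nrm M u + nrm M v)\<^sup>2"
    using nrm_Cauchy_Schwarz[OF u v] by (simp add: power2_sum)
  finally show "(nrm M (\<lambda>x. u x + v x))\<^sup>2 \<le> (nrm M u + nrm M v)\<^sup>2" .
qed simp

lemma nrm_triangle_diff:
  assumes u: "u \<in> sq_int M" and v: "v \<in> sq_int M" and w: "w \<in> sq_int M"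
  shows "nrm M (\<lambda>x. u x - w x) \<le> nrm M (\<lambda>x. u x - v x) + nrm M (\<lambda>x. v x - w x)"
  using nrm_triangle[OF sq_int_diff[OF u v] sq_int_diff[OF v w]] by simp

lemma nrm_triangle_diff_abs:
  assumes u: "u \<in> sq_int M" and v: "v \<in> sq_int M"
  shows "\<bar>nrm M u - nrm M v\<bar> \<le> nrm M (\<lambda>x. u x - v x)"
  using nrm_triangle_diff[OF u v sq_int_zero] nrm_triangle_diff[OF v u sq_int_zero]
    nrm_minus_commute[of M u v] by simp

lemma nrm_tendsto:
  assumes u: "\<And>n. u n \<in> sq_int M" and v: "v \<in> sq_int M"
    and "(\<lambda>n. nrm M (\<lambda>x. u n x - v x)) \<longlonglongrightarrow> 0"
  shows "(\<lambda>n. nrm M (u n)) \<longlonglongrightarrow> nrm M v"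
proof -
  have "(\<lambda>n. nrm M (u n) - nrm M v) \<longlonglongrightarrow> 0"
    by (rule Lim_null_comparison[OF _ assms(3)]) (use nrm_triangle_diff_abs[OF u v] in simp)
  then show ?thesis by (simp add: LIM_zero_iff)
qed

lemma sq_int_limit_unique:
  assumes u: "\<And>n. u n \<in> sq_int M" and v: "v \<in> sq_int M" and w: "w \<in> sq_int M"
    and lv: "(\<lambda>n. nrm M (\<lambda>x. u n x - v x)) \<longlonglongrightarrow> 0"
    and lw: "(\<lambda>n. nrm M (\<lambda>x. u n x - w x)) \<longlonglongrightarrow> 0"
  shows "AE x in M. v x = w x"
proof -
  have "(\<lambda>n. nrm M (\<lambda>x. u n x - v x) + nrm M (\<lambda>x. u n x - w x)) \<longlonglongrightarrow> 0 + 0"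
    by (intro tendsto_add lv lw)
  moreover have "nrm M (\<lambda>x. v x - w x) \<le> nrm M (\<lambda>x. u n x - v x) + nrm M (\<lambda>x. u n x - w x)" for n
    using nrm_triangle_diff[OF v u w, of n] nrm_minus_commute[of M v "u n"] by simp
  ultimately have "nrm M (\<lambda>x. v x - w x) \<le> 0 + 0"
    by (intro LIMSEQ_le_const) auto
  then have "nrm M (\<lambda>x. v x - w x) = 0" by (simp add: order.antisym)
  from nrm_zero_AE[OF sq_int_diff[OF v w] this] show ?thesis by simp
qed

text \<open>The limit passage behind weak derivatives, Q and the right-hand side: u v - u' v' = (u -
  u') v + u' (v - v'), and the norms of \<open>v n\<close> converge, hence stay bounded.\<close>

lemma sq_int_product_tendsto:
  assumes u: "\<And>n. u n \<in> sq_int M" "u' \<in> sq_int M" and v: "\<And>n. v n \<in> sq_int M" "v' \<in> sq_int M"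
    and lu: "(\<lambda>n. nrm M (\<lambda>x. u n x - u' x)) \<longlonglongrightarrow> 0"
    and lv: "(\<lambda>n. nrm M (\<lambda>x. v n x - v' x)) \<longlonglongrightarrow> 0"
  shows "(\<lambda>n. \<integral>x. u n x * v n x \<partial>M) \<longlonglongrightarrow> (\<integral>x. u' x * v' x \<partial>M)"
proof -
  have bound: "norm ((\<integral>x. u n x * v n x \<partial>M) - (\<integral>x. u' x * v' x \<partial>M))
      \<le> nrm M (\<lambda>x. u n x - u' x) * nrm M (v n) + nrm M u' * nrm M (\<lambda>x. v n x - v' x)" for n
  proof -
    have "(\<integral>x. u n x * v n x \<partial>M) - (\<integral>x. u' x * v' x \<partial>M)
        = (\<integral>x. (u n x - u' x) * v n x \<partial>M) + (\<integral>x. u' x * (v n x - v' x) \<partial>M)"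
      using sq_int_mult_integrable[OF u(1) v(1), of n n] sq_int_mult_integrable[OF u(2) v(1), of n]
        sq_int_mult_integrable[OF u(2) v(2)]
      by (simp add: left_diff_distrib right_diff_distrib)
    then show ?thesis
      using nrm_Cauchy_Schwarz[OF sq_int_diff[OF u(1) u(2)] v(1), of n n]
        nrm_Cauchy_Schwarz[OF u(2) sq_int_diff[OF v(1) v(2)], of n]
      unfolding real_norm_def by linarith
  qed
  have "(\<lambda>n. nrm M (\<lambda>x. u n x - u' x) * nrm M (v n) + nrm M u' * nrm M (\<lambda>x. v n x - v' x))
      \<longlonglongrightarrow> 0 * nrm M v' + nrm M u' * 0"
    by (intro tendsto_intros lu lv nrm_tendsto v)
  then have "(\<lambda>n. (\<integral>x. u n x * v n x \<partial>M) - (\<integral>x. u' x * v' x \<partial>M)) \<longlonglongrightarrow> 0"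
    by (intro Lim_null_comparison[OF always_eventually[OF allI[OF bound]]]) simp
  then show ?thesis by (simp add: LIM_zero_iff)
qed
lemma (in finite_measure) bounded_in_sq_int:
  assumes "u \<in> borel_measurable M" "\<And>x. x \<in> space M \<Longrightarrow> \<bar>u x\<bar> \<le> K"
  shows "u \<in> sq_int M"
proof (rule sq_intI[OF assms(1)])
  have "(u x)\<^sup>2 \<le> K\<^sup>2" if "x \<in> space M" for x
    using abs_ge_zero assms(2)[OF that] by (intro abs_le_square_iff[THEN iffD1]) linarith
  then show "integrable M (\<lambda>x. (u x)\<^sup>2)"
    by (intro integrable_const_bound[where B="K\<^sup>2"]) (use assms(1) in auto)
qed

text \<open>Riesz-Fischer. A subsequence with geometrically small increments converges almost
  everywhere; Fatou's lemma along it turns the Cauchy estimate into an estimate of the distance to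
  the pointwise limit.\<close>

lemma (in finite_measure) nrm_complete:
  fixes f :: "nat \<Rightarrow> 'a \<Rightarrow> real"
  assumes f: "\<And>n. f n \<in> sq_int M"
    and cauchy: "\<And>\<epsilon>. \<epsilon> > 0 \<Longrightarrow> \<exists>K. \<forall>m\<ge>K. \<forall>n\<ge>K. nrm M (\<lambda>x. f m x - f n x) < \<epsilon>"
  shows "\<exists>g\<in>sq_int M. (\<lambda>n. nrm M (\<lambda>x. f n x - g x)) \<longlonglongrightarrow> 0"
proof -
  have fm[measurable]: "f n \<in> borel_measurable M" for n using f by auto
  \<comment> \<open>On a finite measure space the constant 1 is square integrable, so Cauchy-Schwarz
    bounds L1 norms by C times L2 norms; the increments are summed in L1.\<close>
  define C where "C = nrm M (\<lambda>x. 1)"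
  have one: "(\<lambda>x. 1) \<in> sq_int M" by (rule bounded_in_sq_int[where K=1]) auto
  have "\<exists>N. \<forall>k. (\<forall>m\<ge>N k. \<forall>n\<ge>N k. nrm M (\<lambda>x. f m x - f n x) < (1/2)^k)"
    by (intro choice allI cauchy) simp
  then obtain N where N: "\<And>k m n. m \<ge> N k \<Longrightarrow> n \<ge> N k \<Longrightarrow> nrm M (\<lambda>x. f m x - f n x) < (1/2)^k"
    by blast
  \<comment> \<open>The partial sum is at least \<open>N i\<close> for every i \<le> k, so
    \<open>r k\<close> and all later indices are admissible in the estimate belonging to k.\<close>
  define r where "r k = (\<Sum>i\<le>k. N i)" for k
  have rN: "r k \<ge> N k" "r (Suc k) \<ge> N k" for k
    unfolding r_def by (rule member_le_sum; simp)+
  define d where "d k x = \<bar>f (r (Suc k)) x - f (r k) x\<bar>" for k x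
  have dnn: "d k x \<ge> 0" for k x by (simp add: d_def)
  have df: "(\<lambda>x. f (r (Suc k)) x - f (r k) x) \<in> sq_int M" for k
    by (intro sq_int_diff f)
  have dsq: "d k \<in> sq_int M" for k
    using df[of k] unfolding d_def[abs_def] by (auto simp: sq_int_def)
  have di: "integrable M (d k)" for k
    using sq_int_mult_integrable[OF dsq one] by simp
  have dle: "(\<integral>x. d k x \<partial>M) \<le> C * (1/2)^k" for k
  proof -
    have "(\<integral>x. d k x * 1 \<partial>M) \<le> nrm M (d k) * C"
      using nrm_Cauchy_Schwarz[OF dsq one] unfolding C_def by (simp add: abs_le_iff)
    also have "nrm M (d k) = nrm M (\<lambda>x. f (r (Suc k)) x - f (r k) x)"
      by (simp add: nrm_def d_def)
    also have "\<dots> * C \<le> (1/2)^k * C"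
      using N[OF rN(2) rN(1), of k] by (intro mult_right_mono) (simp_all add: C_def)
    finally show ?thesis by (simp add: mult.commute)
  qed
  have sm: "summable (\<lambda>k. \<integral>x. norm (d k x) \<partial>M)"
  proof (rule summable_comparison_test')
    show "summable (\<lambda>k. C * (1/2)^k)" by (intro summable_mult summable_geometric) simp
    show "norm (\<integral>x. norm (d k x) \<partial>M) \<le> C * (1/2)^k" for k
      using dle[of k] by (simp add: d_def)
  qed
  have "AE x in M. summable (\<lambda>k. d k x)"
  proof -
    have "(\<integral>\<^sup>+x. (\<Sum>k. ennreal (d k x)) \<partial>M) = (\<Sum>k. \<integral>\<^sup>+x. ennreal (d k x) \<partial>M)"
      by (rule nn_integral_suminf) (use di in measurable)
    also have "\<dots> = (\<Sum>k. ennreal (\<integral>x. d k x \<partial>M))"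
      by (intro suminf_cong nn_integral_eq_integral di) (simp add: d_def)
    also have "\<dots> \<noteq> \<infinity>"
    proof -
      have "summable (\<lambda>k. \<integral>x. d k x \<partial>M)" using sm dnn by simp
      then show ?thesis
        by (subst suminf_ennreal2) (simp_all add: dnn)
    qed
    finally have "AE x in M. (\<Sum>k. ennreal (d k x)) \<noteq> \<infinity>"
      by (intro nn_integral_noteq_infinite) (use di in measurable)
    then show ?thesis
    proof eventually_elim
      case (elim x)
      show ?case
        by (rule summable_suminf_not_top) (use elim in \<open>simp_all add: d_def\<close>)
    qed
  qed
  then have "AE x in M. convergent (\<lambda>k. f (r k) x)"
  proof eventually_elim
    case (elim x)
    then have "summable (\<lambda>k. f (r (Suc k)) x - f (r k) x)"
      unfolding d_def by (rule summable_rabs_cancel)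
    then have "convergent (\<lambda>n. \<Sum>k<n. f (r (Suc k)) x - f (r k) x)"
      by (simp add: summable_iff_convergent)
    then have "convergent (\<lambda>n. f (r n) x - f (r 0) x)"
      using sum_lessThan_telescope[of "\<lambda>n. f (r n) x"] by simp
    then have "convergent (\<lambda>n. (f (r n) x - f (r 0) x) + f (r 0) x)"
      by (rule convergent_add[OF _ convergent_const])
    then show ?case by simp
  qed
  then have conv: "AE x in M. (\<lambda>k. f (r k) x) \<longlonglongrightarrow> lim (\<lambda>k. f (r k) x)"
    by (simp add: convergent_LIMSEQ_iff)
  define g where "g x = lim (\<lambda>k. f (r k) x)" for x
  have gm[measurable]: "g \<in> borel_measurable M" unfolding g_def by measurable
  have key: "(\<integral>\<^sup>+x. ennreal ((f n x - g x)\<^sup>2) \<partial>M) \<le> ennreal (((1/2)^k)\<^sup>2)" if "n \<ge> N k" for n k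
  proof -
    have "(\<integral>\<^sup>+x. ennreal ((f n x - g x)\<^sup>2) \<partial>M)
        = (\<integral>\<^sup>+x. liminf (\<lambda>j. ennreal ((f n x - f (r j) x)\<^sup>2)) \<partial>M)"
    proof (rule nn_integral_cong_AE)
      show "AE x in M. ennreal ((f n x - g x)\<^sup>2) = liminf (\<lambda>j. ennreal ((f n x - f (r j) x)\<^sup>2))"
        using conv
      proof eventually_elim
        case (elim x)
        have "(\<lambda>j. ennreal ((f n x - f (r j) x)\<^sup>2)) \<longlonglongrightarrow> ennreal ((f n x - g x)\<^sup>2)"
          unfolding g_def by (intro tendsto_ennrealI tendsto_intros elim)
        then show ?case by (intro lim_imp_Liminf[symmetric]) auto
      qed
    qed
    also have "\<dots> \<le> liminf (\<lambda>j. \<integral>\<^sup>+x. ennreal ((f n x - f (r j) x)\<^sup>2) \<partial>M)"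
      by (rule nn_integral_liminf) simp
    also have "\<dots> \<le> limsup (\<lambda>j. \<integral>\<^sup>+x. ennreal ((f n x - f (r j) x)\<^sup>2) \<partial>M)"
      by (rule Liminf_le_Limsup) simp
    also have "\<dots> \<le> ennreal (((1/2)^k)\<^sup>2)"
    proof (rule Limsup_bounded, rule eventually_sequentiallyI)
      fix j assume "j \<ge> k"
      have "N k \<le> (\<Sum>i\<le>j. N i)" using \<open>j \<ge> k\<close> by (intro member_le_sum) auto
      then have "N k \<le> r j" unfolding r_def .
      have sq: "(\<lambda>x. f n x - f (r j) x) \<in> sq_int M" by (intro sq_int_diff f)
      have "(\<integral>\<^sup>+x. ennreal ((f n x - f (r j) x)\<^sup>2) \<partial>M) = ennreal (\<integral>x. (f n x - f (r j) x)\<^sup>2 \<partial>M)"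
        using sq by (intro nn_integral_eq_integral) auto
      also have "\<dots> = ennreal ((nrm M (\<lambda>x. f n x - f (r j) x))\<^sup>2)" by (simp add: nrm_power2)
      also have "\<dots> \<le> ennreal (((1/2)^k)\<^sup>2)"
        using N[OF that \<open>N k \<le> r j\<close>] by (intro ennreal_leI power_mono) auto
      finally show "(\<integral>\<^sup>+x. ennreal ((f n x - f (r j) x)\<^sup>2) \<partial>M) \<le> ennreal (((1/2)^k)\<^sup>2)" .
    qed
    finally show ?thesis .
  qed
  have diffsq: "(\<lambda>x. f n x - g x) \<in> sq_int M" if "n \<ge> N k" for n k
  proof (rule sq_intI)
    show "integrable M (\<lambda>x. (f n x - g x)\<^sup>2)"
      using order_le_less_trans[OF key[OF that] ennreal_less_top] by (intro integrableI_bounded) simp_all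
  qed simp
  have "g \<in> sq_int M"
    using sq_int_diff[OF f[of "N 0"] diffsq[of 0 "N 0"]] by simp
  moreover have "(\<lambda>n. nrm M (\<lambda>x. f n x - g x)) \<longlonglongrightarrow> 0"
  proof (rule LIMSEQ_I)
    fix e :: real assume "e > 0"
    then obtain k where k: "(1/2)^k < e" using real_arch_pow_inv[of e "1/2"] by fastforce
    have "nrm M (\<lambda>x. f n x - g x) < e" if n: "n \<ge> N k" for n
    proof -
      have "ennreal (\<integral>x. (f n x - g x)\<^sup>2 \<partial>M) \<le> ennreal (((1/2)^k)\<^sup>2)"
        using key[OF n] diffsq[OF n] by (subst nn_integral_eq_integral[symmetric]) auto
      then have "(nrm M (\<lambda>x. f n x - g x))\<^sup>2 \<le> ((1/2)^k)\<^sup>2"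
        by (simp add: nrm_power2)
      then have "nrm M (\<lambda>x. f n x - g x) \<le> (1/2)^k"
        by (rule power2_le_imp_le) simp
      then show ?thesis using k by simp
    qed
    then show "\<exists>no. \<forall>n\<ge>no. norm (nrm M (\<lambda>x. f n x - g x) - 0) < e"
      by (intro exI[of _ "N k"]) simp
  qed
  ultimately show ?thesis by blast
qed

section \<open>Smooth functions\<close>

lemma partial_derivI:
  "(f has_derivative f') (at x) \<Longrightarrow> partial_deriv b f x = f' b"
  unfolding partial_deriv_def by (metis frechet_derivative_at)

lemma has_derivative_partial_deriv:
  "f differentiable (at x) \<Longrightarrow> (f has_derivative (\<lambda>b. partial_deriv b f x)) (at x)"
  unfolding partial_deriv_def by (metis eta_contract_eq frechet_derivative_works)

lemma partial_deriv_add: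
  assumes "\<And>x. f differentiable (at x)" "\<And>x. g differentiable (at x)"
  shows "partial_deriv b (\<lambda>x. f x + g x) = (\<lambda>x. partial_deriv b f x + partial_deriv b g x)"
  by (rule ext, rule partial_derivI[OF has_derivative_add])
    (intro has_derivative_partial_deriv assms)+

lemma partial_deriv_mult:
  assumes "\<And>x. f differentiable (at x)" "\<And>x. g differentiable (at x)"
  shows "partial_deriv b (\<lambda>x. f x * g x) = (\<lambda>x. f x * partial_deriv b g x + partial_deriv b f x * g x)"
  by (rule ext, rule partial_derivI[OF has_derivative_mult])
    (intro has_derivative_partial_deriv assms)+

lemma partial_deriv_const: "partial_deriv b (\<lambda>x. c) = (\<lambda>x. 0)"
  by (rule ext, rule partial_derivI[OF has_derivative_const])

lemma differentiable_imp_continuous_on_UNIV: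
  assumes "\<And>x. f differentiable (at x)" shows "continuous_on UNIV f"
  using assms by (meson continuous_at_imp_continuous_on differentiable_imp_continuous_within)

lemma C_k_Suc_imp: "C_k (Suc k) f \<Longrightarrow> C_k k f"
proof (induction k arbitrary: f)
  case 0
  then show ?case by (simp add: differentiable_imp_continuous_on_UNIV)
next
  case (Suc k)
  have "\<forall>x. f differentiable (at x)" "\<forall>b\<in>Basis. C_k (Suc k) (partial_deriv b f)"
    using Suc.prems unfolding C_k.simps(2)[of "Suc k"] by auto
  then show ?case using Suc.IH by simp
qed

text \<open>Replaces the computation of all higher derivatives: it suffices to exhibit a family of
  functions that differentiation does not leave, as for the constants and the bump functions
  below.\<close>

lemma C_k_coinduct:
  assumes "f \<in> S" and "\<And>f x. f \<in> S \<Longrightarrow> f differentiable (at x)"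
    and "\<And>f b. f \<in> S \<Longrightarrow> b \<in> Basis \<Longrightarrow> partial_deriv b f \<in> S"
  shows "C_k k f"
  using assms(1)
proof (induction k arbitrary: f)
  case 0
  then show ?case by (simp add: differentiable_imp_continuous_on_UNIV assms(2))
next
  case (Suc k)
  then show ?case using assms(2,3) by simp
qed

lemma C_k_const: "C_k k (\<lambda>x. c)"
proof (rule C_k_coinduct[where S="range (\<lambda>c x. c)"])
  show "partial_deriv b f \<in> range (\<lambda>c x. c)" if "f \<in> range (\<lambda>c x. c)" for f b
    using that by (auto simp: partial_deriv_const)
qed auto

lemma C_k_add: "C_k k f \<Longrightarrow> C_k k g \<Longrightarrow> C_k k (\<lambda>x. f x + g x)"
proof (induction k arbitrary: f g)
  case 0
  then show ?case by (simp add: continuous_on_add)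
next
  case (Suc k)
  then show ?case by (auto simp: partial_deriv_add intro!: differentiable_add)
qed

lemma C_k_mult: "C_k k f \<Longrightarrow> C_k k g \<Longrightarrow> C_k k (\<lambda>x. f x * g x)"
proof (induction k arbitrary: f g)
  case 0
  then show ?case by (simp add: continuous_on_mult)
next
  case (Suc k)
  have "C_k k f" "C_k k g" using Suc.prems C_k_Suc_imp by auto
  then show ?case using Suc
    by (auto simp: partial_deriv_mult intro!: differentiable_mult C_k_add)
qed

lemma C_k_prod: "(\<And>i. i \<in> I \<Longrightarrow> C_k k (f i)) \<Longrightarrow> C_k k (\<lambda>x. \<Prod>i\<in>I. f i x)"
  by (induction I rule: infinite_finite_induct) (auto intro: C_k_const C_k_mult)

lemma partial_deriv_section:
  fixes f :: "'a::euclidean_space \<times> 'b::euclidean_space \<Rightarrow> real"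
  assumes "\<And>z. f differentiable (at z)"
  shows "partial_deriv b (\<lambda>x. f (x, y)) = (\<lambda>x. partial_deriv (b, 0) f (x, y))"
    and "partial_deriv c (\<lambda>y. f (x, y)) = (\<lambda>y. partial_deriv (0, c) f (x, y))"
proof -
  show "partial_deriv b (\<lambda>x. f (x, y)) = (\<lambda>x. partial_deriv (b, 0) f (x, y))"
  proof (rule ext)
    fix x
    have "((\<lambda>x. f (x, y)) has_derivative (\<lambda>h. partial_deriv (h, 0) f (x, y))) (at x)"
      by (rule has_derivative_compose[OF has_derivative_Pair[OF has_derivative_ident has_derivative_const]
            has_derivative_partial_deriv[OF assms]])
    then show "partial_deriv b (\<lambda>x. f (x, y)) x = partial_deriv (b, 0) f (x, y)"
      by (rule partial_derivI)
  qed
  show "partial_deriv c (\<lambda>y. f (x, y)) = (\<lambda>y. partial_deriv (0, c) f (x, y))"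
  proof (rule ext)
    fix y
    have "((\<lambda>y. f (x, y)) has_derivative (\<lambda>h. partial_deriv (0, h) f (x, y))) (at y)"
      by (rule has_derivative_compose[OF has_derivative_Pair[OF has_derivative_const has_derivative_ident]
            has_derivative_partial_deriv[OF assms]])
    then show "partial_deriv c (\<lambda>y. f (x, y)) y = partial_deriv (0, c) f (x, y)"
      by (rule partial_derivI)
  qed
qed

lemma differentiable_section:
  fixes f :: "'a::euclidean_space \<times> 'b::euclidean_space \<Rightarrow> real"
  assumes "\<And>z. f differentiable (at z)"
  shows "(\<lambda>x. f (x, y)) differentiable (at x)" "(\<lambda>y. f (x, y)) differentiable (at y)"
  using has_derivative_compose[OF has_derivative_Pair[OF has_derivative_ident has_derivative_const]
            has_derivative_partial_deriv[OF assms], where s=UNIV]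
    has_derivative_compose[OF has_derivative_Pair[OF has_derivative_const has_derivative_ident]
            has_derivative_partial_deriv[OF assms], where s=UNIV]
  unfolding differentiable_def by blast+

lemma C_k_section:
  fixes f :: "'a::euclidean_space \<times> 'b::euclidean_space \<Rightarrow> real"
  shows "C_k k f \<Longrightarrow> C_k k (\<lambda>x. f (x, y))" "C_k k f \<Longrightarrow> C_k k (\<lambda>y. f (x, y))"
proof (induction k arbitrary: f)
  case 0
  {
    case 1
    then show ?case
      by (auto intro!: continuous_on_compose2[where g=f and t=UNIV and f="\<lambda>x. (x, y)"] continuous_intros)
  next
    case 2
    then show ?case
      by (auto intro!: continuous_on_compose2[where g=f and t=UNIV and f="\<lambda>y. (x, y)"] continuous_intros)
  }
next
  case (Suc k)
  {
    case 1
    have d: "\<And>z. f differentiable (at z)" using 1 unfolding C_k.simps by blast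
    from 1 show ?case
      by (simp add: partial_deriv_section[OF d] differentiable_section[OF d] Suc.IH)
        (auto simp: Basis_prod_def intro!: Suc.IH)
  next
    case 2
    have d: "\<And>z. f differentiable (at z)" using 2 unfolding C_k.simps by blast
    from 2 show ?case
      by (simp add: partial_deriv_section[OF d] differentiable_section[OF d] Suc.IH)
        (auto simp: Basis_prod_def intro!: Suc.IH)
  }
qed

section \<open>Smooth bump functions\<close>

text \<open>For p = 1 this is the classical flat function exp(-1/t). Differentiating it produces
  polynomials in 1/t; carrying the factor p(1/t) along closes the family under derivatives.\<close>

definition bump :: "real poly \<Rightarrow> real \<Rightarrow> real" where
  "bump p t = (if t > 0 then poly p (1 / t) * exp (- (1 / t)) else 0)"

lemma poly_div_exp_tendsto_0: "((\<lambda>s. poly p s * exp (- s)) \<longlongrightarrow> (0::real)) at_top"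
proof -
  have "((\<lambda>s. \<Sum>i\<le>degree p. coeff p i * (s ^ i / exp s)) \<longlongrightarrow> (\<Sum>i\<le>degree p. coeff p i * 0)) at_top"
    by (intro tendsto_intros tendsto_power_div_exp_0)
  moreover have "(\<Sum>i\<le>degree p. coeff p i * (s ^ i / exp s)) = poly p s * exp (- s)" for s
    by (simp add: poly_altdef exp_minus sum_distrib_right divide_inverse mult.assoc)
  ultimately show ?thesis by simp
qed

lemma bump_tendsto_0: "(bump p \<longlongrightarrow> 0) (at 0)"
proof -
  have "((\<lambda>t. poly p (1 / t) * exp (- (1 / t))) \<longlongrightarrow> 0) (at_right 0)"
    by (rule filterlim_compose[OF poly_div_exp_tendsto_0])
      (simp add: filterlim_inverse_at_top_right divide_inverse)
  moreover have "\<forall>\<^sub>F t in at_right 0. poly p (1 / t) * exp (- (1 / t)) = bump p t"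
    by (rule eventually_at_rightI[of 0 1]) (auto simp: bump_def)
  ultimately have r: "(bump p \<longlongrightarrow> 0) (at_right 0)" by (rule Lim_transform_eventually)
  have "\<forall>\<^sub>F t in at_left 0. 0 = bump p t"
    by (rule eventually_at_leftI[of "-1" 0]) (auto simp: bump_def)
  then have l: "(bump p \<longlongrightarrow> 0) (at_left 0)" by (rule Lim_transform_eventually[OF tendsto_const])
  show ?thesis using l r by (simp add: filterlim_at_split)
qed

text \<open>With s = 1/t the derivative of p(s) exp(-s) is s^2 (p(s) - p'(s)) exp(-s), and
  \<open>[:0, 0, 1:]\<close> is s^2. At t = 0 the difference quotient is treated directly.\<close>

lemma bump_deriv:
  "(bump p has_real_derivative bump ([:0, 0, 1:] * (p - pderiv p)) t) (at t)"
proof -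
  consider "t > 0" | "t < 0" | "t = 0" by linarith
  then show ?thesis
  proof cases
    case 1
    have "((\<lambda>t. poly p (1 / t) * exp (- (1 / t))) has_real_derivative
        bump ([:0, 0, 1:] * (p - pderiv p)) t) (at t)"
      using 1 by (auto intro!: derivative_eq_intros simp: bump_def field_simps power2_eq_square)
    then show ?thesis
      by (rule has_field_derivative_transform_within_open[where S="{0<..}"])
        (use 1 in \<open>auto simp: bump_def\<close>)
  next
    case 2
    have "((\<lambda>t. 0) has_real_derivative bump ([:0, 0, 1:] * (p - pderiv p)) t) (at t)"
      using 2 by (simp add: bump_def)
    then show ?thesis
      by (rule has_field_derivative_transform_within_open[where S="{..<0}"])
        (use 2 in \<open>auto simp: bump_def\<close>)
  next
    case 3
    \<comment> \<open>Division by h multiplies the polynomial by 1/h, so the quotient is itself a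
      bump and tends to 0.\<close>
    have "(\<lambda>h. (bump p (0 + h) - bump p 0) / h) = bump ([:0, 1:] * p)"
      by (auto simp: bump_def fun_eq_iff)
    then have "(\<lambda>h. (bump p (0 + h) - bump p 0) / h) \<midarrow>0\<rightarrow> 0"
      by (simp only: bump_tendsto_0)
    then show ?thesis using 3 by (simp add: DERIV_def bump_def)
  qed
qed

lemma C_k_bump_affine:
  "C_k k (\<lambda>x::'a::euclidean_space. bump p (c \<bullet> x + d))"
\<comment> \<open>The scalar r absorbs the factor \<open>c \<bullet> b\<close> that the chain rule
  produces.\<close>
proof (rule C_k_coinduct[where S="{\<lambda>x. r * bump p (c \<bullet> x + d) | r p. True}"])
  show "(\<lambda>x. bump p (c \<bullet> x + d)) \<in> {\<lambda>x. r * bump p (c \<bullet> x + d) | r p. True}"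
    by (auto intro!: exI[of _ 1] exI[of _ p])
  have der: "((\<lambda>x::'a. r * bump p (c \<bullet> x + d)) has_derivative
      (\<lambda>h. r * ((c \<bullet> h) * bump ([:0, 0, 1:] * (p - pderiv p)) (c \<bullet> x + d)))) (at x)" for r p x
  proof -
    have 1: "((\<lambda>x. c \<bullet> x + d) has_derivative (\<lambda>h. c \<bullet> h)) (at x)"
      by (auto intro!: derivative_eq_intros)
    have "((\<lambda>x. bump p (c \<bullet> x + d)) has_derivative
        (\<lambda>h. (c \<bullet> h) * bump ([:0, 0, 1:] * (p - pderiv p)) (c \<bullet> x + d))) (at x)"
      using has_derivative_compose[OF 1 bump_deriv[unfolded has_field_derivative_def]]
      by (simp add: mult.commute)
    then show ?thesis by (rule has_derivative_mult_right)
  qed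
  show "f differentiable (at x)" if "f \<in> {\<lambda>x. r * bump p (c \<bullet> x + d) | r p. True}" for f x
    using that der unfolding differentiable_def by blast
  show "partial_deriv b f \<in> {\<lambda>x. r * bump p (c \<bullet> x + d) | r p. True}"
    if f: "f \<in> {\<lambda>x. r * bump p (c \<bullet> x + d) | r p. True}" for f b
  proof -
    obtain r p where f: "f = (\<lambda>x. r * bump p (c \<bullet> x + d))" using f by blast
    have "partial_deriv b f = (\<lambda>x. (r * (c \<bullet> b)) * bump ([:0, 0, 1:] * (p - pderiv p)) (c \<bullet> x + d))"
      unfolding f by (simp add: fun_eq_iff partial_derivI[OF der] mult.assoc)
    then show ?thesis by blast
  qed
qed

text \<open>Each factor exp(-1/((n+1) t)) tends to 1 where the distance t to a face is positive. The
  functions thus approximate the indicator of the open box and are bounded by it, which suits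
  dominated convergence.\<close>

definition box_bump :: "'a::euclidean_space \<Rightarrow> 'a \<Rightarrow> nat \<Rightarrow> 'a \<Rightarrow> real" where
  "box_bump a b n x = (\<Prod>i\<in>Basis. bump 1 (real (Suc n) * (x \<bullet> i - a \<bullet> i)) * bump 1 (real (Suc n) * (b \<bullet> i - x \<bullet> i)))"

lemma bump_1_bounds: "0 \<le> bump 1 t" "bump 1 t \<le> 1"
  by (auto simp: bump_def)

lemma box_bump_smooth: "C_k k (box_bump a b n)"
proof -
  have "C_k k (\<lambda>x. bump 1 ((real (Suc n) *\<^sub>R i) \<bullet> x + (- real (Suc n) * (a \<bullet> i))) *
      bump 1 ((- real (Suc n) *\<^sub>R i) \<bullet> x + real (Suc n) * (b \<bullet> i)))" for i
    by (intro C_k_mult C_k_bump_affine)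
  also have "(\<lambda>x. bump 1 ((real (Suc n) *\<^sub>R i) \<bullet> x + (- real (Suc n) * (a \<bullet> i))) *
      bump 1 ((- real (Suc n) *\<^sub>R i) \<bullet> x + real (Suc n) * (b \<bullet> i)))
    = (\<lambda>x. bump 1 (real (Suc n) * (x \<bullet> i - a \<bullet> i)) * bump 1 (real (Suc n) * (b \<bullet> i - x \<bullet> i)))" for i
    by (simp add: algebra_simps inner_commute)
  finally show ?thesis
    unfolding box_bump_def[abs_def] by (intro C_k_prod)
qed

lemma box_bump_bounds: "0 \<le> box_bump a b n x" "box_bump a b n x \<le> 1"
  unfolding box_bump_def
  by (auto intro!: prod_nonneg prod_le_1 mult_nonneg_nonneg mult_le_one bump_1_bounds)

lemma box_bump_outside: "x \<notin> box a b \<Longrightarrow> box_bump a b n x = 0"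
proof -
  assume "x \<notin> box a b"
  then obtain i where i: "i \<in> Basis" "\<not> (a \<bullet> i < x \<bullet> i \<and> x \<bullet> i < b \<bullet> i)"
    by (auto simp: box_def)
  then have "real (Suc n) * (x \<bullet> i - a \<bullet> i) \<le> 0 \<or> real (Suc n) * (b \<bullet> i - x \<bullet> i) \<le> 0"
    by (auto simp: mult_le_0_iff)
  then have "bump 1 (real (Suc n) * (x \<bullet> i - a \<bullet> i)) * bump 1 (real (Suc n) * (b \<bullet> i - x \<bullet> i)) = 0"
    by (auto simp: bump_def)
  then show ?thesis
    unfolding box_bump_def using i(1) by (intro prod_zero finite_Basis bexI)
qed

lemma box_bump_tendsto: "(\<lambda>n. box_bump a b n x) \<longlonglongrightarrow> indicator (box a b) x"
proof (cases "x \<in> box a b")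
  case True
  have 1: "(\<lambda>n. bump 1 (real (Suc n) * t)) \<longlonglongrightarrow> 1" if "t > 0" for t
  proof -
    have "(\<lambda>n. exp (- (1 / t * inverse (real (Suc n))))) \<longlonglongrightarrow> exp (- (1 / t * 0))"
      by (intro tendsto_intros LIMSEQ_inverse_real_of_nat)
    moreover have "exp (- (1 / t * inverse (real (Suc n)))) = bump 1 (real (Suc n) * t)" for n
      using that by (simp add: bump_def field_simps add_pos_nonneg)
    ultimately show ?thesis by simp
  qed
  have "(\<lambda>n. box_bump a b n x) \<longlonglongrightarrow> (\<Prod>i\<in>(Basis::'a set). 1 * 1)"
    unfolding box_bump_def using True
    by (intro tendsto_prod tendsto_mult 1) (auto simp: box_def)
  then show ?thesis using True by simp
next
  case False
  then show ?thesis by (simp add: box_bump_outside)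
qed

lemma box_bump_test:
  assumes "cbox a b \<subseteq> D" shows "box_bump a b n \<in> test_functions D"
proof -
  have sub: "{x. box_bump a b n x \<noteq> 0} \<subseteq> cbox a b"
    using box_bump_outside box_subset_cbox by blast
  then have "closure {x. box_bump a b n x \<noteq> 0} \<subseteq> cbox a b"
    by (rule closure_minimal) (rule closed_cbox)
  moreover have "compact (closure {x. box_bump a b n x \<noteq> 0})"
    using bounded_subset[OF bounded_cbox sub] by (simp add: compact_closure)
  ultimately show ?thesis
    unfolding test_functions_def using assms box_bump_smooth by auto
qed

section \<open>Integration by parts and the fundamental lemma of the calculus of variations\<close>

(* Differentiating the translation invariance of the Lebesgue integral makes the integral of a
   directional derivative vanish. *)
lemma integral_partial_deriv_eq_0:
  fixes \<phi> :: "'a::euclidean_space \<Rightarrow> real"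
  assumes diff: "\<And>x. \<phi> differentiable (at x)" and cont: "continuous_on UNIV (partial_deriv b \<phi>)"
    and supp: "\<And>x. \<phi> x \<noteq> 0 \<Longrightarrow> norm x \<le> R"
  shows "(\<integral>x. partial_deriv b \<phi> x \<partial>lborel) = 0"
proof -
  define d where "d = partial_deriv b \<phi>"
  \<comment> \<open>Contains every x for which x + h b meets the support for some h in [0,1];
    outside B all the difference quotients below vanish.\<close>
  define B where "B = cball (0::'a) (R + norm b)"
  have c\<phi>: "continuous_on UNIV \<phi>" by (rule differentiable_imp_continuous_on_UNIV[OF diff])
  have m\<phi>: "\<phi> \<in> borel_measurable borel" by (rule borel_measurable_continuous_onI[OF c\<phi>])
  have md: "d \<in> borel_measurable borel" unfolding d_def by (rule borel_measurable_continuous_onI[OF cont])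
  have dline: "((\<lambda>t. \<phi> (x + t *\<^sub>R b)) has_real_derivative d (x + t *\<^sub>R b)) (at t)" for x t
  proof -
    have 1: "((\<lambda>t. x + t *\<^sub>R b) has_derivative (\<lambda>h. h *\<^sub>R b)) (at t)"
      by (auto intro!: derivative_eq_intros)
    have 2: "linear (\<lambda>b. partial_deriv b \<phi> (x + t *\<^sub>R b'))" for b'
      unfolding partial_deriv_def using linear_frechet_derivative[OF diff] by (simp add: eta_contract_eq)
    have "((\<lambda>t. \<phi> (x + t *\<^sub>R b)) has_derivative (\<lambda>h. partial_deriv (h *\<^sub>R b) \<phi> (x + t *\<^sub>R b))) (at t)"
      by (rule has_derivative_compose[OF 1 has_derivative_partial_deriv[OF diff]])
    then show ?thesis
      using linear_cmul[OF 2] unfolding has_field_derivative_def d_def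
      by (simp add: mult_commute_abs)
  qed
  \<comment> \<open>The radius R + 2 norm b covers the mean value points x + z b with x in B and 0 <
    z < 1, where the derivative has to be bounded.\<close>
  have "compact (d ` cball 0 (R + 2 * norm b))"
    using cont unfolding d_def by (intro compact_continuous_image compact_cball) (auto intro: continuous_on_subset)
  then obtain K where K: "\<And>x. x \<in> cball 0 (R + 2 * norm b) \<Longrightarrow> \<bar>d x\<bar> \<le> K"
    unfolding compact_eq_bounded_closed bounded_iff by force
  have zero: "\<phi> (x + h *\<^sub>R b) = 0" if "x \<notin> B" "0 \<le> h" "h \<le> 1" for x h
  proof (rule ccontr)
    assume "\<phi> (x + h *\<^sub>R b) \<noteq> 0"
    then have "norm (x + h *\<^sub>R b) \<le> R" by (rule supp)
    moreover have "norm x \<le> norm (x + h *\<^sub>R b) + norm (h *\<^sub>R b)"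
      by (metis add_diff_cancel norm_triangle_ineq4)
    moreover have "norm (h *\<^sub>R b) \<le> norm b" using that by (simp add: mult_left_le_one_le)
    ultimately show False using that by (simp add: B_def)
  qed
  define q where "q n x = (\<phi> (x + inverse (real (Suc n)) *\<^sub>R b) - \<phi> x) * real (Suc n)" for n x
  have h01: "0 < inverse (real (Suc n))" "inverse (real (Suc n)) \<le> 1" for n
    by (simp_all add: inverse_le_1_iff)
  have qm: "q n \<in> borel_measurable borel" for n
    unfolding q_def[abs_def] using m\<phi> by measurable
  have qlim: "(\<lambda>n. q n x) \<longlonglongrightarrow> d x" for x
  proof -
    have "(\<lambda>h. (\<phi> (x + (0 + h) *\<^sub>R b) - \<phi> (x + 0 *\<^sub>R b)) / h) \<midarrow>0\<rightarrow> d (x + 0 *\<^sub>R b)"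
      using dline[of x 0] unfolding DERIV_def .
    moreover have "filterlim (\<lambda>n. inverse (real (Suc n))) (at 0) sequentially"
      by (rule filterlim_atI[OF LIMSEQ_inverse_real_of_nat]) simp
    ultimately have "(\<lambda>n. (\<phi> (x + (0 + inverse (real (Suc n))) *\<^sub>R b) - \<phi> (x + 0 *\<^sub>R b))
        / inverse (real (Suc n))) \<longlonglongrightarrow> d (x + 0 *\<^sub>R b)"
      by (rule filterlim_compose)
    then show ?thesis unfolding q_def by (simp add: divide_inverse del: of_nat_Suc)
  qed
  have qbound: "norm (q n x) \<le> K * indicator B x" for n x
  proof (cases "x \<in> B")
    case False
    then show ?thesis using zero[OF False, of 0] zero[OF False, of "inverse (real (Suc n))"] h01[of n]
      by (simp add: q_def)
  next
    case True
    obtain z where z: "0 < z" "z < inverse (real (Suc n))"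
      "\<phi> (x + inverse (real (Suc n)) *\<^sub>R b) - \<phi> (x + 0 *\<^sub>R b) = (inverse (real (Suc n)) - 0) * d (x + z *\<^sub>R b)"
      using MVT2[OF h01(1)[of n], of "\<lambda>t. \<phi> (x + t *\<^sub>R b)" "\<lambda>t. d (x + t *\<^sub>R b)"] dline by blast
    have "q n x = d (x + z *\<^sub>R b)" using z(3) unfolding q_def by (simp del: of_nat_Suc)
    moreover have "norm (x + z *\<^sub>R b) \<le> R + 2 * norm b"
    proof -
      have "norm (z *\<^sub>R b) \<le> norm b" using z h01[of n] by (simp add: mult_left_le_one_le)
      then show ?thesis using True norm_triangle_ineq[of x "z *\<^sub>R b"] by (simp add: B_def)
    qed
    ultimately show ?thesis using K[of "x + z *\<^sub>R b"] True by simp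
  qed
  have Bint: "integrable lborel (\<lambda>x. K * indicator B x)"
    unfolding B_def by (intro integrable_mult_right integrable_real_indicator) (use emeasure_bounded_finite[OF bounded_cball] in auto)
  have lim: "(\<lambda>n. \<integral>x. q n x \<partial>lborel) \<longlonglongrightarrow> (\<integral>x. d x \<partial>lborel)"
    by (rule integral_dominated_convergence[OF _ _ Bint]) (use md qm qlim qbound in auto)
  have "(\<integral>x. q n x \<partial>lborel) = 0" for n
  proof -
    have "compact (\<phi> ` B)" unfolding B_def
      by (intro compact_continuous_image compact_cball continuous_on_subset[OF c\<phi>]) simp
    then obtain L where L: "\<And>x. x \<in> B \<Longrightarrow> \<bar>\<phi> x\<bar> \<le> L"
      unfolding compact_eq_bounded_closed bounded_iff by force
    have \<phi>i: "integrable lborel \<phi>"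
    proof (rule Bochner_Integration.integrable_bound)
      show "integrable lborel (\<lambda>x. L * indicator B x)"
        unfolding B_def by (intro integrable_mult_right integrable_real_indicator) (use emeasure_bounded_finite[OF bounded_cball] in auto)
      show "AE x in lborel. norm (\<phi> x) \<le> norm (L * indicator B x)"
      proof (rule AE_I2)
        fix x show "norm (\<phi> x) \<le> norm (L * indicator B x)"
          using L[of x] zero[of x 0] by (cases "x \<in> B") auto
      qed
    qed (use m\<phi> in simp)
    have sh: "distr lborel borel (\<lambda>x. x + c) = lborel" for c :: 'a
    proof -
      have "(\<lambda>x. x + c) = (+) c" by (simp add: fun_eq_iff add.commute)
      then show ?thesis using lborel_distr_plus[of c] by simp
    qed
    have shift: "integrable lborel (\<lambda>x. \<phi> (x + c))" "(\<integral>x. \<phi> (x + c) \<partial>lborel) = (\<integral>x. \<phi> x \<partial>lborel)" for c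
    proof -
      have "integrable (distr lborel borel (\<lambda>x. x + c)) \<phi>" using \<phi>i by (simp add: sh)
      then show "integrable lborel (\<lambda>x. \<phi> (x + c))" by (rule integrable_distr[rotated]) simp
      show "(\<integral>x. \<phi> (x + c) \<partial>lborel) = (\<integral>x. \<phi> x \<partial>lborel)"
        by (subst (2) sh[of c, symmetric], subst integral_distr) (use m\<phi> in auto)
    qed
    show ?thesis unfolding q_def using shift \<phi>i by simp
  qed
  then show ?thesis using lim unfolding d_def[symmetric] by (simp add: LIMSEQ_const_iff)
qed

lemma integral_lebesgue_on_eq_lborel:
  fixes h :: "'a::euclidean_space \<Rightarrow> real"
  assumes "D \<in> sets borel" "h \<in> borel_measurable borel" "\<And>x. x \<notin> D \<Longrightarrow> h x = 0"
  shows "(\<integral>x. h x \<partial>lebesgue_on D) = (\<integral>x. h x \<partial>lborel)"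
proof -
  have "(\<integral>x. h x \<partial>lebesgue_on D) = (\<integral>x. indicator D x *\<^sub>R h x \<partial>lebesgue)"
    using assms(1) by (subst integral_restrict_space) auto
  also have "(\<lambda>x. indicator D x *\<^sub>R h x) = h"
    using assms(3) by (auto simp: fun_eq_iff indicator_def)
  also have "(\<integral>x. h x \<partial>lebesgue) = (\<integral>x. h x \<partial>lborel)"
    using assms(2) by (intro integral_completion) simp
  finally show ?thesis .
qed

text \<open>Bump functions give vanishing integrals over boxes whose closure lies in D. On one such
  box, intersections of boxes generate the Borel sets, so g vanishes almost everywhere there, and
  countably many such boxes cover D.\<close>

lemma fundamental_lemma_variations:
  fixes g :: "'a::euclidean_space \<Rightarrow> real"
  assumes D: "open D" and g: "integrable (lebesgue_on D) g"
    and orth: "\<And>\<phi>. \<phi> \<in> test_functions D \<Longrightarrow> (\<integral>x. g x * \<phi> x \<partial>lebesgue_on D) = 0"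
  shows "AE x in lebesgue_on D. g x = 0"
proof -
  have Ds[measurable]: "D \<in> sets lebesgue" using D by auto
  define g0 where "g0 x = indicator D x *\<^sub>R g x" for x
  have g0: "integrable lebesgue g0"
    using g unfolding g0_def by (subst (asm) integrable_restrict_space) auto
  have box0: "(\<integral>x. g0 x * indicator (box a b) x \<partial>lebesgue) = 0" if sub: "cbox a b \<subseteq> D" for a b
  proof -
    have 0: "(\<integral>x. g0 x * box_bump a b n x \<partial>lebesgue) = 0" for n
    proof -
      have "(\<integral>x. g x * box_bump a b n x \<partial>lebesgue_on D) = (\<integral>x. g0 x * box_bump a b n x \<partial>lebesgue)"
        unfolding g0_def by (subst integral_restrict_space) (auto simp: mult.assoc)
      then show ?thesis using orth[OF box_bump_test[OF sub]] by simp
    qed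
    have bm: "box_bump a b n \<in> borel_measurable borel" for n
      using box_bump_smooth[of 0 a b n] by (intro borel_measurable_continuous_onI) simp
    have "(\<lambda>n. \<integral>x. g0 x * box_bump a b n x \<partial>lebesgue) \<longlonglongrightarrow> (\<integral>x. g0 x * indicator (box a b) x \<partial>lebesgue)"
    proof (rule integral_dominated_convergence[where w="\<lambda>x. \<bar>g0 x\<bar>"])
      show "AE x in lebesgue. (\<lambda>n. g0 x * box_bump a b n x) \<longlonglongrightarrow> g0 x * indicator (box a b) x"
        by (intro AE_I2 tendsto_intros box_bump_tendsto)
      show "AE x in lebesgue. norm (g0 x * box_bump a b n x) \<le> \<bar>g0 x\<bar>" for n
        using box_bump_bounds[of a b n] by (intro AE_I2) (simp add: abs_mult mult_left_le)
      show "(\<lambda>x. g0 x * box_bump a b n x) \<in> borel_measurable lebesgue" for n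
        using g0 bm[of n] by (intro borel_measurable_times) (auto intro: measurable_completion)
      show "(\<lambda>x. g0 x * indicator (box a b) x) \<in> borel_measurable lebesgue"
        using g0 by (intro borel_measurable_times borel_measurable_indicator) auto
    qed (use g0 in auto)
    then show ?thesis unfolding 0 by (simp add: LIMSEQ_const_iff)
  qed
  have AEbox: "AE x in lebesgue. x \<in> box c d \<longrightarrow> g0 x = 0" if sub: "cbox c d \<subseteq> D" for c d
  proof -
    \<comment> \<open>Cutting g0 off to one box inside D lets the Dynkin argument run over all boxes
      of the space: their intersections with this box again have closure in D.\<close>
    define g1 where "g1 x = g0 x * indicator (box c d) x" for x
    have g1: "integrable lebesgue g1"
      unfolding g1_def using g0 by (intro integrable_real_mult_indicator) auto
    have g1i: "integrable lebesgue (\<lambda>x. g1 x * indicator S x)" if "S \<in> sets lebesgue" for S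
      using g1 that by (intro integrable_real_mult_indicator) auto
    have borel0: "(\<integral>x. g1 x * indicator S x \<partial>lebesgue) = 0" if S: "S \<in> sets borel" for S
    proof -
      have gen: "(\<integral>x. g1 x * indicator (box a b) x \<partial>lebesgue) = 0" for a b
      proof -
        obtain p r where pr: "box c d \<inter> box a b = box p r" by (rule that[OF box_Int_box])
        show ?thesis
        \<comment> \<open>An empty open box gives no control over \<open>cbox p r\<close>; a
          nonempty one has it as its closure.\<close>
        proof (cases "box p r = {}")
          case True
          then have "(\<lambda>x. g1 x * indicator (box a b) x) = (\<lambda>x. 0)"
            using pr unfolding g1_def by (auto simp: indicator_def fun_eq_iff)
          then show ?thesis by simp
        next
          case False
          have "cbox p r \<subseteq> cbox c d"
            using False pr closure_mono[of "box p r" "box c d"]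
            by (metis Int_lower1 box_subset_cbox closed_cbox closure_box closure_minimal subset_trans)
          then have "(\<integral>x. g0 x * indicator (box p r) x \<partial>lebesgue) = 0"
            using sub by (intro box0) auto
          then show ?thesis unfolding g1_def pr[symmetric] by (simp add: indicator_inter_arith mult.assoc)
        qed
      qed
      have all: "(\<integral>x. g1 x \<partial>lebesgue) = 0"
        using box0[OF sub] unfolding g1_def .
      have sig: "S \<in> sigma_sets UNIV (range (\<lambda>(a, b). box a b))"
        using S unfolding borel_eq_box by simp
      have stable: "Int_stable (range (\<lambda>(a, b). box a b :: 'a set))"
        by (auto simp: Int_stable_def box_Int_box)
      have sub: "range (\<lambda>(a, b). box a b :: 'a set) \<subseteq> Pow UNIV" by simp
      from stable sub sig show ?thesis
      proof (induction rule: sigma_sets_induct_disjoint)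
        case (basic A)
        then show ?case using gen by auto
      next
        case empty
        then show ?case by simp
      next
        case (compl A)
        then have "A \<in> sets borel" unfolding borel_eq_box by simp
        then have "integrable lebesgue (\<lambda>x. g1 x * indicator A x)" by (intro g1i) auto
        then have "(\<integral>x. g1 x - g1 x * indicator A x \<partial>lebesgue) = 0"
          using g1 all compl by simp
        also have "(\<lambda>x. g1 x - g1 x * indicator A x) = (\<lambda>x. g1 x * indicator (UNIV - A) x)"
          by (auto simp: indicator_def fun_eq_iff)
        finally show ?case .
      next
        case (union A)
        then have Ab: "A i \<in> sets borel" for i unfolding borel_eq_box by auto
        then have Al: "A i \<in> sets lebesgue" for i by auto
        have "integrable lebesgue (\<lambda>x. indicat_real (\<Union>(range A)) x * g1 x)"
          using integrable_mult_indicator[OF _ g1, of "\<Union>(range A)"] Al by auto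
        then have "(\<integral>x. indicator (\<Union>i. A i) x *\<^sub>R g1 x \<partial>lebesgue) = (\<Sum>i. \<integral>x. indicator (A i) x *\<^sub>R g1 x \<partial>lebesgue)"
          using lebesgue_integral_countable_add[of A lebesgue g1] Al union(1) g1
          unfolding set_lebesgue_integral_def set_integrable_def disjoint_family_on_def
          by (auto intro!: integrable_mult_indicator)
        then show ?case using union by (simp add: mult.commute)
      qed
    qed
    have "AE x in lebesgue. g1 x = 0"
    proof (rule density_unique_real[OF g1])
      \<comment> \<open>A Lebesgue set is a Borel set S up to a null set, which does not affect the
        integral.\<close>
      fix A :: "'a set" assume "A \<in> sets lebesgue"
      then obtain S N N' where S: "A = S \<union> N" "N \<subseteq> N'" "N' \<in> null_sets lborel" "S \<in> sets lborel"
        by (rule sets_completionE)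
      have N: "AE x in lebesgue. x \<notin> N'"
        using S(3) by (intro AE_completion AE_not_in)
      have "(\<integral>x. indicator A x *\<^sub>R g1 x \<partial>lebesgue) = (\<integral>x. g1 x * indicator S x \<partial>lebesgue)"
      proof (rule integral_cong_AE)
        show "AE x in lebesgue. indicator A x *\<^sub>R g1 x = g1 x * indicator S x"
          using N by eventually_elim (use S in \<open>auto simp: indicator_def\<close>)
      qed (use g1 S \<open>A \<in> sets lebesgue\<close> in \<open>auto intro!: borel_measurable_times borel_measurable_scaleR borel_measurable_indicator\<close>)
      then show "set_lebesgue_integral lebesgue A g1 = set_lebesgue_integral lebesgue A (\<lambda>x. 0)"
        unfolding set_lebesgue_integral_def using borel0 S(4) by simp
    qed simp
    then show ?thesis by eventually_elim (auto simp: g1_def)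
  qed
  obtain \<D> where \<D>: "countable \<D>" "\<D> \<subseteq> Pow D" "\<And>X. X \<in> \<D> \<Longrightarrow> \<exists>a b. X = cbox a b" "\<Union>\<D> = D"
    using open_countable_Union_open_cbox[OF D] by metis
  have "AE x in lebesgue. \<forall>X\<in>\<D>. x \<in> X \<longrightarrow> g0 x = 0"
  proof (subst AE_ball_countable[OF \<D>(1)], rule ballI)
    fix X assume X: "X \<in> \<D>"
    then obtain a b where ab: "X = cbox a b" using \<D>(3) by blast
    \<comment> \<open>The cover consists of closed boxes while \<open>AEbox\<close> concerns open
      ones; their faces are null sets.\<close>
    have "cbox a b - box a b \<in> null_sets lebesgue"
      using negligible_frontier_interval[of a b] by (simp add: negligible_iff_null_sets)
    then have "AE x in lebesgue. x \<notin> cbox a b - box a b" by (rule AE_not_in)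
    moreover have "AE x in lebesgue. x \<in> box a b \<longrightarrow> g0 x = 0"
      using X \<D>(2) ab by (intro AEbox) auto
    ultimately show "AE x in lebesgue. x \<in> X \<longrightarrow> g0 x = 0"
      by eventually_elim (use ab in auto)
  qed
  then have "AE x in lebesgue. x \<in> D \<longrightarrow> g x = 0"
  proof eventually_elim
    case (elim x)
    show ?case
    proof
      assume x: "x \<in> D"
      then obtain X where "X \<in> \<D>" "x \<in> X" using \<D>(4) by blast
      then show "g x = 0" using elim x by (auto simp: g0_def)
    qed
  qed
  then show ?thesis by (subst AE_restrict_space_iff) auto
qed

section \<open>Test functions\<close>

lemma test_funD:
  assumes "\<phi> \<in> test_functions D"
  shows "C_k k \<phi>" "\<phi> differentiable (at x)" "continuous_on UNIV \<phi>" "\<phi> \<in> borel_measurable borel"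
    "x \<notin> D \<Longrightarrow> \<phi> x = 0"
proof -
  have C: "\<And>k. C_k k \<phi>" using assms by (simp add: test_functions_def)
  show "C_k k \<phi>" by (rule C)
  show "\<phi> differentiable (at x)" using C[of 1] by simp
  show c: "continuous_on UNIV \<phi>" using C[of 0] by simp
  show "\<phi> \<in> borel_measurable borel" by (rule borel_measurable_continuous_onI[OF c])
  show "x \<notin> D \<Longrightarrow> \<phi> x = 0"
    using assms closure_subset[of "{x. \<phi> x \<noteq> 0}"] by (auto simp: test_functions_def)
qed

lemma test_fun_support:
  assumes "\<phi> \<in> test_functions D"
  obtains R where "\<And>x. \<phi> x \<noteq> 0 \<Longrightarrow> norm x \<le> R"
proof -
  have "bounded {x. \<phi> x \<noteq> 0}"
    using assms by (simp add: test_functions_def compact_closure)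
  then show ?thesis using that by (auto simp: bounded_iff)
qed

lemma test_fun_bounded:
  assumes "\<phi> \<in> test_functions D"
  obtains K where "\<And>x. \<bar>\<phi> x\<bar> \<le> K"
proof -
  obtain R where R: "\<And>x. \<phi> x \<noteq> 0 \<Longrightarrow> norm x \<le> R" using test_fun_support[OF assms] by blast
  have "compact (\<phi> ` cball 0 R)"
    by (intro compact_continuous_image compact_cball continuous_on_subset[OF test_funD(3)[OF assms]]) simp
  then obtain L where L: "\<And>x. x \<in> cball 0 R \<Longrightarrow> \<bar>\<phi> x\<bar> \<le> L"
    unfolding compact_eq_bounded_closed bounded_iff by force
  show ?thesis
  proof (rule that[of "max L 0"])
    fix x show "\<bar>\<phi> x\<bar> \<le> max L 0"
    proof (cases "\<phi> x = 0")
      case False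
      then show ?thesis using L[of x] R[of x] by simp
    qed simp
  qed
qed

lemma test_funI:
  assumes "\<phi> \<in> test_functions D" "\<And>k. C_k k \<psi>" "{x. \<psi> x \<noteq> 0} \<subseteq> closure {x. \<phi> x \<noteq> 0}"
  shows "\<psi> \<in> test_functions D"
proof -
  have c: "closure {x. \<psi> x \<noteq> 0} \<subseteq> closure {x. \<phi> x \<noteq> 0}"
    using assms(3) closed_closure by (rule closure_minimal)
  moreover have "compact (closure {x. \<psi> x \<noteq> 0})"
    using c assms(1) by (auto simp: test_functions_def compact_eq_bounded_closed intro: bounded_subset)
  ultimately show ?thesis using assms by (auto simp: test_functions_def)
qed

lemma test_fun_mult:
  assumes "\<phi> \<in> test_functions D" "\<And>k. C_k k \<psi>"
  shows "(\<lambda>x. \<phi> x * \<psi> x) \<in> test_functions D"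
proof (rule test_funI[OF assms(1)])
  show "C_k k (\<lambda>x. \<phi> x * \<psi> x)" for k by (intro C_k_mult test_funD(1)[OF assms(1)] assms(2))
  show "{x. \<phi> x * \<psi> x \<noteq> 0} \<subseteq> closure {x. \<phi> x \<noteq> 0}"
    using closure_subset[of "{x. \<phi> x \<noteq> 0}"] by auto
qed

lemma test_fun_cmult: "\<phi> \<in> test_functions D \<Longrightarrow> (\<lambda>x. c * \<phi> x) \<in> test_functions D"
  using test_fun_mult[OF _ C_k_const, of \<phi> D c] by (simp add: mult.commute)

lemma test_fun_zero: "(\<lambda>x. 0) \<in> test_functions D"
  by (simp add: test_functions_def C_k_const)

lemma test_fun_add:
  assumes "\<phi> \<in> test_functions D" "\<psi> \<in> test_functions D"
  shows "(\<lambda>x. \<phi> x + \<psi> x) \<in> test_functions D"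
proof -
  have c: "closure {x. \<phi> x + \<psi> x \<noteq> 0} \<subseteq> closure {x. \<phi> x \<noteq> 0} \<union> closure {x. \<psi> x \<noteq> 0}"
    unfolding closure_Un[symmetric] by (rule closure_mono) auto
  moreover have "compact (closure {x. \<phi> x + \<psi> x \<noteq> 0})"
    using c assms by (auto simp: test_functions_def compact_eq_bounded_closed intro: bounded_subset[of "_ \<union> _"])
  moreover have "C_k k (\<lambda>x. \<phi> x + \<psi> x)" for k by (intro C_k_add test_funD(1)[OF assms(1)] test_funD(1)[OF assms(2)])
  ultimately show ?thesis using assms by (auto simp: test_functions_def)
qed

lemma test_fun_partial_deriv:
  assumes \<phi>: "\<phi> \<in> test_functions D" and b: "b \<in> Basis"
  shows "partial_deriv b \<phi> \<in> test_functions D"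
proof (rule test_funI[OF \<phi>])
  show "C_k k (partial_deriv b \<phi>)" for k using test_funD(1)[OF \<phi>, of "Suc k"] b by simp
  show "{x. partial_deriv b \<phi> x \<noteq> 0} \<subseteq> closure {x. \<phi> x \<noteq> 0}"
  proof (intro subsetI, rule ccontr)
    fix x assume x: "x \<in> {x. partial_deriv b \<phi> x \<noteq> 0}" "x \<notin> closure {x. \<phi> x \<noteq> 0}"
    \<comment> \<open>Off the closed support \<phi> agrees with 0 on a neighbourhood of x, so its
      derivative vanishes there.\<close>
    have "((\<lambda>x. 0) has_derivative (\<lambda>h. 0)) (at x)" by simp
    then have "(\<phi> has_derivative (\<lambda>h. 0)) (at x)"
      by (rule has_derivative_transform_within_open[OF _ open_Compl[OF closed_closure[of "{x. \<phi> x \<noteq> 0}"]]])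
        (use x closure_subset[of "{x. \<phi> x \<noteq> 0}"] in auto)
    then show False using partial_derivI x by fastforce
  qed
qed

lemma finite_measure_lebesgue_on_bounded:
  assumes "open D" "bounded D" shows "finite_measure (lebesgue_on D)"
  by (intro finite_measure_lebesgue_on bounded_set_imp_lmeasurable) (use assms in auto)

lemma borel_measurable_lebesgue_onI:
  "f \<in> borel_measurable borel \<Longrightarrow> f \<in> borel_measurable (lebesgue_on D)"
  by (intro measurable_restrict_space1 measurable_completion) simp

lemma test_fun_sq_int:
  assumes "open D" "bounded D" "\<phi> \<in> test_functions D"
  shows "\<phi> \<in> sq_int (lebesgue_on D)"
proof -
  obtain K where "\<And>x. \<bar>\<phi> x\<bar> \<le> K" using test_fun_bounded[OF assms(3)] by blast
  then show ?thesis
    by (intro finite_measure.bounded_in_sq_int[OF finite_measure_lebesgue_on_bounded[OF assms(1,2)]]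
        borel_measurable_lebesgue_onI test_funD(4)[OF assms(3)])
qed

lemma integral_partial_deriv_test_fun:
  assumes "open D" "\<phi> \<in> test_functions D" "b \<in> Basis"
  shows "(\<integral>x. partial_deriv b \<phi> x \<partial>lebesgue_on D) = 0"
proof -
  note d = test_fun_partial_deriv[OF assms(2,3)]
  obtain R where R: "\<And>x. \<phi> x \<noteq> 0 \<Longrightarrow> norm x \<le> R" using test_fun_support[OF assms(2)] by blast
  have "(\<integral>x. partial_deriv b \<phi> x \<partial>lebesgue_on D) = (\<integral>x. partial_deriv b \<phi> x \<partial>lborel)"
    using assms(1) by (intro integral_lebesgue_on_eq_lborel test_funD(4)[OF d] test_funD(5)[OF d]) auto
  also have "\<dots> = 0"
    by (rule integral_partial_deriv_eq_0[OF test_funD(2)[OF assms(2)] test_funD(3)[OF d] R])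
  finally show ?thesis .
qed

lemma integral_by_parts_test_fun:
  assumes D: "open D" "bounded D" and \<phi>: "\<phi> \<in> test_functions D" and \<psi>: "\<psi> \<in> test_functions D"
    and b: "b \<in> Basis"
  shows "(\<integral>x. \<phi> x * partial_deriv b \<psi> x \<partial>lebesgue_on D) = - (\<integral>x. partial_deriv b \<phi> x * \<psi> x \<partial>lebesgue_on D)"
proof -
  have "(\<lambda>x. \<phi> x * \<psi> x) \<in> test_functions D" by (rule test_fun_mult[OF \<phi> test_funD(1)[OF \<psi>]])
  from integral_partial_deriv_test_fun[OF D(1) this b]
  have "(\<integral>x. \<phi> x * partial_deriv b \<psi> x + partial_deriv b \<phi> x * \<psi> x \<partial>lebesgue_on D) = 0"
    by (simp add: partial_deriv_mult[OF test_funD(2)[OF \<phi>] test_funD(2)[OF \<psi>]])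
  moreover have "integrable (lebesgue_on D) (\<lambda>x. \<phi> x * partial_deriv b \<psi> x)"
    "integrable (lebesgue_on D) (\<lambda>x. partial_deriv b \<phi> x * \<psi> x)"
    by (intro sq_int_mult_integrable test_fun_sq_int[OF D] \<phi> \<psi> test_fun_partial_deriv b)+
  ultimately show ?thesis by simp
qed

text \<open>The form of the fundamental lemma that yields uniqueness of weak derivatives, used on D
  for gradients and on D x D for mixed gradients.\<close>

lemma sq_int_orthogonal_test_functions:
  fixes g h :: "'a::euclidean_space \<Rightarrow> real"
  assumes D: "open D" "bounded D" and g: "g \<in> sq_int (lebesgue_on D)" and h: "h \<in> sq_int (lebesgue_on D)"
    and eq: "\<And>\<phi>. \<phi> \<in> test_functions D \<Longrightarrow>
      (\<integral>x. g x * \<phi> x \<partial>lebesgue_on D) = (\<integral>x. h x * \<phi> x \<partial>lebesgue_on D)"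
  shows "AE x in lebesgue_on D. g x = h x"
proof -
  interpret finite_measure "lebesgue_on D" by (rule finite_measure_lebesgue_on_bounded[OF D])
  have d: "(\<lambda>x. g x - h x) \<in> sq_int (lebesgue_on D)" by (rule sq_int_diff[OF g h])
  have "AE x in lebesgue_on D. g x - h x = 0"
  proof (rule fundamental_lemma_variations[OF D(1)])
    show "integrable (lebesgue_on D) (\<lambda>x. g x - h x)"
      by (rule square_integrable_imp_integrable[OF sq_intD[OF d]])
    fix \<phi> assume \<phi>: "\<phi> \<in> test_functions D"
    note p = test_fun_sq_int[OF D \<phi>]
    show "(\<integral>x. (g x - h x) * \<phi> x \<partial>lebesgue_on D) = 0"
      using eq[OF \<phi>] sq_int_mult_integrable[OF g p] sq_int_mult_integrable[OF h p]
      by (simp add: left_diff_distrib)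
  qed
  then show ?thesis by simp
qed

section \<open>Sobolev functions of one variable\<close>

lemma axis_in_Basis: "axis i (1::real) \<in> Basis"
  by (simp add: axis_in_Basis_iff)

(* The components of the embedding u \<mapsto> (u, \<nabla>u) of H1 into a product of L2 spaces; this turns
   the H1 inner product into a sum of L2 inner products. *)
definition jet :: "(real^'d) set \<Rightarrow> 'd option \<Rightarrow> (real^'d \<Rightarrow> real) \<Rightarrow> real^'d \<Rightarrow> real" where
  "jet D e u x = (case e of None \<Rightarrow> u x | Some i \<Rightarrow> weak_grad D u x $ i)"

lemma jet_simps [simp]: "jet D None u = u" "jet D (Some i) u = (\<lambda>x. weak_grad D u x $ i)"
  by (simp_all add: jet_def fun_eq_iff)

locale bounded_open =
  fixes D :: "(real^'d) set"
  assumes open_D: "open D" and bounded_D: "bounded D"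
begin

abbreviation "M \<equiv> lebesgue_on D"

sublocale finite_measure M
  by (rule finite_measure_lebesgue_on_bounded[OF open_D bounded_D])

lemma is_weak_gradD:
  assumes "is_weak_grad D u g"
  shows "(\<lambda>x. g x $ i) \<in> sq_int M" "\<phi> \<in> test_functions D \<Longrightarrow>
    (\<integral>x. u x * partial_deriv (axis i 1) \<phi> x \<partial>M) = - (\<integral>x. g x $ i * \<phi> x \<partial>M)"
  using assms by (simp_all add: is_weak_grad_def L2_eq)

lemma weak_grad_unique:
  assumes g: "is_weak_grad D u g" and h: "is_weak_grad D u h"
  shows "AE x in M. g x = h x"
proof -
  have "AE x in M. \<forall>i. g x $ i = h x $ i"
    unfolding AE_all_countable
  proof
    fix i
    show "AE x in M. g x $ i = h x $ i"
    proof (rule sq_int_orthogonal_test_functions[OF open_D bounded_D is_weak_gradD(1)[OF g] is_weak_gradD(1)[OF h]])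
      fix \<phi> assume "\<phi> \<in> test_functions D"
      from is_weak_gradD(2)[OF g this, of i] is_weak_gradD(2)[OF h this, of i]
      show "(\<integral>x. g x $ i * \<phi> x \<partial>M) = (\<integral>x. h x $ i * \<phi> x \<partial>M)" by simp
    qed
  qed
  then show ?thesis by (simp add: vec_eq_iff)
qed

lemma weak_grad_works: "u \<in> H1 D \<Longrightarrow> is_weak_grad D u (weak_grad D u)"
  unfolding H1_def weak_grad_def using someI_ex[of "is_weak_grad D u"] by blast

lemma H1_sq_int: "u \<in> H1 D \<Longrightarrow> u \<in> sq_int M"
  by (simp add: H1_def L2_eq)

lemma jet_sq_int: "u \<in> H1 D \<Longrightarrow> jet D e u \<in> sq_int M"
  using is_weak_gradD(1)[OF weak_grad_works] H1_sq_int by (cases e) auto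

text \<open>Since \<open>weak_grad\<close> is a choice, an explicitly known gradient can be
  identified with it only almost everywhere. Linearity of the jets and the gradients of test
  functions are obtained through this rule.\<close>

lemma H1I:
  assumes "u \<in> sq_int M" "is_weak_grad D u g"
  shows "u \<in> H1 D" "AE x in M. weak_grad D u x = g x"
proof -
  show H: "u \<in> H1 D" using assms by (auto simp: H1_def L2_eq)
  show "AE x in M. weak_grad D u x = g x"
    by (rule weak_grad_unique[OF weak_grad_works[OF H] assms(2)])
qed

lemma H1_lincomb:
  assumes u: "u \<in> H1 D" and v: "v \<in> H1 D"
  shows "(\<lambda>x. a * u x + b * v x) \<in> H1 D"
    "AE x in M. jet D e (\<lambda>x. a * u x + b * v x) x = a * jet D e u x + b * jet D e v x"
proof -
  have s: "(\<lambda>x. a * u x + b * v x) \<in> sq_int M"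
    by (intro sq_int_add sq_int_cmult H1_sq_int u v)
  have w: "is_weak_grad D (\<lambda>x. a * u x + b * v x) (\<lambda>x. a *\<^sub>R weak_grad D u x + b *\<^sub>R weak_grad D v x)"
    unfolding is_weak_grad_def L2_eq
  proof (intro allI conjI ballI)
    fix i
    note gu = is_weak_gradD(1)[OF weak_grad_works[OF u], of i]
      and gv = is_weak_gradD(1)[OF weak_grad_works[OF v], of i]
    show "(\<lambda>x. (a *\<^sub>R weak_grad D u x + b *\<^sub>R weak_grad D v x) $ i) \<in> sq_int M"
      using sq_int_add[OF sq_int_cmult[OF gu, of a] sq_int_cmult[OF gv, of b]] by simp
    fix \<phi> assume \<phi>: "\<phi> \<in> test_functions D"
    note p = test_fun_sq_int[OF open_D bounded_D \<phi>]
      and dp = test_fun_sq_int[OF open_D bounded_D test_fun_partial_deriv[OF \<phi> axis_in_Basis[of i]]]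
    show "(\<integral>x. (a * u x + b * v x) * partial_deriv (axis i 1) \<phi> x \<partial>M) =
        - (\<integral>x. (a *\<^sub>R weak_grad D u x + b *\<^sub>R weak_grad D v x) $ i * \<phi> x \<partial>M)"
      using is_weak_gradD(2)[OF weak_grad_works[OF u] \<phi>, of i]
        is_weak_gradD(2)[OF weak_grad_works[OF v] \<phi>, of i]
        sq_int_mult_integrable[OF H1_sq_int[OF u] dp] sq_int_mult_integrable[OF H1_sq_int[OF v] dp]
        sq_int_mult_integrable[OF gu p] sq_int_mult_integrable[OF gv p]
      by (simp add: distrib_right mult.assoc)
  qed
  show "(\<lambda>x. a * u x + b * v x) \<in> H1 D" by (rule H1I(1)[OF s w])
  show "AE x in M. jet D e (\<lambda>x. a * u x + b * v x) x = a * jet D e u x + b * jet D e v x"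
    using H1I(2)[OF s w] by (cases e) (auto elim!: eventually_mono)
qed

lemma test_fun_H1:
  assumes \<phi>: "\<phi> \<in> test_functions D"
  shows "\<phi> \<in> H1 D" "AE x in M. jet D (Some i) \<phi> x = partial_deriv (axis i 1) \<phi> x"
proof -
  have w: "is_weak_grad D \<phi> (\<lambda>x. \<chi> i. partial_deriv (axis i 1) \<phi> x)"
    unfolding is_weak_grad_def L2_eq
    by (auto intro!: test_fun_sq_int[OF open_D bounded_D] test_fun_partial_deriv[OF \<phi>] axis_in_Basis
        integral_by_parts_test_fun[OF open_D bounded_D \<phi>])
  note s = test_fun_sq_int[OF open_D bounded_D \<phi>]
  show "\<phi> \<in> H1 D" by (rule H1I(1)[OF s w])
  show "AE x in M. jet D (Some i) \<phi> x = partial_deriv (axis i 1) \<phi> x"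
    using H1I(2)[OF s w] by (auto elim!: eventually_mono)
qed

lemma sum_option: "(\<Sum>e\<in>(UNIV::'d option set). f e) = f None + (\<Sum>i\<in>UNIV. f (Some i))"
  unfolding UNIV_option_conv by (subst sum.insert) (auto simp: sum.reindex)

lemma H1_inner_jet:
  assumes u: "u \<in> H1 D" and v: "v \<in> H1 D"
  shows "H1_inner D u v = (\<Sum>e\<in>UNIV. \<integral>x. jet D e u x * jet D e v x \<partial>M)"
  using sq_int_mult_integrable[OF jet_sq_int[OF u, of "Some _"] jet_sq_int[OF v, of "Some _"]]
  by (simp add: H1_inner_def sum_option inner_vec_def)

text \<open>As an \<open>L2_set\<close> of L2 norms, the H1 norm inherits its triangle inequality
  from Minkowski's inequality for finite sums.\<close>

lemma H1_norm_jet: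
  assumes u: "u \<in> H1 D"
  shows "H1_norm D u = L2_set (\<lambda>e. nrm M (jet D e u)) UNIV"
  unfolding H1_norm_def L2_set_def H1_inner_jet[OF u u] nrm_power2 by (simp add: power2_eq_square)

lemma H1_norm_nonneg: "u \<in> H1 D \<Longrightarrow> 0 \<le> H1_norm D u"
  by (simp add: H1_norm_jet L2_set_nonneg)

lemma nrm_jet_le: "u \<in> H1 D \<Longrightarrow> nrm M (jet D e u) \<le> H1_norm D u"
  unfolding H1_norm_jet by (rule member_le_L2_set) auto

lemma nrm_jet_lincomb:
  assumes u: "u \<in> H1 D" and v: "v \<in> H1 D"
  shows "nrm M (jet D e (\<lambda>x. a * u x + b * v x)) = nrm M (\<lambda>x. a * jet D e u x + b * jet D e v x)"
  using H1_lincomb[OF u v] jet_sq_int[OF H1_lincomb(1)[OF u v], of e a b]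
    sq_int_add[OF sq_int_cmult[OF jet_sq_int[OF u]] sq_int_cmult[OF jet_sq_int[OF v]], of a e b e]
  by (intro nrm_cong_AE) auto

lemma H1_norm_lincomb_le:
  assumes u: "u \<in> H1 D" and v: "v \<in> H1 D"
  shows "H1_norm D (\<lambda>x. a * u x + b * v x) \<le> \<bar>a\<bar> * H1_norm D u + \<bar>b\<bar> * H1_norm D v"
proof -
  have "H1_norm D (\<lambda>x. a * u x + b * v x) = L2_set (\<lambda>e. nrm M (\<lambda>x. a * jet D e u x + b * jet D e v x)) UNIV"
    by (simp add: H1_norm_jet[OF H1_lincomb(1)[OF u v]] nrm_jet_lincomb[OF u v])
  also have "\<dots> \<le> L2_set (\<lambda>e. \<bar>a\<bar> * nrm M (jet D e u) + \<bar>b\<bar> * nrm M (jet D e v)) UNIV"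
    using nrm_triangle[OF sq_int_cmult[OF jet_sq_int[OF u]] sq_int_cmult[OF jet_sq_int[OF v]]]
    by (intro L2_set_mono) (simp_all add: nrm_cmult)
  also have "\<dots> \<le> L2_set (\<lambda>e. \<bar>a\<bar> * nrm M (jet D e u)) UNIV + L2_set (\<lambda>e. \<bar>b\<bar> * nrm M (jet D e v)) UNIV"
    by (rule L2_set_triangle_ineq)
  also have "\<dots> = \<bar>a\<bar> * H1_norm D u + \<bar>b\<bar> * H1_norm D v"
    by (simp add: H1_norm_jet u v L2_set_right_distrib)
  finally show ?thesis .
qed

lemma H1_norm_diff_le:
  "u \<in> H1 D \<Longrightarrow> v \<in> H1 D \<Longrightarrow> H1_norm D (\<lambda>x. u x - v x) \<le> H1_norm D u + H1_norm D v"
  using H1_norm_lincomb_le[of u v 1 "-1"] by simp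

lemma H1_diff: "u \<in> H1 D \<Longrightarrow> v \<in> H1 D \<Longrightarrow> (\<lambda>x. u x - v x) \<in> H1 D"
  using H1_lincomb(1)[of u v 1 "-1"] by simp

lemma jet_diff_AE:
  "u \<in> H1 D \<Longrightarrow> v \<in> H1 D \<Longrightarrow> AE x in M. jet D e (\<lambda>x. u x - v x) x = jet D e u x - jet D e v x"
  using H1_lincomb(2)[of u v e 1 "-1"] by simp

lemma nrm_jet_diff_le:
  "u \<in> H1 D \<Longrightarrow> v \<in> H1 D \<Longrightarrow> nrm M (\<lambda>x. jet D e u x - jet D e v x) \<le> H1_norm D (\<lambda>x. u x - v x)"
  using nrm_jet_lincomb[of u v e 1 "-1"] nrm_jet_le[OF H1_diff, of u v e] by simp

lemma H1_norm_diff_commute: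
  "u \<in> H1 D \<Longrightarrow> v \<in> H1 D \<Longrightarrow> H1_norm D (\<lambda>x. u x - v x) = H1_norm D (\<lambda>x. v x - u x)"
proof -
  have "H1_norm D (\<lambda>x. u x - v x) \<le> H1_norm D (\<lambda>x. v x - u x)" if "u \<in> H1 D" "v \<in> H1 D" for u v
    using H1_norm_lincomb_le[OF H1_diff[OF that(2,1)] H1_diff[OF that(2,1)], of "-1" 0] by simp
  then show "u \<in> H1 D \<Longrightarrow> v \<in> H1 D \<Longrightarrow> ?thesis" by (simp add: order.antisym)
qed

lemma H1_norm_triangle_diff:
  assumes "u \<in> H1 D" "v \<in> H1 D" "w \<in> H1 D"
  shows "H1_norm D (\<lambda>x. u x - w x) \<le> H1_norm D (\<lambda>x. u x - v x) + H1_norm D (\<lambda>x. v x - w x)"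
  using H1_norm_lincomb_le[OF H1_diff[OF assms(1,2)] H1_diff[OF assms(2,3)], of 1 1] by simp

lemma H10_H1: "u \<in> H10 D \<Longrightarrow> u \<in> H1 D"
  by (simp add: H10_def)

lemma H10_lincomb:
  assumes u: "u \<in> H10 D" and v: "v \<in> H10 D"
  shows "(\<lambda>x. a * u x + b * v x) \<in> H10 D"
proof -
  note H = H10_H1[OF u] H10_H1[OF v]
  have "\<exists>\<phi>\<in>test_functions D. H1_norm D (\<lambda>x. a * u x + b * v x - \<phi> x) < \<epsilon>" if "\<epsilon> > 0" for \<epsilon>
  proof -
    \<comment> \<open>The summand 1 keeps the denominator positive and leaves a margin:
      (\<bar>a\<bar> + \<bar>b\<bar>) \<delta> = \<epsilon> - \<delta> < \<epsilon>.\<close>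
    define \<delta> where "\<delta> = \<epsilon> / (\<bar>a\<bar> + \<bar>b\<bar> + 1)"
    have d0: "\<delta> > 0" using that by (simp add: \<delta>_def add_nonneg_pos)
    obtain \<phi> where \<phi>: "\<phi> \<in> test_functions D" "H1_norm D (\<lambda>x. u x - \<phi> x) < \<delta>"
      using u d0 unfolding H10_def by blast
    obtain \<psi> where \<psi>: "\<psi> \<in> test_functions D" "H1_norm D (\<lambda>x. v x - \<psi> x) < \<delta>"
      using v d0 unfolding H10_def by blast
    have "H1_norm D (\<lambda>x. a * (u x - \<phi> x) + b * (v x - \<psi> x))
        \<le> \<bar>a\<bar> * H1_norm D (\<lambda>x. u x - \<phi> x) + \<bar>b\<bar> * H1_norm D (\<lambda>x. v x - \<psi> x)"
      by (intro H1_norm_lincomb_le H1_diff H test_fun_H1 \<phi> \<psi>)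
    also have "\<dots> \<le> \<bar>a\<bar> * \<delta> + \<bar>b\<bar> * \<delta>"
      using \<phi> \<psi> by (intro add_mono mult_left_mono) auto
    also have "\<dots> = (\<bar>a\<bar> + \<bar>b\<bar> + 1) * \<delta> - \<delta>" by (simp add: algebra_simps)
    also have "\<dots> < \<epsilon>" using d0 by (simp add: \<delta>_def add_nonneg_pos)
    finally have *: "H1_norm D (\<lambda>x. a * u x + b * v x - (a * \<phi> x + b * \<psi> x)) < \<epsilon>"
      by (simp add: algebra_simps)
    have "(\<lambda>x. a * \<phi> x + b * \<psi> x) \<in> test_functions D"
      by (intro test_fun_add test_fun_cmult \<phi> \<psi>)
    then show ?thesis using * by (intro bexI[of _ "\<lambda>x. a * \<phi> x + b * \<psi> x"]) auto
  qed
  then show ?thesis unfolding H10_def using H1_lincomb(1)[OF H] by auto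
qed

lemma H10_cmult: "u \<in> H10 D \<Longrightarrow> (\<lambda>x. c * u x) \<in> H10 D"
  using H10_lincomb[of u u c 0] by simp

lemma H10_zero: "(\<lambda>x. 0) \<in> H10 D"
proof -
  have z: "(\<lambda>x. 0) \<in> H1 D" by (rule test_fun_H1(1)[OF test_fun_zero])
  have "H1_norm D (\<lambda>x. 0) \<le> 0"
    using H1_norm_lincomb_le[OF z z, of 0 0] by simp
  then show ?thesis unfolding H10_def using z test_fun_zero by (auto intro!: bexI[of _ "\<lambda>x. 0"])
qed

lemma jet_cmult_AE:
  "u \<in> H1 D \<Longrightarrow> AE x in M. jet D e (\<lambda>x. c * u x) x = c * jet D e u x"
  using H1_lincomb(2)[of u u e c 0] by simp

lemma H1_norm_zero: "H1_norm D (\<lambda>x. 0) = 0"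
  using H1_norm_lincomb_le[OF H10_H1[OF H10_zero] H10_H1[OF H10_zero], of 0 0]
    H1_norm_nonneg[OF H10_H1[OF H10_zero]] by simp

lemma jet_zero_AE: "AE x in M. jet D e (\<lambda>x. 0) x = 0"
  using jet_cmult_AE[OF H10_H1[OF H10_zero], of e 0] by simp

section \<open>The Poincare inequality in one variable\<close>

lemma C_k_component: "C_k k (\<lambda>x::real^'d. x $ i)"
proof -
  have d: "((\<lambda>x::real^'d. x $ i) has_derivative (\<lambda>h. h $ i)) (at x)" for x
    by (rule bounded_linear.has_derivative[OF bounded_linear_vec_nth has_derivative_ident])
  have p: "partial_deriv b (\<lambda>x::real^'d. x $ i) = (\<lambda>x. b $ i)" for b
    using partial_derivI[OF d] by (simp add: fun_eq_iff)
  show ?thesis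
  proof (cases k)
    case 0
    then show ?thesis by (simp add: continuous_intros)
  next
    case (Suc k)
    then show ?thesis using d by (auto simp: p differentiable_def intro: C_k_const)
  qed
qed

text \<open>Integrate \<phi> by parts against the derivative of x_i \<phi>. The squared norm of
  \<phi> comes out as -2 times the integral of \<phi> x_i d_i \<phi>; with \<bar>x_i\<bar> \<le> R
  and Cauchy-Schwarz this gives the constant 2 R.\<close>

lemma poincare_test_fun:
  assumes R: "\<And>x. x \<in> D \<Longrightarrow> norm x \<le> R" and R0: "R \<ge> 0" and \<phi>: "\<phi> \<in> test_functions D"
  shows "nrm M \<phi> \<le> 2 * R * nrm M (partial_deriv (axis i 1) \<phi>)"
proof -
  let ?d = "partial_deriv (axis i 1) \<phi>"
  have der: "((\<lambda>x::real^'d. x $ i) has_derivative (\<lambda>h. h $ i)) (at x)" for x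
    by (rule bounded_linear.has_derivative[OF bounded_linear_vec_nth has_derivative_ident])
  have px: "partial_deriv (axis i 1) (\<lambda>x::real^'d. x $ i) = (\<lambda>x. 1)"
    using partial_derivI[OF der] by (simp add: fun_eq_iff)
  have dx: "(\<lambda>x::real^'d. x $ i) differentiable (at x)" for x
    using der by (auto simp: differentiable_def)
  define \<psi> where "\<psi> x = \<phi> x * x $ i" for x
  have \<psi>: "\<psi> \<in> test_functions D"
    unfolding \<psi>_def by (rule test_fun_mult[OF \<phi> C_k_component])
  have d\<psi>: "partial_deriv (axis i 1) \<psi> = (\<lambda>x. \<phi> x + ?d x * x $ i)"
    unfolding \<psi>_def[abs_def] partial_deriv_mult[OF test_funD(2)[OF \<phi>] dx] px by simp
  have dt: "?d \<in> test_functions D" by (intro test_fun_partial_deriv \<phi> axis_in_Basis)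
  note sq = test_fun_sq_int[OF open_D bounded_D]
  have b: "AE x in M. \<bar>x $ i\<bar> \<le> R"
    by (rule AE_I2, rule order_trans[OF component_le_norm_cart R]) simp
  have m: "(\<lambda>x. x $ i) \<in> borel_measurable M"
    by (intro borel_measurable_lebesgue_onI borel_measurable_continuous_onI) (simp add: continuous_intros)
  have xd: "(\<lambda>x. x $ i * ?d x) \<in> sq_int M" "nrm M (\<lambda>x. x $ i * ?d x) \<le> \<bar>R\<bar> * nrm M ?d"
    by (rule sq_int_bounded_mult[OF sq[OF dt] m b])+
  have xp: "(\<lambda>x. x $ i * \<phi> x) \<in> sq_int M"
    by (rule sq_int_bounded_mult(1)[OF sq[OF \<phi>] m b])
  have 1: "integrable M (\<lambda>x. \<phi> x * \<phi> x)" "integrable M (\<lambda>x. \<phi> x * (x $ i * ?d x))"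
    by (intro sq_int_mult_integrable sq \<phi> xd)+
  have "(\<integral>x. \<phi> x * (\<phi> x + ?d x * x $ i) \<partial>M) = - (\<integral>x. ?d x * \<psi> x \<partial>M)"
    using integral_by_parts_test_fun[OF open_D bounded_D \<phi> \<psi> axis_in_Basis[of i]] by (simp add: d\<psi>)
  moreover have "(\<lambda>x. ?d x * \<psi> x) = (\<lambda>x. \<phi> x * (x $ i * ?d x))" by (auto simp: \<psi>_def fun_eq_iff)
  moreover have "(\<lambda>x. \<phi> x * (\<phi> x + ?d x * x $ i)) = (\<lambda>x. \<phi> x * \<phi> x + \<phi> x * (x $ i * ?d x))"
    by (auto simp: fun_eq_iff algebra_simps)
  ultimately have "(nrm M \<phi>)\<^sup>2 = - 2 * (\<integral>x. \<phi> x * (x $ i * ?d x) \<partial>M)"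
    using 1 unfolding nrm_power2 by (simp add: power2_eq_square)
  also have "\<dots> \<le> 2 * (nrm M \<phi> * (R * nrm M ?d))"
  proof -
    have "nrm M \<phi> * nrm M (\<lambda>x. x $ i * ?d x) \<le> nrm M \<phi> * (\<bar>R\<bar> * nrm M ?d)"
      by (rule mult_left_mono[OF xd(2)]) simp
    moreover have "\<bar>R\<bar> = R" using R0 by simp
    ultimately show ?thesis using nrm_Cauchy_Schwarz[OF sq[OF \<phi>] xd(1)] by (simp only:)
  qed
  finally have "nrm M \<phi> * nrm M \<phi> \<le> nrm M \<phi> * (2 * R * nrm M ?d)"
    by (simp add: power2_eq_square algebra_simps)
  then show ?thesis
    using R0 nrm_nonneg[of M \<phi>] nrm_nonneg[of M ?d]
    by (cases "nrm M \<phi> = 0") (simp_all add: mult_le_cancel_left_pos order_le_less[of 0 "nrm M \<phi>"])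
qed

text \<open>Density of test functions carries the estimate over to \<open>H10 D\<close>. The
  constant depends only on the size of D, so it serves every direction i.\<close>

lemma poincare:
  obtains C where "C \<ge> 0" "\<And>u i. u \<in> H10 D \<Longrightarrow> nrm M u \<le> C * nrm M (jet D (Some i) u)"
proof -
  obtain R0 where "\<And>x. x \<in> D \<Longrightarrow> norm x \<le> R0" using bounded_D by (auto simp: bounded_iff)
  then have R: "\<And>x. x \<in> D \<Longrightarrow> norm x \<le> max R0 0" by fastforce
  define C where "C = 2 * max R0 0"
  have C0: "C \<ge> 0" by (simp add: C_def)
  have "nrm M u \<le> C * nrm M (jet D (Some i) u)" if u: "u \<in> H10 D" for u i
  proof (rule field_le_epsilon)
    fix e :: real assume "e > 0"
    \<comment> \<open>Replacing u by \<phi> costs \<epsilon> on the left and C \<epsilon> on the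
      right, together (C + 1) \<epsilon> = e.\<close>
    define \<epsilon> where "\<epsilon> = e / (C + 1)"
    have "\<epsilon> > 0" using \<open>e > 0\<close> C0 by (simp add: \<epsilon>_def)
    then obtain \<phi> where \<phi>: "\<phi> \<in> test_functions D" "H1_norm D (\<lambda>x. u x - \<phi> x) < \<epsilon>"
      using u unfolding H10_def by blast
    note H = H10_H1[OF u] test_fun_H1(1)[OF \<phi>(1)]
    have dd: "\<bar>nrm M (jet D e u) - nrm M (jet D e \<phi>)\<bar> \<le> \<epsilon>" for e
      using nrm_triangle_diff_abs[OF jet_sq_int[OF H(1)] jet_sq_int[OF H(2)], of e e]
        nrm_jet_diff_le[OF H, of e] \<phi>(2) by linarith
    have eq: "nrm M (jet D (Some i) \<phi>) = nrm M (partial_deriv (axis i 1) \<phi>)"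
      using test_fun_H1(2)[OF \<phi>(1), of i] jet_sq_int[OF H(2), of "Some i"]
        test_fun_sq_int[OF open_D bounded_D test_fun_partial_deriv[OF \<phi>(1) axis_in_Basis[of i]]]
      by (intro nrm_cong_AE) auto
    have "nrm M u \<le> nrm M \<phi> + \<epsilon>" using dd[of None] by simp
    also have "nrm M \<phi> \<le> C * nrm M (jet D (Some i) \<phi>)"
      unfolding eq C_def by (rule poincare_test_fun[OF R _ \<phi>(1)]) auto
    also have "\<dots> \<le> C * (nrm M (jet D (Some i) u) + \<epsilon>)"
      using dd[of "Some i"] C0 by (intro mult_left_mono) auto
    also have "C * (nrm M (jet D (Some i) u) + \<epsilon>) + \<epsilon> = C * nrm M (jet D (Some i) u) + (C + 1) * \<epsilon>"
      by (simp add: algebra_simps)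
    also have "(C + 1) * \<epsilon> = e" using C0 by (simp add: \<epsilon>_def)
    finally show "nrm M u \<le> C * nrm M (jet D (Some i) u) + e" by simp
  qed
  then show ?thesis using that C0 by blast
qed

end

section \<open>Lebesgue measure on a product domain\<close>

text \<open>Both factors are Borel up to null sets, and A x B differs from the Borel rectangle S x T
  only inside two strips over null sets, which are null in the product.\<close>

lemma lebesgue_Times:
  fixes A :: "'a::euclidean_space set" and B :: "'b::euclidean_space set"
  assumes "A \<in> sets lebesgue" "B \<in> sets lebesgue"
  shows "A \<times> B \<in> sets lebesgue"
    "emeasure lebesgue (A \<times> B) = emeasure lebesgue A * emeasure lebesgue B"
proof -
  obtain S N N' where S: "A = S \<union> N" "N \<subseteq> N'" "N' \<in> null_sets lborel" "S \<in> sets lborel"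
    using assms(1) by (rule sets_completionE)
  obtain T K K' where T: "B = T \<union> K" "K \<subseteq> K'" "K' \<in> null_sets lborel" "T \<in> sets lborel"
    using assms(2) by (rule sets_completionE)
  define Z where "Z = N' \<times> UNIV \<union> UNIV \<times> K'"
  have "N' \<times> (UNIV :: 'b set) \<in> null_sets (lborel \<Otimes>\<^sub>M lborel)"
    by (rule lborel.times_in_null_sets1) (use S in auto)
  moreover have "(UNIV :: 'a set) \<times> K' \<in> null_sets (lborel \<Otimes>\<^sub>M lborel)"
    by (rule lborel.times_in_null_sets2) (use T in auto)
  ultimately have Z: "Z \<in> null_sets lborel"
    unfolding Z_def by (simp add: lborel_prod null_sets.Un)
  have ST: "S \<times> T \<in> sets lborel"
    using pair_measureI[OF S(4) T(4)] unfolding lborel_prod .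
  have "A \<times> B = S \<times> T \<union> (A \<times> B - S \<times> T)" using S T by auto
  moreover have "A \<times> B - S \<times> T \<subseteq> Z" using S T by (auto simp: Z_def)
  ultimately show AB: "A \<times> B \<in> sets lebesgue"
    by (rule sets_completionI[OF _ _ Z ST])
  have AEeq: "emeasure lebesgue X = emeasure lborel Y"
    if "X \<in> sets lebesgue" "Y \<in> sets lborel" "W \<in> null_sets lborel" "Y \<subseteq> X" "X - Y \<subseteq> W" for X Y W :: "'c::euclidean_space set"
  proof -
    have "AE x in lebesgue. x \<notin> W" by (rule AE_completion[OF AE_not_in[OF that(3)]])
    then have "AE x in lebesgue. x \<in> X \<longleftrightarrow> x \<in> Y" by eventually_elim (use that in auto)
    then have "emeasure lebesgue X = emeasure lebesgue Y"
      by (rule emeasure_eq_AE) (use that in auto)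
    then show ?thesis using that by simp
  qed
  have "emeasure lebesgue (A \<times> B) = emeasure lborel (S \<times> T)"
    by (rule AEeq[OF AB ST Z]) (use S T in \<open>auto simp: Z_def\<close>)
  also have "\<dots> = emeasure lborel S * emeasure lborel T"
    using lborel.emeasure_pair_measure_Times[OF S(4) T(4)] by (simp add: lborel_prod)
  also have "emeasure lborel S = emeasure lebesgue A"
    by (rule AEeq[OF assms(1) S(4,3), symmetric]) (use S in auto)
  also have "emeasure lborel T = emeasure lebesgue B"
    by (rule AEeq[OF assms(2) T(4,3), symmetric]) (use T in auto)
  finally show "emeasure lebesgue (A \<times> B) = emeasure lebesgue A * emeasure lebesgue B" .
qed

context bounded_open begin

(* lebesgue_on (D \<times> D) is the completion of this measure, so that integrals of N-measurable
   functions may be computed in either of the two. *)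
abbreviation "N \<equiv> M \<Otimes>\<^sub>M M"
abbreviation "M2 \<equiv> lebesgue_on (D \<times> D)"

sublocale pair: pair_sigma_finite M M ..

lemma D_lebesgue [simp]: "D \<in> sets lebesgue" using open_D by auto

lemma DD: "open (D \<times> D)" "bounded (D \<times> D)" "D \<times> D \<in> sets lebesgue"
  using open_D bounded_D by (auto intro: open_Times bounded_Times lebesgue_Times)

sublocale M2: finite_measure M2
  by (rule finite_measure_lebesgue_on_bounded[OF DD(1,2)])

lemma Times_M2:
  assumes "A \<in> sets M" "B \<in> sets M"
  shows "A \<times> B \<in> sets M2" "emeasure M A * emeasure M B = emeasure M2 (A \<times> B)"
proof -
  have AB: "A \<in> sets lebesgue" "B \<in> sets lebesgue" "A \<subseteq> D" "B \<subseteq> D"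
    using assms by (auto simp: sets_restrict_space_iff)
  show "A \<times> B \<in> sets M2"
    using AB DD(3) lebesgue_Times(1)[OF AB(1,2)] by (subst sets_restrict_space_iff) auto
  show "emeasure M A * emeasure M B = emeasure M2 (A \<times> B)"
    using AB DD(3) lebesgue_Times(2)[OF AB(1,2)]
    by (subst (1 2 3) emeasure_restrict_space) auto
qed

lemma sets_N: "sets N \<subseteq> sets M2"
proof -
  have "{a \<times> b |a b. a \<in> sets M \<and> b \<in> sets M} \<subseteq> sets M2" using Times_M2(1) by auto
  then show ?thesis
    unfolding sets_pair_measure using sets.sigma_sets_subset[of _ M2] by simp
qed

lemma space_N: "space N = space M2"
  by (simp add: space_pair_measure)

text \<open>Pushing \<open>M2\<close> forward under the identity restricts it to the product
  sigma-algebra. The result has the right value on rectangles, and that characterises the product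
  measure.\<close>

lemma emeasure_N: assumes "A \<in> sets N" shows "emeasure N A = emeasure M2 A"
proof -
  have id: "(\<lambda>x. x) \<in> measurable M2 N"
    using sets_N space_N sets.sets_into_space[of _ N] by (auto simp: measurable_def Int_absorb2 simp del: space_lebesgue_on)
  have "N = distr M2 N (\<lambda>x. x)"
  proof (rule pair_measure_eqI)
    fix A B assume AB: "A \<in> sets M" "B \<in> sets M"
    have "A \<times> B \<subseteq> space M2" using Times_M2(1)[OF AB] by (rule sets.sets_into_space)
    then show "emeasure M A * emeasure M B = emeasure (distr M2 N (\<lambda>x. x)) (A \<times> B)"
      using AB id by (subst emeasure_distr) (auto simp: Times_M2(2) Int_absorb2)
  qed (auto intro: sigma_finite_measure_axioms)
  then have "emeasure N A = emeasure (distr M2 N (\<lambda>x. x)) A" by simp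
  also have "\<dots> = emeasure M2 A"
    using assms id sets.sets_into_space[OF assms] space_N by (subst emeasure_distr) (auto simp: Int_absorb2)
  finally show ?thesis .
qed

lemma measurable_N_M2: "f \<in> borel_measurable N \<Longrightarrow> f \<in> borel_measurable M2"
  using sets_N space_N by (auto simp: measurable_def simp del: space_lebesgue_on)

lemma integral_N: "f \<in> borel_measurable N \<Longrightarrow> integral\<^sup>L N f = (integral\<^sup>L M2 f :: real)"
  by (rule integral_subalgebra[OF _ sets_N space_N emeasure_N])

lemma integrable_N:
  fixes f :: "_ \<Rightarrow> real"
  shows "f \<in> borel_measurable N \<Longrightarrow> integrable N f \<longleftrightarrow> integrable M2 f"
  by (rule integrable_subalgebra[OF _ sets_N space_N emeasure_N])

lemma sq_int_N:
  assumes "f \<in> sq_int N" shows "f \<in> sq_int M2"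
proof (rule sq_intI)
  have m: "f \<in> borel_measurable N" and i: "integrable N (\<lambda>x. (f x)\<^sup>2)" using assms by auto
  show "f \<in> borel_measurable M2" by (rule measurable_N_M2[OF m])
  show "integrable M2 (\<lambda>x. (f x)\<^sup>2)" using integrable_N[of "\<lambda>x. (f x)\<^sup>2"] m i by simp
qed

lemma nrm_N: assumes "f \<in> borel_measurable N" shows "nrm N f = nrm M2 f"
  unfolding nrm_def using assms by (subst integral_N) auto

lemma AE_N: assumes "AE z in N. P z" shows "AE z in M2. P z"
proof -
  obtain Z where Z: "{z \<in> space N. \<not> P z} \<subseteq> Z" "emeasure N Z = 0" "Z \<in> sets N"
    using assms by (rule AE_E)
  show ?thesis
    by (rule AE_I[of M2 P Z]) (use Z sets_N emeasure_N[OF Z(3)] space_N in auto)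
qed

lemma borel_measurable_N:
  assumes "f \<in> borel_measurable borel" shows "f \<in> borel_measurable N"
proof -
  have id: "(\<lambda>x. x) \<in> measurable M borel" by (rule borel_measurable_lebesgue_onI) simp
  have "fst \<in> measurable N borel" by (rule measurable_compose[OF measurable_fst id])
  moreover have "snd \<in> measurable N borel" by (rule measurable_compose[OF measurable_snd id])
  ultimately have "(\<lambda>z. (fst z, snd z)) \<in> measurable N borel" by (intro borel_measurable_Pair)
  from measurable_compose[OF this assms] show ?thesis by simp
qed

section \<open>Null sets and integrals of functions with separated variables\<close>

lemma AE_fst: "AE x in M. P x \<Longrightarrow> AE z in N. P (fst z)"
proof -
  assume "AE x in M. P x"
  then obtain Z where Z: "{z \<in> space M. \<not> P z} \<subseteq> Z" "emeasure M Z = 0" "Z \<in> sets M" by (rule AE_E)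
  have "Z \<times> space M \<in> null_sets N" using Z by (intro times_in_null_sets1) (auto simp: null_sets_def)
  then show ?thesis by (rule AE_I') (use Z in \<open>auto simp: space_pair_measure\<close>)
qed

lemma AE_snd: "AE x in M. P x \<Longrightarrow> AE z in N. P (snd z)"
proof -
  assume "AE x in M. P x"
  then obtain Z where Z: "{z \<in> space M. \<not> P z} \<subseteq> Z" "emeasure M Z = 0" "Z \<in> sets M" by (rule AE_E)
  have "space M \<times> Z \<in> null_sets N" using Z by (intro times_in_null_sets2) (auto simp: null_sets_def)
  then show ?thesis by (rule AE_I') (use Z in \<open>auto simp: space_pair_measure\<close>)
qed

lemma integral_tensor:
  fixes a b :: "_ \<Rightarrow> real"
  assumes a: "integrable M a" and b: "integrable M b"
  shows "integrable N (\<lambda>z. a (fst z) * b (snd z))"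
    "(\<integral>z. a (fst z) * b (snd z) \<partial>N) = (\<integral>x. a x \<partial>M) * (\<integral>x. b x \<partial>M)"
proof -
  have [measurable]: "a \<in> borel_measurable M" "b \<in> borel_measurable M" using a b by auto
  have "integrable N (\<lambda>(x, y). a x * b y)"
  proof (rule pair.Fubini_integrable)
    show "(\<lambda>(x, y). a x * b y) \<in> borel_measurable N" by measurable
    show "integrable M (\<lambda>x. \<integral>y. norm (case (x, y) of (x, y) \<Rightarrow> a x * b y) \<partial>M)"
      using a b by (simp add: abs_mult)
    show "AE x in M. integrable M (\<lambda>y. case (x, y) of (x, y) \<Rightarrow> a x * b y)"
      using b by simp
  qed
  then show i: "integrable N (\<lambda>z. a (fst z) * b (snd z))" by (simp add: case_prod_beta')
  have "(\<integral>z. a (fst z) * b (snd z) \<partial>N) = (\<integral>x. \<integral>y. a x * b y \<partial>M \<partial>M)"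
    using pair.integral_fst'[OF i] by simp
  then show "(\<integral>z. a (fst z) * b (snd z) \<partial>N) = (\<integral>x. a x \<partial>M) * (\<integral>x. b x \<partial>M)" by simp
qed

lemma sq_int_tensor:
  assumes a: "a \<in> sq_int M" and b: "b \<in> sq_int M"
  shows "(\<lambda>z. a (fst z) * b (snd z)) \<in> sq_int N"
proof (rule sq_intI)
  show "(\<lambda>z. a (fst z) * b (snd z)) \<in> borel_measurable N"
    using a b by (auto dest!: sq_intD(1))
  show "integrable N (\<lambda>z. (a (fst z) * b (snd z))\<^sup>2)"
    using integral_tensor(1)[of "\<lambda>x. (a x)\<^sup>2" "\<lambda>x. (b x)\<^sup>2"] a b by (simp add: power_mult_distrib sq_int_def)
qed

end

section \<open>Algebraic tensors\<close>

text \<open>The jet embedding applied in each variable. The index pair (None, None) gives the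
  function itself, and (Some i, Some j) the entry (i, j) of its mixed gradient.\<close>

definition tensor_jet :: "(real^'d) set \<Rightarrow> 'd option \<Rightarrow> 'd option \<Rightarrow> (real^'d) tensor
    \<Rightarrow> (real^'d) \<times> (real^'d) \<Rightarrow> real" where
  "tensor_jet D e e' T z = (\<Sum>(a, b)\<leftarrow>T. jet D e a (fst z) * jet D e' b (snd z))"

lemma tensor_jet_None: "tensor_jet D None None T = tensor_fun T"
  by (simp add: tensor_jet_def tensor_fun_def fun_eq_iff)

lemma tensor_jet_Nil [simp]: "tensor_jet D e e' [] z = 0"
  by (simp add: tensor_jet_def)

lemma tensor_jet_Cons [simp]:
  "tensor_jet D e e' ((a, b) # T) z = jet D e a (fst z) * jet D e' b (snd z) + tensor_jet D e e' T z"
  by (simp add: tensor_jet_def)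

lemma tensor_jet_append: "tensor_jet D e e' (S @ T) z = tensor_jet D e e' S z + tensor_jet D e e' T z"
  by (simp add: tensor_jet_def)

text \<open>Freezing one variable must leave a test function in the other, so that the one-variable
  weak derivatives can be used inside an iterated integral. The slices are controlled by the
  projections of the compact support.\<close>

lemma test_fun_section:
  fixes \<phi> :: "'a::euclidean_space \<times> 'b::euclidean_space \<Rightarrow> real"
  assumes "\<phi> \<in> test_functions (D \<times> E)"
  shows "(\<lambda>x. \<phi> (x, y)) \<in> test_functions D" "(\<lambda>y. \<phi> (x, y)) \<in> test_functions E"
proof -
  define K where "K = closure {z. \<phi> z \<noteq> 0}"
  have K: "compact K" "K \<subseteq> D \<times> E" using assms by (auto simp: test_functions_def K_def)
  have K': "\<phi> z \<noteq> 0 \<Longrightarrow> z \<in> K" for z unfolding K_def using closure_subset by fastforce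
  have 1: "closure {x. \<phi> (x, y) \<noteq> 0} \<subseteq> {x. (x, y) \<in> K}"
  proof (rule closure_minimal)
    have "closed ((\<lambda>x. (x, y)) -` K)"
      using K(1) by (intro closed_vimage compact_imp_closed continuous_intros)
    then show "closed {x. (x, y) \<in> K}" by (simp add: vimage_def)
  qed (use K' in auto)
  have 2: "closure {y. \<phi> (x, y) \<noteq> 0} \<subseteq> {y. (x, y) \<in> K}"
  proof (rule closure_minimal)
    have "closed ((\<lambda>y. (x, y)) -` K)"
      using K(1) by (intro closed_vimage compact_imp_closed continuous_intros)
    then show "closed {y. (x, y) \<in> K}" by (simp add: vimage_def)
  qed (use K' in auto)
  have "bounded (fst ` K)" "bounded (snd ` K)"
    using K(1) by (auto intro!: compact_imp_bounded compact_continuous_image continuous_intros)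
  moreover have "{x. (x, y) \<in> K} \<subseteq> fst ` K" "{y. (x, y) \<in> K} \<subseteq> snd ` K" by force+
  ultimately have "bounded {x. (x, y) \<in> K}" "bounded {y. (x, y) \<in> K}" by (auto intro: bounded_subset)
  then have "compact (closure {x. \<phi> (x, y) \<noteq> 0})" "compact (closure {y. \<phi> (x, y) \<noteq> 0})"
    using 1 2 by (auto simp: compact_eq_bounded_closed intro: bounded_subset)
  moreover have "C_k k (\<lambda>x. \<phi> (x, y))" "C_k k (\<lambda>y. \<phi> (x, y))" for k
    using C_k_section[OF test_funD(1)[OF assms]] by auto
  ultimately show "(\<lambda>x. \<phi> (x, y)) \<in> test_functions D" "(\<lambda>y. \<phi> (x, y)) \<in> test_functions E"
    using 1 2 K(2) by (auto simp: test_functions_def)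
qed

lemma axis_Pair_in_Basis:
  "(axis i (1::real), 0::'b::euclidean_space) \<in> Basis" "(0::'b, axis i (1::real)) \<in> Basis"
  using axis_in_Basis[of i] by (auto simp: Basis_prod_def)

context bounded_open begin

section \<open>The tensor norm expressed by L2 norms of jets\<close>

lemma tensor_jet_sq_int:
  assumes "set T \<subseteq> H1 D \<times> H1 D" shows "tensor_jet D e e' T \<in> sq_int N"
  using assms
proof (induction T)
  case Nil
  then show ?case by (simp add: tensor_jet_def[abs_def])
next
  case (Cons ab T)
  obtain a b where ab: "ab = (a, b)" by (cases ab)
  have "(\<lambda>z. jet D e a (fst z) * jet D e' b (snd z) + tensor_jet D e e' T z) \<in> sq_int N"
    using Cons ab by (intro sq_int_add sq_int_tensor jet_sq_int) auto
  then show ?case unfolding ab tensor_jet_Cons[abs_def] by (simp add: eta_contract_eq)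
qed

text \<open>Both sides are additive in the entries of each list. For two elementary tensors Fubini
  splits each integral into a product, and the double sum of these products is the product of two H1
  inner products.\<close>

lemma tensor_inner_jet:
  assumes S: "set S \<subseteq> H1 D \<times> H1 D" and T: "set T \<subseteq> H1 D \<times> H1 D"
  shows "tensor_inner (H1_inner D) S T
    = (\<Sum>e\<in>UNIV. \<Sum>e'\<in>UNIV. \<integral>z. tensor_jet D e e' S z * tensor_jet D e e' T z \<partial>N)"
proof -
  have one: "(\<Sum>(c, d)\<leftarrow>T. H1_inner D a c * H1_inner D b d)
    = (\<Sum>e\<in>UNIV. \<Sum>e'\<in>UNIV. \<integral>z. jet D e a (fst z) * jet D e' b (snd z) * tensor_jet D e e' T z \<partial>N)"
    if a: "a \<in> H1 D" and b: "b \<in> H1 D" for a b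
    using T
  proof (induction T)
    case Nil
    then show ?case by simp
  next
    case (Cons cd T)
    obtain c d where cd: "cd = (c, d)" by (cases cd)
    have c: "c \<in> H1 D" and d: "d \<in> H1 D" and T: "set T \<subseteq> H1 D \<times> H1 D" using Cons.prems cd by auto
    have "(\<integral>z. jet D e a (fst z) * jet D e' b (snd z) * tensor_jet D e e' (cd # T) z \<partial>N)
      = (\<integral>x. jet D e a x * jet D e c x \<partial>M) * (\<integral>y. jet D e' b y * jet D e' d y \<partial>M)
        + (\<integral>z. jet D e a (fst z) * jet D e' b (snd z) * tensor_jet D e e' T z \<partial>N)" for e e'
    proof -
      have i: "integrable M (\<lambda>x. jet D e a x * jet D e c x)" "integrable M (\<lambda>y. jet D e' b y * jet D e' d y)"
        by (intro sq_int_mult_integrable jet_sq_int a b c d)+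
      have i2: "integrable N (\<lambda>z. jet D e a (fst z) * jet D e' b (snd z) * tensor_jet D e e' T z)"
        by (intro sq_int_mult_integrable sq_int_tensor jet_sq_int tensor_jet_sq_int a b T)
      have "(\<integral>z. jet D e a (fst z) * jet D e' b (snd z) * tensor_jet D e e' (cd # T) z \<partial>N)
        = (\<integral>z. (jet D e a (fst z) * jet D e c (fst z)) * (jet D e' b (snd z) * jet D e' d (snd z))
            + jet D e a (fst z) * jet D e' b (snd z) * tensor_jet D e e' T z \<partial>N)"
        unfolding cd by (intro Bochner_Integration.integral_cong refl) (simp add: algebra_simps)
      also have "\<dots> = (\<integral>z. (jet D e a (fst z) * jet D e c (fst z)) * (jet D e' b (snd z) * jet D e' d (snd z)) \<partial>N)
          + (\<integral>z. jet D e a (fst z) * jet D e' b (snd z) * tensor_jet D e e' T z \<partial>N)"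
        by (rule Bochner_Integration.integral_add[OF integral_tensor(1)[OF i] i2])
      finally show ?thesis unfolding integral_tensor(2)[OF i] .
    qed
    then show ?case
      using Cons.IH[OF T] by (simp add: cd H1_inner_jet a b c d sum_product sum.distrib)
  qed
  show ?thesis using S
  proof (induction S)
    case Nil
    then show ?case by (simp add: tensor_inner_def)
  next
    case (Cons ab S)
    obtain a b where ab: "ab = (a, b)" by (cases ab)
    have a: "a \<in> H1 D" and b: "b \<in> H1 D" and S: "set S \<subseteq> H1 D \<times> H1 D" using Cons.prems ab by auto
    have "(\<integral>z. tensor_jet D e e' (ab # S) z * tensor_jet D e e' T z \<partial>N)
        = (\<integral>z. jet D e a (fst z) * jet D e' b (snd z) * tensor_jet D e e' T z \<partial>N)
          + (\<integral>z. tensor_jet D e e' S z * tensor_jet D e e' T z \<partial>N)" for e e'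
    proof -
      have "integrable N (\<lambda>z. jet D e a (fst z) * jet D e' b (snd z) * tensor_jet D e e' T z)"
        by (intro sq_int_mult_integrable sq_int_tensor jet_sq_int tensor_jet_sq_int a b T)
      moreover have "integrable N (\<lambda>z. tensor_jet D e e' S z * tensor_jet D e e' T z)"
        by (intro sq_int_mult_integrable tensor_jet_sq_int S T)
      ultimately show ?thesis by (simp add: ab distrib_right)
    qed
    then show ?case
      using Cons.IH[OF S] one[OF a b] by (simp add: tensor_inner_def ab sum.distrib)
  qed
qed

lemma tensor_norm_jet:
  assumes "set T \<subseteq> H1 D \<times> H1 D"
  shows "(tensor_norm (H1_inner D) T)\<^sup>2 = (\<Sum>e\<in>UNIV. \<Sum>e'\<in>UNIV. (nrm N (tensor_jet D e e' T))\<^sup>2)"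
    "0 \<le> tensor_norm (H1_inner D) T"
proof -
  have "tensor_inner (H1_inner D) T T = (\<Sum>e\<in>UNIV. \<Sum>e'\<in>UNIV. (nrm N (tensor_jet D e e' T))\<^sup>2)"
    unfolding tensor_inner_jet[OF assms assms] nrm_power2 by (simp add: power2_eq_square)
  moreover have "\<dots> \<ge> 0" by (intro sum_nonneg) simp
  ultimately show "(tensor_norm (H1_inner D) T)\<^sup>2 = (\<Sum>e\<in>UNIV. \<Sum>e'\<in>UNIV. (nrm N (tensor_jet D e e' T))\<^sup>2)"
    "0 \<le> tensor_norm (H1_inner D) T"
    by (auto simp: tensor_norm_def)
qed

lemma tensor_diff_H1:
  assumes "set S \<subseteq> H1 D \<times> H1 D" "set T \<subseteq> H1 D \<times> H1 D"
  shows "set (tensor_diff S T) \<subseteq> H1 D \<times> H1 D"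
  using assms H1_lincomb(1)[of _ _ "-1" 0] by (fastforce simp: tensor_diff_def)

lemma tensor_jet_diff_AE:
  assumes "set S \<subseteq> H1 D \<times> H1 D" "set T \<subseteq> H1 D \<times> H1 D"
  shows "AE z in N. tensor_jet D e e' (tensor_diff S T) z = tensor_jet D e e' S z - tensor_jet D e e' T z"
proof -
  have "AE z in N. tensor_jet D e e' (map (\<lambda>(a, b). (\<lambda>x. - a x, b)) T) z = - tensor_jet D e e' T z"
    using assms(2)
  proof (induction T)
    case Nil
    then show ?case by simp
  next
    case (Cons ab T)
    obtain a b where ab: "ab = (a, b)" by (cases ab)
    have "AE x in M. jet D e (\<lambda>x. - a x) x = - jet D e a x"
      using jet_cmult_AE[of a e "-1"] Cons.prems ab by simp
    then have "AE z in N. jet D e (\<lambda>x. - a x) (fst z) = - jet D e a (fst z)" by (rule AE_fst)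
    moreover have "AE z in N. tensor_jet D e e' (map (\<lambda>(a, b). (\<lambda>x. - a x, b)) T) z = - tensor_jet D e e' T z"
      using Cons by auto
    ultimately show ?case by eventually_elim (simp add: ab)
  qed
  then show ?thesis by eventually_elim (simp add: tensor_diff_def tensor_jet_append)
qed

text \<open>Makes the Cauchy condition of \<open>H11\<close> equivalent to finitely many L2 Cauchy
  conditions, one for each pair of jet indices.\<close>

lemma tensor_norm_diff:
  assumes S: "set S \<subseteq> H1 D \<times> H1 D" and T: "set T \<subseteq> H1 D \<times> H1 D"
  shows "(tensor_norm (H1_inner D) (tensor_diff S T))\<^sup>2
    = (\<Sum>e\<in>UNIV. \<Sum>e'\<in>UNIV. (nrm N (\<lambda>z. tensor_jet D e e' S z - tensor_jet D e e' T z))\<^sup>2)"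
proof -
  have "nrm N (tensor_jet D e e' (tensor_diff S T)) = nrm N (\<lambda>z. tensor_jet D e e' S z - tensor_jet D e e' T z)" for e e'
    using tensor_jet_sq_int[OF tensor_diff_H1[OF S T], of e e'] tensor_jet_diff_AE[OF S T, of e e']
      sq_int_diff[OF tensor_jet_sq_int[OF S, of e e'] tensor_jet_sq_int[OF T, of e e']]
    by (intro nrm_cong_AE) auto
  then show ?thesis by (simp add: tensor_norm_jet(1)[OF tensor_diff_H1[OF S T]])
qed

lemma nrm_tensor_jet_diff_le:
  assumes S: "set S \<subseteq> H1 D \<times> H1 D" and T: "set T \<subseteq> H1 D \<times> H1 D"
  shows "nrm N (\<lambda>z. tensor_jet D e e' S z - tensor_jet D e e' T z) \<le> tensor_norm (H1_inner D) (tensor_diff S T)"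
proof (rule power2_le_imp_le)
  have "(nrm N (\<lambda>z. tensor_jet D e e' S z - tensor_jet D e e' T z))\<^sup>2
      \<le> (\<Sum>e'\<in>UNIV. (nrm N (\<lambda>z. tensor_jet D e e' S z - tensor_jet D e e' T z))\<^sup>2)"
    by (rule member_le_sum) auto
  also have "\<dots> \<le> (\<Sum>e\<in>UNIV. \<Sum>e'\<in>UNIV. (nrm N (\<lambda>z. tensor_jet D e e' S z - tensor_jet D e e' T z))\<^sup>2)"
    by (rule member_le_sum[of e UNIV "\<lambda>e. \<Sum>e'\<in>UNIV. (nrm N (\<lambda>z. tensor_jet D e e' S z - tensor_jet D e e' T z))\<^sup>2"])
      (auto intro: sum_nonneg)
  finally show "(nrm N (\<lambda>z. tensor_jet D e e' S z - tensor_jet D e e' T z))\<^sup>2 \<le> (tensor_norm (H1_inner D) (tensor_diff S T))\<^sup>2"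
    unfolding tensor_norm_diff[OF S T] .
  show "0 \<le> tensor_norm (H1_inner D) (tensor_diff S T)" by (rule tensor_norm_jet(2)[OF tensor_diff_H1[OF S T]])
qed

text \<open>For an elementary tensor integrate by parts in x with y frozen, exchange the order of
  integration, and integrate by parts in y with x frozen; the two signs cancel. The general case
  follows by induction on the list.\<close>

lemma tensor_weak_grad_xy:
  assumes T: "set T \<subseteq> H1 D \<times> H1 D" and \<phi>: "\<phi> \<in> test_functions (D \<times> D)"
  shows "(\<integral>z. tensor_fun T z * partial_deriv (axis i 1, 0) (partial_deriv (0, axis j 1) \<phi>) z \<partial>N)
    = (\<integral>z. tensor_jet D (Some i) (Some j) T z * \<phi> z \<partial>N)"
proof -
  define \<psi> where "\<psi> = partial_deriv (0, axis j 1) \<phi>"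
  define \<kappa> where "\<kappa> = partial_deriv (axis i 1, 0) \<psi>"
  have \<psi>: "\<psi> \<in> test_functions (D \<times> D)"
    unfolding \<psi>_def by (rule test_fun_partial_deriv[OF \<phi> axis_Pair_in_Basis(2)])
  have \<kappa>: "\<kappa> \<in> test_functions (D \<times> D)"
    unfolding \<kappa>_def by (rule test_fun_partial_deriv[OF \<psi> axis_Pair_in_Basis(1)])
  have tN: "f \<in> sq_int N" if "f \<in> test_functions (D \<times> D)" for f
  proof -
    have m: "f \<in> borel_measurable N" by (rule borel_measurable_N[OF test_funD(4)[OF that]])
    have "integrable M2 (\<lambda>z. (f z)\<^sup>2)" using test_fun_sq_int[OF DD(1,2) that] by auto
    then show ?thesis using m integrable_N[of "\<lambda>z. (f z)\<^sup>2"] by (intro sq_intI) auto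
  qed
  have one: "(\<integral>z. a (fst z) * b (snd z) * \<kappa> z \<partial>N) = (\<integral>z. jet D (Some i) a (fst z) * jet D (Some j) b (snd z) * \<phi> z \<partial>N)"
    if a: "a \<in> H1 D" and b: "b \<in> H1 D" for a b
  proof -
    have i: "integrable N (\<lambda>z. a (fst z) * b (snd z) * \<kappa> z)"
      "integrable N (\<lambda>z. jet D (Some i) a (fst z) * b (snd z) * \<psi> z)"
      "integrable N (\<lambda>z. jet D (Some i) a (fst z) * jet D (Some j) b (snd z) * \<phi> z)"
      by (intro sq_int_mult_integrable sq_int_tensor jet_sq_int H1_sq_int a b tN[OF \<phi>] tN[OF \<psi>] tN[OF \<kappa>])+
    have in1: "(\<integral>x. a x * b y * \<kappa> (x, y) \<partial>M) = - (\<integral>x. jet D (Some i) a x * b y * \<psi> (x, y) \<partial>M)" for y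
    proof -
      have \<psi>y: "(\<lambda>x. \<psi> (x, y)) \<in> test_functions D" by (rule test_fun_section(1)[OF \<psi>])
      have "(\<integral>x. a x * \<kappa> (x, y) \<partial>M) = - (\<integral>x. jet D (Some i) a x * \<psi> (x, y) \<partial>M)"
        using is_weak_gradD(2)[OF weak_grad_works[OF a] \<psi>y, of i]
        unfolding partial_deriv_section(1)[OF test_funD(2)[OF \<psi>]] \<kappa>_def by simp
      moreover have "(\<lambda>x. a x * b y * \<kappa> (x, y)) = (\<lambda>x. b y * (a x * \<kappa> (x, y)))"
        "(\<lambda>x. jet D (Some i) a x * b y * \<psi> (x, y)) = (\<lambda>x. b y * (jet D (Some i) a x * \<psi> (x, y)))"
        by (auto simp: fun_eq_iff)
      ultimately show ?thesis by simp
    qed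
    have in2: "(\<integral>y. jet D (Some i) a x * b y * \<psi> (x, y) \<partial>M)
        = - (\<integral>y. jet D (Some i) a x * jet D (Some j) b y * \<phi> (x, y) \<partial>M)" for x
    proof -
      have \<phi>x: "(\<lambda>y. \<phi> (x, y)) \<in> test_functions D" by (rule test_fun_section(2)[OF \<phi>])
      have "(\<integral>y. b y * \<psi> (x, y) \<partial>M) = - (\<integral>y. jet D (Some j) b y * \<phi> (x, y) \<partial>M)"
        using is_weak_gradD(2)[OF weak_grad_works[OF b] \<phi>x, of j]
        unfolding partial_deriv_section(2)[OF test_funD(2)[OF \<phi>]] \<psi>_def by simp
      then show ?thesis by (simp add: mult.assoc)
    qed
    have "(\<integral>z. a (fst z) * b (snd z) * \<kappa> z \<partial>N) = (\<integral>y. \<integral>x. a x * b y * \<kappa> (x, y) \<partial>M \<partial>M)"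
      using pair.integral_snd[of "\<lambda>x y. a x * b y * \<kappa> (x, y)"] i(1) by (simp add: case_prod_beta')
    also have "\<dots> = - (\<integral>y. \<integral>x. jet D (Some i) a x * b y * \<psi> (x, y) \<partial>M \<partial>M)"
      unfolding in1 by (rule Bochner_Integration.integral_minus)
    also have "(\<integral>y. \<integral>x. jet D (Some i) a x * b y * \<psi> (x, y) \<partial>M \<partial>M)
        = (\<integral>z. jet D (Some i) a (fst z) * b (snd z) * \<psi> z \<partial>N)"
      using pair.integral_snd[of "\<lambda>x y. jet D (Some i) a x * b y * \<psi> (x, y)"] i(2) by (simp add: case_prod_beta')
    also have "\<dots> = (\<integral>x. \<integral>y. jet D (Some i) a x * b y * \<psi> (x, y) \<partial>M \<partial>M)"
      using pair.integral_fst'[OF i(2)] by simp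
    also have "\<dots> = - (\<integral>x. \<integral>y. jet D (Some i) a x * jet D (Some j) b y * \<phi> (x, y) \<partial>M \<partial>M)"
      unfolding in2 by (rule Bochner_Integration.integral_minus)
    also have "(\<integral>x. \<integral>y. jet D (Some i) a x * jet D (Some j) b y * \<phi> (x, y) \<partial>M \<partial>M)
        = (\<integral>z. jet D (Some i) a (fst z) * jet D (Some j) b (snd z) * \<phi> z \<partial>N)"
      using pair.integral_fst'[OF i(3)] by simp
    also have "- (- (\<integral>z. jet D (Some i) a (fst z) * jet D (Some j) b (snd z) * \<phi> z \<partial>N))
        = (\<integral>z. jet D (Some i) a (fst z) * jet D (Some j) b (snd z) * \<phi> z \<partial>N)" by simp
    finally show ?thesis .
  qed
  have "(\<integral>z. tensor_fun T z * \<kappa> z \<partial>N) = (\<integral>z. tensor_jet D (Some i) (Some j) T z * \<phi> z \<partial>N)"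
    using T
  proof (induction T)
    case Nil
    then show ?case by (simp add: tensor_fun_def)
  next
    case (Cons ab T)
    obtain a b where ab: "ab = (a, b)" by (cases ab)
    have a: "a \<in> H1 D" and b: "b \<in> H1 D" and T: "set T \<subseteq> H1 D \<times> H1 D" using Cons.prems ab by auto
    have i: "integrable N (\<lambda>z. a (fst z) * b (snd z) * \<kappa> z)"
      "integrable N (\<lambda>z. tensor_fun T z * \<kappa> z)"
      "integrable N (\<lambda>z. jet D (Some i) a (fst z) * jet D (Some j) b (snd z) * \<phi> z)"
      "integrable N (\<lambda>z. tensor_jet D (Some i) (Some j) T z * \<phi> z)"
      by (intro sq_int_mult_integrable sq_int_tensor jet_sq_int tensor_jet_sq_int H1_sq_int a b T
          tN[OF \<phi>] tN[OF \<kappa>] tensor_jet_sq_int[OF T, of None None, unfolded tensor_jet_None])+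
    have f: "tensor_fun (ab # T) z = a (fst z) * b (snd z) + tensor_fun T z" for z
      by (simp add: tensor_fun_def ab case_prod_beta')
    show ?case
      using i one[OF a b] Cons.IH[OF T] unfolding f by (simp add: ab distrib_right)
  qed
  then show ?thesis unfolding \<kappa>_def \<psi>_def .
qed

text \<open>With one variable frozen, a tensor is such a combination of functions of the other
  variable; the Poincare inequality is applied to these slices.\<close>

lemma H10_sum_list:
  assumes "\<forall>(c, u) \<in> set L. u \<in> H10 D"
  shows "(\<lambda>x. \<Sum>(c, u)\<leftarrow>L. c * u x) \<in> H10 D"
    "AE x in M. jet D e (\<lambda>x. \<Sum>(c, u)\<leftarrow>L. c * u x) x = (\<Sum>(c, u)\<leftarrow>L. c * jet D e u x)"
proof -
  have "(\<lambda>x. \<Sum>(c, u)\<leftarrow>L. c * u x) \<in> H10 D \<and>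
    (AE x in M. jet D e (\<lambda>x. \<Sum>(c, u)\<leftarrow>L. c * u x) x = (\<Sum>(c, u)\<leftarrow>L. c * jet D e u x))"
    using assms
  proof (induction L)
    case Nil
    then show ?case using H10_zero jet_zero_AE by simp
  next
    case (Cons cu L)
    obtain c u where cu: "cu = (c, u)" by (cases cu)
    define v where "v = (\<lambda>x. \<Sum>(c, u)\<leftarrow>L. c * u x)"
    have u: "u \<in> H10 D" using Cons.prems cu by simp
    have v: "v \<in> H10 D" "AE x in M. jet D e v x = (\<Sum>(c, u)\<leftarrow>L. c * jet D e u x)"
      using Cons unfolding v_def by auto
    have eq: "(\<lambda>x. \<Sum>(c, u)\<leftarrow>cu # L. c * u x) = (\<lambda>x. c * u x + 1 * v x)"
      by (simp add: cu v_def)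
    show ?case unfolding eq
    proof
      show "(\<lambda>x. c * u x + 1 * v x) \<in> H10 D" by (rule H10_lincomb[OF u v(1)])
      show "AE x in M. jet D e (\<lambda>x. c * u x + 1 * v x) x = (\<Sum>(c, u)\<leftarrow>cu # L. c * jet D e u x)"
        using H1_lincomb(2)[OF H10_H1[OF u] H10_H1[OF v(1)], of e c 1] v(2)
        by eventually_elim (simp add: cu)
    qed
  qed
  then show "(\<lambda>x. \<Sum>(c, u)\<leftarrow>L. c * u x) \<in> H10 D"
    "AE x in M. jet D e (\<lambda>x. \<Sum>(c, u)\<leftarrow>L. c * u x) x = (\<Sum>(c, u)\<leftarrow>L. c * jet D e u x)" by auto
qed

lemma poincare_sum_list:
  assumes "\<forall>(c, u) \<in> set L. u \<in> H10 D"
    and C: "\<And>u. u \<in> H10 D \<Longrightarrow> nrm M u \<le> C * nrm M (jet D (Some i) u)"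
  shows "(\<integral>x. (\<Sum>(c, u)\<leftarrow>L. c * u x)\<^sup>2 \<partial>M) \<le> C\<^sup>2 * (\<integral>x. (\<Sum>(c, u)\<leftarrow>L. c * jet D (Some i) u x)\<^sup>2 \<partial>M)"
proof -
  let ?v = "\<lambda>x. \<Sum>(c, u)\<leftarrow>L. c * u x"
  let ?w = "\<lambda>x. \<Sum>(c, u)\<leftarrow>L. c * jet D (Some i) u x"
  note v = H10_sum_list[OF assms(1)]
  have m: "?w \<in> borel_measurable M"
    using assms(1)
  proof (induction L)
    case (Cons cu L)
    obtain c u where cu: "cu = (c, u)" by (cases cu)
    have "jet D (Some i) u \<in> borel_measurable M"
      using Cons.prems cu jet_sq_int[OF H10_H1, of u "Some i"] by auto
    then show ?case using Cons by (simp add: cu)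
  qed simp
  have "(nrm M ?v)\<^sup>2 \<le> (C * nrm M (jet D (Some i) ?v))\<^sup>2"
    by (intro power_mono C v) simp
  also have "nrm M (jet D (Some i) ?v) = nrm M ?w"
    using m v(2)[of "Some i"] jet_sq_int[OF H10_H1[OF v(1)], of "Some i"] by (intro nrm_cong_AE) auto
  finally show ?thesis by (simp add: power_mult_distrib nrm_power2)
qed

lemma nrm_N_iterated:
  assumes f: "f \<in> sq_int N"
  shows "(nrm N f)\<^sup>2 = (\<integral>x. \<integral>y. (f (x, y))\<^sup>2 \<partial>M \<partial>M)" "integrable M (\<lambda>x. \<integral>y. (f (x, y))\<^sup>2 \<partial>M)"
    "(nrm N f)\<^sup>2 = (\<integral>y. \<integral>x. (f (x, y))\<^sup>2 \<partial>M \<partial>M)" "integrable M (\<lambda>y. \<integral>x. (f (x, y))\<^sup>2 \<partial>M)"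
proof -
  have i: "integrable N (\<lambda>z. (f z)\<^sup>2)" using f by auto
  show "(nrm N f)\<^sup>2 = (\<integral>x. \<integral>y. (f (x, y))\<^sup>2 \<partial>M \<partial>M)"
    using pair.integral_fst'[OF i] by (simp add: nrm_power2)
  show "integrable M (\<lambda>x. \<integral>y. (f (x, y))\<^sup>2 \<partial>M)"
    using pair.integrable_fst'[OF i] by simp
  show "(nrm N f)\<^sup>2 = (\<integral>y. \<integral>x. (f (x, y))\<^sup>2 \<partial>M \<partial>M)"
    using pair.integral_snd[of "\<lambda>x y. (f (x, y))\<^sup>2"] i by (simp add: nrm_power2 case_prod_beta')
  show "integrable M (\<lambda>y. \<integral>x. (f (x, y))\<^sup>2 \<partial>M)"
    using pair.integrable_snd[of "\<lambda>x y. (f (x, y))\<^sup>2"] i by (simp add: case_prod_beta')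
qed

text \<open>The first pass goes from w to its x_i-derivative on slices with y frozen. That
  derivative has only L2 factors in x, but the second pass uses slices with x frozen, and their
  y-factors still lie in \<open>H10 D\<close>. Each pass costs a factor C.\<close>

lemma tensor_poincare:
  assumes C: "C \<ge> 0" "\<And>u. u \<in> H10 D \<Longrightarrow> nrm M u \<le> C * nrm M (jet D (Some i) u)"
    and T: "set T \<subseteq> H10 D \<times> H10 D"
  shows "nrm N (tensor_fun T) \<le> C\<^sup>2 * nrm N (tensor_jet D (Some i) (Some i) T)"
proof -
  have T1: "set T \<subseteq> H1 D \<times> H1 D" using T H10_H1 by auto
  let ?f = "tensor_jet D None None T" and ?g = "tensor_jet D (Some i) None T"
    and ?h = "tensor_jet D (Some i) (Some i) T"
  note sq = tensor_jet_sq_int[OF T1]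
  have 1: "(nrm N ?f)\<^sup>2 \<le> C\<^sup>2 * (nrm N ?g)\<^sup>2"
  proof -
    have "(\<integral>x. (?f (x, y))\<^sup>2 \<partial>M) \<le> C\<^sup>2 * (\<integral>x. (?g (x, y))\<^sup>2 \<partial>M)" for y
    proof -
      define L where "L = map (\<lambda>(a, b). (b y, a)) T"
      have "\<forall>(c, u) \<in> set L. u \<in> H10 D" using T by (auto simp: L_def)
      from poincare_sum_list[OF this C(2)]
      show ?thesis by (simp add: L_def tensor_jet_def case_prod_beta' comp_def mult.commute)
    qed
    then have "(\<integral>y. \<integral>x. (?f (x, y))\<^sup>2 \<partial>M \<partial>M) \<le> (\<integral>y. C\<^sup>2 * (\<integral>x. (?g (x, y))\<^sup>2 \<partial>M) \<partial>M)"
      by (intro integral_mono integrable_mult_right nrm_N_iterated sq)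
    then show ?thesis unfolding nrm_N_iterated(3)[OF sq] by simp
  qed
  have 2: "(nrm N ?g)\<^sup>2 \<le> C\<^sup>2 * (nrm N ?h)\<^sup>2"
  proof -
    have "(\<integral>y. (?g (x, y))\<^sup>2 \<partial>M) \<le> C\<^sup>2 * (\<integral>y. (?h (x, y))\<^sup>2 \<partial>M)" for x
    proof -
      define L where "L = map (\<lambda>(a, b). (jet D (Some i) a x, b)) T"
      have "\<forall>(c, u) \<in> set L. u \<in> H10 D" using T by (auto simp: L_def)
      from poincare_sum_list[OF this C(2)]
      show ?thesis by (simp add: L_def tensor_jet_def case_prod_beta' comp_def mult.commute)
    qed
    then have "(\<integral>x. \<integral>y. (?g (x, y))\<^sup>2 \<partial>M \<partial>M) \<le> (\<integral>x. C\<^sup>2 * (\<integral>y. (?h (x, y))\<^sup>2 \<partial>M) \<partial>M)"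
      by (intro integral_mono integrable_mult_right nrm_N_iterated sq)
    then show ?thesis unfolding nrm_N_iterated(1)[OF sq] by simp
  qed
  have "(nrm N ?f)\<^sup>2 \<le> C\<^sup>2 * (C\<^sup>2 * (nrm N ?h)\<^sup>2)"
    by (rule order_trans[OF 1 mult_left_mono[OF 2]]) simp
  also have "\<dots> = (C\<^sup>2 * nrm N ?h)\<^sup>2" by (simp add: power2_eq_square)
  finally have "nrm N ?f \<le> C\<^sup>2 * nrm N ?h" by (rule power2_le_imp_le) simp
  then show ?thesis by (simp add: tensor_jet_None)
qed

end

section \<open>Ellipticity of the tensorised coefficient\<close>

(* The induction step is symmetric Gaussian elimination on M. *)
lemma sum_mult_psd_nonneg:
  fixes C M :: "'i \<Rightarrow> 'i \<Rightarrow> real"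
  assumes "finite S"
    and "\<And>x. (\<Sum>j\<in>S. \<Sum>l\<in>S. C j l * x j * x l) \<ge> 0"
    and "\<And>j l. M j l = M l j"
    and "\<And>x. (\<Sum>j\<in>S. \<Sum>l\<in>S. M j l * x j * x l) \<ge> 0"
  shows "(\<Sum>j\<in>S. \<Sum>l\<in>S. C j l * M j l) \<ge> 0"
  using assms
proof (induction S arbitrary: M rule: finite_induct)
  case empty
  then show ?case by simp
next
  case (insert s S)
  have exp: "(\<Sum>j\<in>insert s S. \<Sum>l\<in>insert s S. f j l)
    = f s s + (\<Sum>l\<in>S. f s l) + (\<Sum>j\<in>S. f j s) + (\<Sum>j\<in>S. \<Sum>l\<in>S. f j l)" for f :: "'i \<Rightarrow> 'i \<Rightarrow> real"
    using insert.hyps by (simp add: sum.distrib)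
  have upd: "(\<Sum>j\<in>insert s S. \<Sum>l\<in>insert s S. K j l * (x(s := t)) j * (x(s := t)) l)
    = K s s * t * t + (\<Sum>l\<in>S. K s l * t * x l) + (\<Sum>j\<in>S. K j s * x j * t)
      + (\<Sum>j\<in>S. \<Sum>l\<in>S. K j l * x j * x l)" for K :: "'i \<Rightarrow> 'i \<Rightarrow> real" and x t
  proof -
    have ne: "j \<noteq> s" if "j \<in> S" for j using that insert.hyps by auto
    show ?thesis unfolding exp using ne by (auto intro!: arg_cong2[where f="(+)"] sum.cong)
  qed
  have Cpsd: "(\<Sum>j\<in>S. \<Sum>l\<in>S. C j l * x j * x l) \<ge> 0" for x
    using insert.prems(1)[of "x(s := 0)"] unfolding upd by simp
  have Mform: "M s s * t\<^sup>2 + 2 * t * (\<Sum>l\<in>S. M s l * x l) + (\<Sum>j\<in>S. \<Sum>l\<in>S. M j l * x j * x l) \<ge> 0" for t x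
  proof -
    have "0 \<le> (\<Sum>j\<in>insert s S. \<Sum>l\<in>insert s S. M j l * (x(s := t)) j * (x(s := t)) l)"
      by (rule insert.prems(3))
    also have "\<dots> = M s s * t * t + (\<Sum>l\<in>S. M s l * t * x l) + (\<Sum>j\<in>S. M j s * x j * t)
        + (\<Sum>j\<in>S. \<Sum>l\<in>S. M j l * x j * x l)"
      by (rule upd)
    also have "(\<Sum>l\<in>S. M s l * t * x l) = t * (\<Sum>l\<in>S. M s l * x l)"
      by (simp add: sum_distrib_left mult_ac)
    also have "(\<Sum>j\<in>S. M j s * x j * t) = t * (\<Sum>l\<in>S. M s l * x l)"
      by (simp add: sum_distrib_left mult_ac insert.prems(2)[of _ s])
    finally show ?thesis by (simp add: power2_eq_square mult.assoc)
  qed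
  have ss: "M s s \<ge> 0" using Mform[of 1 "\<lambda>_. 0"] by simp
  show ?case
  proof (cases "M s s = 0")
    case True
    \<comment> \<open>Test with the row \<open>M s\<close> itself: since the pivot is 0, the form is
      affine in t with slope 2 q, and nonnegativity forces q = 0.\<close>
    define q where "q = (\<Sum>l\<in>S. M s l * M s l)"
    define r where "r = (\<Sum>j\<in>S. \<Sum>l\<in>S. M j l * M s j * M s l)"
    have "2 * t * q + r \<ge> 0" for t
      using Mform[of t "M s"] True unfolding q_def r_def by simp
    \<comment> \<open>For q different from 0 this t would make the left-hand side equal to
      -1.\<close>
    from this[of "(- r - 1) / (2 * q)"] have "q = 0" by (cases "q = 0") (simp_all add: field_simps)
    then have z: "M s l = 0" if l: "l \<in> S" for l
      using l insert.hyps unfolding q_def by (subst (asm) sum_nonneg_eq_0_iff) auto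
    have "M l s = 0" if "l \<in> S" for l using z[OF that] insert.prems(2)[of l s] by simp
    then have "(\<Sum>j\<in>insert s S. \<Sum>l\<in>insert s S. C j l * M j l) = (\<Sum>j\<in>S. \<Sum>l\<in>S. C j l * M j l)"
      unfolding exp using z True by simp
    moreover have "\<dots> \<ge> 0"
    proof (rule insert.IH[OF Cpsd insert.prems(2)])
      show "(\<Sum>j\<in>S. \<Sum>l\<in>S. M j l * x j * x l) \<ge> 0" for x using Mform[of 0 x] by simp
    qed
    ultimately show ?thesis by simp
  next
    case False
    then have pos: "M s s > 0" using ss by simp
    \<comment> \<open>The Schur complement of the pivot \<open>M s s\<close>; its row and column s
      vanish.\<close>
    define M' where "M' j l = M j l - M s j * M s l / M s s" for j l
    have "(\<Sum>j\<in>S. \<Sum>l\<in>S. C j l * M' j l) \<ge> 0"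
    proof (rule insert.IH[OF Cpsd])
      show "M' j l = M' l j" for j l by (simp add: M'_def insert.prems(2)[of j l])
      show "(\<Sum>j\<in>S. \<Sum>l\<in>S. M' j l * x j * x l) \<ge> 0" for x
      proof -
        define q where "q = (\<Sum>l\<in>S. M s l * x l)"
        have "(\<Sum>j\<in>S. \<Sum>l\<in>S. M' j l * x j * x l)
          = (\<Sum>j\<in>S. \<Sum>l\<in>S. M j l * x j * x l - (M s j * x j) * (M s l * x l) / M s s)"
          by (intro sum.cong refl) (simp add: M'_def field_simps pos)
        also have "\<dots> = (\<Sum>j\<in>S. \<Sum>l\<in>S. M j l * x j * x l) - q * q / M s s"
          unfolding q_def by (simp add: sum_subtractf sum_product sum_divide_distrib)
        \<comment> \<open>Completing the square: t = - q / M s s minimises the form of M in the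
          coordinate s, and the minimum is the form of the Schur complement.\<close>
        also have "\<dots> = M s s * (- q / M s s)\<^sup>2 + 2 * (- q / M s s) * q + (\<Sum>j\<in>S. \<Sum>l\<in>S. M j l * x j * x l)"
          using pos by (simp add: power2_eq_square field_simps)
        also have "\<dots> \<ge> 0" unfolding q_def by (rule Mform)
        finally show ?thesis .
      qed
    qed
    moreover have "(\<Sum>j\<in>insert s S. \<Sum>l\<in>insert s S. C j l * M s j * M s l) \<ge> 0"
      by (rule insert.prems(1))
    \<comment> \<open>M is M' plus a rank-one matrix, whose pairing with C is the C-form at the row
      \<open>M s\<close> divided by the pivot.\<close>
    moreover have "(\<Sum>j\<in>insert s S. \<Sum>l\<in>insert s S. C j l * M j l)
      = (\<Sum>j\<in>insert s S. \<Sum>l\<in>insert s S. C j l * M' j l) + (\<Sum>j\<in>insert s S. \<Sum>l\<in>insert s S. C j l * M s j * M s l) / M s s"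
      unfolding sum_divide_distrib sum.distrib[symmetric]
      by (intro sum.cong refl) (simp add: M'_def field_simps pos)
    moreover have "(\<Sum>j\<in>insert s S. \<Sum>l\<in>insert s S. C j l * M' j l) = (\<Sum>j\<in>S. \<Sum>l\<in>S. C j l * M' j l)"
    proof -
      have "M' s l = 0" "M' l s = 0" for l
        using pos insert.prems(2)[of l s] by (simp_all add: M'_def)
      then show ?thesis unfolding exp by simp
    qed
    ultimately show ?thesis using pos by simp
  qed
qed

text \<open>With g_j the columns of G, the right-hand side is the entrywise pairing of Q with m j l
  = g_j . P g_l. Since m and Q - \<alpha> I are nonnegative, it is at least \<alpha> times the trace
  of m, and ellipticity of P bounds each m j j below by \<alpha> times the squared norm of
  g_j.\<close>

lemma tensor_elliptic:
  fixes P Q G :: "real^'d^'d"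
  assumes sym: "transpose P = P" and \<alpha>: "\<alpha> > 0"
    and P: "\<And>\<xi>. \<alpha> * (norm \<xi>)\<^sup>2 \<le> \<xi> \<bullet> (P *v \<xi>)" and Q: "\<And>\<xi>. \<alpha> * (norm \<xi>)\<^sup>2 \<le> \<xi> \<bullet> (Q *v \<xi>)"
  shows "\<alpha>\<^sup>2 * (\<Sum>i\<in>UNIV. \<Sum>j\<in>UNIV. (G $ i $ j)\<^sup>2)
    \<le> (\<Sum>i\<in>UNIV. \<Sum>j\<in>UNIV. \<Sum>k\<in>UNIV. \<Sum>l\<in>UNIV. P $ i $ k * Q $ j $ l * G $ k $ l * G $ i $ j)"
proof -
  define g where "g j = (\<chi> i. G $ i $ j)" for j
  define m where "m j l = g j \<bullet> (P *v g l)" for j l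
  define c where "c j l = Q $ j $ l - (if j = l then \<alpha> else 0)" for j l
  have m_eq: "m j l = (\<Sum>i\<in>UNIV. \<Sum>k\<in>UNIV. P $ i $ k * G $ k $ l * G $ i $ j)" for j l
    by (simp add: m_def g_def inner_vec_def matrix_vector_mult_def sum_distrib_left sum_distrib_right mult_ac)
  have "(\<Sum>j\<in>UNIV. \<Sum>l\<in>UNIV. c j l * m j l) \<ge> 0"
  proof (rule sum_mult_psd_nonneg)
    show "finite (UNIV::'d set)" by simp
    \<comment> \<open>Symmetry of P enters here, because the elimination argument requires a
      symmetric m.\<close>
    show "m j l = m l j" for j l
      unfolding m_def using dot_lmul_matrix[of "g j" P "g l"] sym
      by (metis inner_commute vector_transpose_matrix)
    fix x :: "'d \<Rightarrow> real"
    define \<xi> :: "real^'d" where "\<xi> = (\<chi> j. x j)"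
    have "(\<Sum>j\<in>UNIV. \<Sum>l\<in>UNIV. c j l * x j * x l)
      = (\<Sum>j\<in>UNIV. \<Sum>l\<in>UNIV. Q $ j $ l * x j * x l) - (\<Sum>j\<in>UNIV. \<Sum>l\<in>UNIV. if j = l then \<alpha> * x j * x l else 0)"
      unfolding sum_subtractf[symmetric] by (intro sum.cong refl) (simp add: c_def algebra_simps)
    also have "\<dots> = \<xi> \<bullet> (Q *v \<xi>) - \<alpha> * (norm \<xi>)\<^sup>2"
      by (simp add: \<xi>_def inner_vec_def matrix_vector_mult_def power2_norm_eq_inner sum_distrib_left mult_ac)
    also have "\<dots> \<ge> 0" using Q[of \<xi>] by simp
    finally show "(\<Sum>j\<in>UNIV. \<Sum>l\<in>UNIV. c j l * x j * x l) \<ge> 0" .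
    \<comment> \<open>The form of m at x is the form of P at the combination of the columns g_j with
      weights x j.\<close>
    define v where "v = (\<Sum>j\<in>UNIV. x j *\<^sub>R g j)"
    have "P *v v = (\<Sum>l\<in>UNIV. x l *\<^sub>R (P *v g l))"
      by (simp add: v_def linear_sum[OF matrix_vector_mul_linear] matrix_vector_mult_scaleR)
    then have "v \<bullet> (P *v v) = (\<Sum>j\<in>UNIV. \<Sum>l\<in>UNIV. m j l * x j * x l)"
      unfolding v_def m_def
      by (simp add: inner_sum_left inner_sum_right sum_distrib_left mult_ac) (subst sum.swap, simp add: mult_ac)
    moreover have "v \<bullet> (P *v v) \<ge> 0"
      using P[of v] \<alpha> by (smt (verit) mult_nonneg_nonneg zero_le_power2)
    ultimately show "(\<Sum>j\<in>UNIV. \<Sum>l\<in>UNIV. m j l * x j * x l) \<ge> 0" by simp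
  qed
  moreover have "(\<Sum>j\<in>UNIV. \<Sum>l\<in>UNIV. c j l * m j l)
    = (\<Sum>j\<in>UNIV. \<Sum>l\<in>UNIV. Q $ j $ l * m j l) - (\<Sum>j\<in>UNIV. \<Sum>l\<in>UNIV. if j = l then \<alpha> * m j l else 0)"
    unfolding sum_subtractf[symmetric] by (intro sum.cong refl) (simp add: c_def algebra_simps)
  ultimately have "\<alpha> * (\<Sum>j\<in>UNIV. m j j) \<le> (\<Sum>j\<in>UNIV. \<Sum>l\<in>UNIV. Q $ j $ l * m j l)"
    by (simp add: sum_distrib_left)
  moreover have "\<alpha> * (\<Sum>j\<in>UNIV. \<alpha> * (norm (g j))\<^sup>2) \<le> \<alpha> * (\<Sum>j\<in>UNIV. m j j)"
    using \<alpha> P by (intro mult_left_mono sum_mono) (auto simp: m_def)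
  moreover have "\<alpha> * (\<Sum>j\<in>UNIV. \<alpha> * (norm (g j))\<^sup>2) = \<alpha>\<^sup>2 * (\<Sum>i\<in>UNIV. \<Sum>j\<in>UNIV. (G $ i $ j)\<^sup>2)"
  proof -
    have "(norm (g j))\<^sup>2 = (\<Sum>i\<in>UNIV. (G $ i $ j)\<^sup>2)" for j
      unfolding power2_norm_eq_inner by (simp add: g_def inner_vec_def power2_eq_square)
    then show ?thesis
      by (subst sum.swap) (simp add: sum_distrib_left power2_eq_square[of \<alpha>] mult.assoc)
  qed
  moreover have "(\<Sum>j\<in>UNIV. \<Sum>l\<in>UNIV. Q $ j $ l * m j l)
    = (\<Sum>i\<in>UNIV. \<Sum>j\<in>UNIV. \<Sum>k\<in>UNIV. \<Sum>l\<in>UNIV. P $ i $ k * Q $ j $ l * G $ k $ l * G $ i $ j)"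
  proof -
    have "(\<Sum>j\<in>UNIV. \<Sum>l\<in>UNIV. Q $ j $ l * m j l)
      = (\<Sum>j\<in>UNIV. \<Sum>l\<in>UNIV. \<Sum>i\<in>UNIV. \<Sum>k\<in>UNIV. P $ i $ k * Q $ j $ l * G $ k $ l * G $ i $ j)"
      by (simp add: m_eq sum_distrib_left mult_ac)
    also have "\<dots> = (\<Sum>j\<in>UNIV. \<Sum>i\<in>UNIV. \<Sum>l\<in>UNIV. \<Sum>k\<in>UNIV. P $ i $ k * Q $ j $ l * G $ k $ l * G $ i $ j)"
      by (intro sum.cong refl sum.swap)
    also have "\<dots> = (\<Sum>i\<in>UNIV. \<Sum>j\<in>UNIV. \<Sum>l\<in>UNIV. \<Sum>k\<in>UNIV. P $ i $ k * Q $ j $ l * G $ k $ l * G $ i $ j)"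
      by (rule sum.swap)
    also have "\<dots> = (\<Sum>i\<in>UNIV. \<Sum>j\<in>UNIV. \<Sum>k\<in>UNIV. \<Sum>l\<in>UNIV. P $ i $ k * Q $ j $ l * G $ k $ l * G $ i $ j)"
      by (intro sum.cong refl sum.swap)
    finally show ?thesis .
  qed
  ultimately show ?thesis by linarith
qed

section \<open>The tensor product space\<close>

context bounded_open begin

lemma nrm_M2_diff_eq:
  assumes "\<And>n. f n \<in> sq_int N"
  shows "nrm M2 (\<lambda>z. f m z - f n z) = nrm N (\<lambda>z. f m z - f n z)"
  using sq_int_diff[OF assms[of m] assms[of n]] by (intro nrm_N[symmetric]) auto

lemma is_weak_grad_xyD:
  assumes "is_weak_grad_xy D w G"
  shows "(\<lambda>z. G z $ i $ j) \<in> sq_int M2" "\<phi> \<in> test_functions (D \<times> D) \<Longrightarrow>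
    (\<integral>z. w z * partial_deriv (axis i 1, 0) (partial_deriv (0, axis j 1) \<phi>) z \<partial>M2)
      = (\<integral>z. G z $ i $ j * \<phi> z \<partial>M2)"
  using assms by (simp_all add: is_weak_grad_xy_def L2_eq)

lemma weak_grad_xy_eq:
  assumes G: "is_weak_grad_xy D w G"
  shows "(\<lambda>z. weak_grad_xy D w z $ i $ j) \<in> sq_int M2"
    "AE z in M2. weak_grad_xy D w z $ i $ j = G z $ i $ j"
proof -
  have w: "is_weak_grad_xy D w (weak_grad_xy D w)"
    using someI[of "is_weak_grad_xy D w", OF G] unfolding weak_grad_xy_def .
  show s: "(\<lambda>z. weak_grad_xy D w z $ i $ j) \<in> sq_int M2" by (rule is_weak_grad_xyD(1)[OF w])
  show "AE z in M2. weak_grad_xy D w z $ i $ j = G z $ i $ j"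
  proof (rule sq_int_orthogonal_test_functions[OF DD(1,2) s is_weak_grad_xyD(1)[OF G]])
    fix \<phi> assume "\<phi> \<in> test_functions (D \<times> D)"
    from is_weak_grad_xyD(2)[OF w this, of i j] is_weak_grad_xyD(2)[OF G this, of i j]
    show "(\<integral>z. weak_grad_xy D w z $ i $ j * \<phi> z \<partial>M2) = (\<integral>z. G z $ i $ j * \<phi> z \<partial>M2)" by simp
  qed
qed

text \<open>Completeness provides L2 limits of the mixed gradients of the tensors. Passing to the
  limit in the integration by parts shows that these limits form a mixed weak gradient of w, and
  uniqueness identifies them with the chosen one.\<close>

lemma weak_grad_xy_tensor_limit:
  assumes wsq: "w \<in> sq_int M2" and T: "\<And>n. set (T n) \<subseteq> H10 D \<times> H10 D"
    and cauchy: "\<And>\<epsilon>. \<epsilon> > 0 \<Longrightarrow> \<exists>K. \<forall>m\<ge>K. \<forall>n\<ge>K. tensor_norm (H1_inner D) (tensor_diff (T m) (T n)) < \<epsilon>"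
    and lim: "(\<lambda>n. nrm M2 (\<lambda>z. tensor_fun (T n) z - w z)) \<longlonglongrightarrow> 0"
  shows "(\<lambda>n. nrm M2 (\<lambda>z. tensor_jet D (Some i) (Some j) (T n) z - weak_grad_xy D w z $ i $ j)) \<longlonglongrightarrow> 0"
    "(\<lambda>z. weak_grad_xy D w z $ i $ j) \<in> sq_int M2"
proof -
  have T1: "set (T n) \<subseteq> H1 D \<times> H1 D" for n using T[of n] H10_H1 by auto
  have sqN: "tensor_jet D e e' (T n) \<in> sq_int N" for n e e' by (rule tensor_jet_sq_int[OF T1])
  have sq: "tensor_jet D e e' (T n) \<in> sq_int M2" for n e e' by (rule sq_int_N[OF sqN])
  have "\<exists>g. g \<in> sq_int M2 \<and> (\<lambda>n. nrm M2 (\<lambda>z. tensor_jet D (Some i) (Some j) (T n) z - g z)) \<longlonglongrightarrow> 0" for i j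
  proof -
    have "\<exists>g\<in>sq_int M2. (\<lambda>n. nrm M2 (\<lambda>z. tensor_jet D (Some i) (Some j) (T n) z - g z)) \<longlonglongrightarrow> 0"
    proof (rule M2.nrm_complete[OF sq])
      fix \<epsilon> :: real assume "\<epsilon> > 0"
      from cauchy[OF this] obtain K where K:
        "\<And>m n. m \<ge> K \<Longrightarrow> n \<ge> K \<Longrightarrow> tensor_norm (H1_inner D) (tensor_diff (T m) (T n)) < \<epsilon>" by blast
      have "nrm M2 (\<lambda>z. tensor_jet D (Some i) (Some j) (T m) z - tensor_jet D (Some i) (Some j) (T n) z) < \<epsilon>"
        if "m \<ge> K" "n \<ge> K" for m n
        unfolding nrm_M2_diff_eq[of "\<lambda>n. tensor_jet D (Some i) (Some j) (T n)", OF sqN]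
        using nrm_tensor_jet_diff_le[OF T1 T1] K[OF that] by (rule order_le_less_trans)
      then show "\<exists>K. \<forall>m\<ge>K. \<forall>n\<ge>K. nrm M2 (\<lambda>z. tensor_jet D (Some i) (Some j) (T m) z
          - tensor_jet D (Some i) (Some j) (T n) z) < \<epsilon>" by blast
    qed
    then show ?thesis by blast
  qed
  then have "\<forall>i j. \<exists>g. g \<in> sq_int M2 \<and> (\<lambda>n. nrm M2 (\<lambda>z. tensor_jet D (Some i) (Some j) (T n) z - g z)) \<longlonglongrightarrow> 0"
    by blast
  then obtain g where "\<forall>i j. g i j \<in> sq_int M2
      \<and> (\<lambda>n. nrm M2 (\<lambda>z. tensor_jet D (Some i) (Some j) (T n) z - g i j z)) \<longlonglongrightarrow> 0"
    unfolding choice_iff by blast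
  then have g: "\<And>i j. g i j \<in> sq_int M2"
    "\<And>i j. (\<lambda>n. nrm M2 (\<lambda>z. tensor_jet D (Some i) (Some j) (T n) z - g i j z)) \<longlonglongrightarrow> 0"
    by blast+
  have G: "is_weak_grad_xy D w (\<lambda>z. \<chi> i j. g i j z)"
    unfolding is_weak_grad_xy_def L2_eq
  proof (intro allI conjI ballI)
    fix i j
    show "(\<lambda>z. (\<chi> i j. g i j z) $ i $ j) \<in> sq_int M2" using g(1) by simp
    fix \<phi> assume \<phi>: "\<phi> \<in> test_functions (D \<times> D)"
    let ?d = "partial_deriv (axis i 1, 0) (partial_deriv (0, axis j 1) \<phi>)"
    have d: "?d \<in> test_functions (D \<times> D)"
      by (intro test_fun_partial_deriv[OF test_fun_partial_deriv[OF \<phi>]] axis_Pair_in_Basis)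
    note sd = test_fun_sq_int[OF DD(1,2) d] and s\<phi> = test_fun_sq_int[OF DD(1,2) \<phi>]
    have 1: "(\<lambda>n. \<integral>z. tensor_fun (T n) z * ?d z \<partial>M2) \<longlonglongrightarrow> (\<integral>z. w z * ?d z \<partial>M2)"
      by (rule sq_int_product_tendsto[OF sq[of None None, unfolded tensor_jet_None] wsq sd sd lim]) (simp add: nrm_def)
    have 2: "(\<lambda>n. \<integral>z. tensor_jet D (Some i) (Some j) (T n) z * \<phi> z \<partial>M2) \<longlonglongrightarrow> (\<integral>z. g i j z * \<phi> z \<partial>M2)"
      by (rule sq_int_product_tendsto[OF sq g(1) s\<phi> s\<phi> g(2)]) (simp add: nrm_def)
    have "(\<integral>z. tensor_fun (T n) z * ?d z \<partial>M2) = (\<integral>z. tensor_jet D (Some i) (Some j) (T n) z * \<phi> z \<partial>M2)" for n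
    proof -
      have m: "?d \<in> borel_measurable N" "\<phi> \<in> borel_measurable N"
        by (intro borel_measurable_N test_funD(4)[OF d] test_funD(4)[OF \<phi>])+
      have "(\<integral>z. tensor_fun (T n) z * ?d z \<partial>M2) = (\<integral>z. tensor_fun (T n) z * ?d z \<partial>N)"
        using sq_intD(1)[OF sqN[of None None n]] m
        by (intro integral_N[symmetric] borel_measurable_times) (auto simp: tensor_jet_None)
      also have "\<dots> = (\<integral>z. tensor_jet D (Some i) (Some j) (T n) z * \<phi> z \<partial>N)"
        by (rule tensor_weak_grad_xy[OF T1 \<phi>])
      also have "\<dots> = (\<integral>z. tensor_jet D (Some i) (Some j) (T n) z * \<phi> z \<partial>M2)"
        using sq_intD(1)[OF sqN[of "Some i" "Some j" n]] m by (intro integral_N borel_measurable_times)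
      finally show ?thesis .
    qed
    then show "(\<integral>z. w z * ?d z \<partial>M2) = (\<integral>z. (\<chi> i j. g i j z) $ i $ j * \<phi> z \<partial>M2)"
      using LIMSEQ_unique[OF 1] 2 by simp
  qed
  show W: "(\<lambda>z. weak_grad_xy D w z $ i $ j) \<in> sq_int M2"
    by (rule weak_grad_xy_eq(1)[OF G])
  show "(\<lambda>n. nrm M2 (\<lambda>z. tensor_jet D (Some i) (Some j) (T n) z - weak_grad_xy D w z $ i $ j)) \<longlonglongrightarrow> 0"
  proof -
    have "nrm M2 (\<lambda>z. tensor_jet D (Some i) (Some j) (T n) z - weak_grad_xy D w z $ i $ j)
        = nrm M2 (\<lambda>z. tensor_jet D (Some i) (Some j) (T n) z - g i j z)" for n
    proof (rule nrm_cong_AE)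
      show "AE z in M2. tensor_jet D (Some i) (Some j) (T n) z - weak_grad_xy D w z $ i $ j
          = tensor_jet D (Some i) (Some j) (T n) z - g i j z"
        using weak_grad_xy_eq(2)[OF G, of i j] by eventually_elim simp
    qed (rule sq_intD(1)[OF sq_int_diff[OF sq W]], rule sq_intD(1)[OF sq_int_diff[OF sq g(1)]])
    then show ?thesis using g(2) by simp
  qed
qed

text \<open>Density in usable form: a single sequence of algebraic tensors approximates both the
  function and its chosen mixed gradient.\<close>

lemma H11_approximation:
  assumes w: "w \<in> H11 D"
  obtains T where "\<And>n. set (T n) \<subseteq> H10 D \<times> H10 D"
    "(\<lambda>n. nrm M2 (\<lambda>z. tensor_fun (T n) z - w z)) \<longlonglongrightarrow> 0"
    "\<And>i j. (\<lambda>n. nrm M2 (\<lambda>z. tensor_jet D (Some i) (Some j) (T n) z - weak_grad_xy D w z $ i $ j)) \<longlonglongrightarrow> 0"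
    "\<And>i j. (\<lambda>z. weak_grad_xy D w z $ i $ j) \<in> sq_int M2"
proof -
  obtain T where T: "\<And>n. set (T n) \<subseteq> H10 D \<times> H10 D"
    and cauchy: "\<And>\<epsilon>. \<epsilon> > 0 \<Longrightarrow> \<exists>K. \<forall>m\<ge>K. \<forall>n\<ge>K. tensor_norm (H1_inner D) (tensor_diff (T m) (T n)) < \<epsilon>"
    and lim: "(\<lambda>n. nrm M2 (\<lambda>z. tensor_fun (T n) z - w z)) \<longlonglongrightarrow> 0"
    using w by (auto simp: H11_def L2_norm_eq)
  have "w \<in> sq_int M2" using w by (simp add: H11_def L2_eq)
  note L = weak_grad_xy_tensor_limit[OF this T cauchy lim]
  show ?thesis by (rule that[OF T lim L])
qed

end

section \<open>The coefficient and the form Q on arrays of square integrable functions\<close>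

locale elliptic = bounded_open D for D :: "(real^'d) set" +
  fixes A :: "real^'d \<Rightarrow> real^'d^'d" and K \<alpha> :: real
  assumes A_measurable: "A \<in> borel_measurable M"
    and A_bounded: "AE x in M. norm (A x) \<le> K"
    and A_symmetric: "AE x in M. transpose (A x) = A x"
    and \<alpha>_pos: "\<alpha> > 0"
    and A_elliptic: "AE x in M. \<forall>\<xi>. \<alpha> * (norm \<xi>)\<^sup>2 \<le> \<xi> \<bullet> (A x *v \<xi>)"
begin

lemma A_entry:
  "(\<lambda>x. A x $ i $ k) \<in> borel_measurable M" "AE x in M. \<bar>A x $ i $ k\<bar> \<le> K"
proof -
  show "(\<lambda>x. A x $ i $ k) \<in> borel_measurable M"
    by (intro measurable_compose[OF A_measurable] borel_measurable_continuous_onI continuous_intros)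
  have "\<bar>A x $ i $ k\<bar> \<le> norm (A x)" for x
    using component_le_norm_cart[of "A x $ i" k] Finite_Cartesian_Product.norm_nth_le[of "A x" i] by linarith
  then show "AE x in M. \<bar>A x $ i $ k\<bar> \<le> K"
    using A_bounded by (auto elim!: eventually_mono intro: order_trans)
qed

definition coef :: "'d \<Rightarrow> 'd \<Rightarrow> 'd \<Rightarrow> 'd \<Rightarrow> (real^'d) \<times> (real^'d) \<Rightarrow> real" where
  "coef i j k l z = A (fst z) $ i $ k * A (snd z) $ j $ l"

lemma coef_measurable: "coef i j k l \<in> borel_measurable N"
  unfolding coef_def[abs_def]
  by (intro borel_measurable_times measurable_compose[OF measurable_fst A_entry(1)]
      measurable_compose[OF measurable_snd A_entry(1)])

lemma coef_bounded: "AE z in N. \<bar>coef i j k l z\<bar> \<le> K\<^sup>2"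
  using AE_fst[OF A_entry(2)[of i k]] AE_snd[OF A_entry(2)[of j l]]
proof eventually_elim
  case (elim z)
  then show ?case unfolding coef_def abs_mult power2_eq_square by (intro mult_mono) auto
qed

text \<open>Q as a form on arbitrary arrays, independent of any choice of weak gradient. The sums
  stand outside the integral so that limits and bilinearity can be handled term by term.\<close>

definition Q_grad where
  "Q_grad G H = (\<Sum>i\<in>UNIV. \<Sum>j\<in>UNIV. \<Sum>k\<in>UNIV. \<Sum>l\<in>UNIV. \<integral>z. coef i j k l z * G k l z * H i j z \<partial>M2)"

lemma coef_mult_sq_int:
  assumes "g \<in> sq_int M2"
  shows "(\<lambda>z. coef i j k l z * g z) \<in> sq_int M2"
    "nrm M2 (\<lambda>z. coef i j k l z * g z) \<le> K\<^sup>2 * nrm M2 g"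
  using sq_int_bounded_mult[OF assms measurable_N_M2[OF coef_measurable] AE_N[OF coef_bounded]] by simp_all

lemma Q_grad_integrable:
  assumes "\<And>k l. G k l \<in> sq_int M2" "\<And>i j. H i j \<in> sq_int M2"
  shows "integrable M2 (\<lambda>z. coef i j k l z * G k l z * H i j z)"
  by (intro sq_int_mult_integrable coef_mult_sq_int assms)

lemma Q_grad_integral:
  assumes "\<And>k l. G k l \<in> sq_int M2" "\<And>i j. H i j \<in> sq_int M2"
  shows "Q_grad G H = (\<integral>z. (\<Sum>i\<in>UNIV. \<Sum>j\<in>UNIV. \<Sum>k\<in>UNIV. \<Sum>l\<in>UNIV. coef i j k l z * G k l z * H i j z) \<partial>M2)"
  unfolding Q_grad_def
  by (simp add: Q_grad_integrable[of G H, OF assms])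

lemma Q_form_eq_Q_grad:
  assumes "w \<in> H11 D" "z \<in> H11 D"
  shows "Q_form D A w z = Q_grad (\<lambda>k l x. weak_grad_xy D w x $ k $ l) (\<lambda>i j x. weak_grad_xy D z x $ i $ j)"
proof -
  have "(\<lambda>x. weak_grad_xy D w x $ i $ j) \<in> sq_int M2" "(\<lambda>x. weak_grad_xy D z x $ i $ j) \<in> sq_int M2" for i j
    using assms by (blast elim: H11_approximation)+
  from Q_grad_integral[of "\<lambda>k l x. weak_grad_xy D w x $ k $ l" "\<lambda>i j x. weak_grad_xy D z x $ i $ j", OF this]
  show ?thesis by (simp add: Q_form_def coef_def case_prod_beta')
qed

lemma Q_grad_tendsto:
  assumes G: "\<And>n k l. G n k l \<in> sq_int M2" "\<And>k l. G' k l \<in> sq_int M2"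
    and H: "\<And>n i j. H n i j \<in> sq_int M2" "\<And>i j. H' i j \<in> sq_int M2"
    and lG: "\<And>k l. (\<lambda>n. nrm M2 (\<lambda>z. G n k l z - G' k l z)) \<longlonglongrightarrow> 0"
    and lH: "\<And>i j. (\<lambda>n. nrm M2 (\<lambda>z. H n i j z - H' i j z)) \<longlonglongrightarrow> 0"
  shows "(\<lambda>n. Q_grad (G n) (H n)) \<longlonglongrightarrow> Q_grad G' H'"
  unfolding Q_grad_def
proof (intro tendsto_sum sq_int_product_tendsto coef_mult_sq_int G H lH)
  fix i j k l
  have lim: "(\<lambda>n. K\<^sup>2 * nrm M2 (\<lambda>z. G n k l z - G' k l z)) \<longlonglongrightarrow> K\<^sup>2 * 0"
    by (intro tendsto_mult tendsto_const lG)
  have bd: "norm (nrm M2 (\<lambda>z. coef i j k l z * G n k l z - coef i j k l z * G' k l z))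
      \<le> K\<^sup>2 * nrm M2 (\<lambda>z. G n k l z - G' k l z)" for n
  proof -
    have "nrm M2 (\<lambda>z. coef i j k l z * (G n k l z - G' k l z)) \<le> K\<^sup>2 * nrm M2 (\<lambda>z. G n k l z - G' k l z)"
      by (rule coef_mult_sq_int(2)[OF sq_int_diff[OF G(1) G(2)]])
    then show ?thesis by (simp add: right_diff_distrib)
  qed
  show "(\<lambda>n. nrm M2 (\<lambda>z. coef i j k l z * G n k l z - coef i j k l z * G' k l z)) \<longlonglongrightarrow> 0"
    by (rule Lim_null_comparison[OF always_eventually[OF allI[OF bd]]]) (use lim in simp)
qed

lemma Q_grad_diff:
  assumes G: "\<And>k l. G k l \<in> sq_int M2" and G': "\<And>k l. G' k l \<in> sq_int M2"
  shows "Q_grad (\<lambda>k l z. G k l z - G' k l z) (\<lambda>k l z. G k l z - G' k l z)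
    = Q_grad G G - Q_grad G' G - Q_grad G G' + Q_grad G' G'"
proof -
  have "Q_grad (\<lambda>k l z. G k l z - G' k l z) (\<lambda>k l z. G k l z - G' k l z)
    = (\<Sum>i\<in>UNIV. \<Sum>j\<in>UNIV. \<Sum>k\<in>UNIV. \<Sum>l\<in>UNIV.
        (\<integral>z. coef i j k l z * G k l z * G i j z \<partial>M2) - (\<integral>z. coef i j k l z * G' k l z * G i j z \<partial>M2)
        - (\<integral>z. coef i j k l z * G k l z * G' i j z \<partial>M2) + (\<integral>z. coef i j k l z * G' k l z * G' i j z \<partial>M2))"
    unfolding Q_grad_def
  proof (intro sum.cong refl)
    fix i j k l
    have "(\<integral>z. coef i j k l z * (G k l z - G' k l z) * (G i j z - G' i j z) \<partial>M2)
      = (\<integral>z. coef i j k l z * G k l z * G i j z - coef i j k l z * G' k l z * G i j z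
        - coef i j k l z * G k l z * G' i j z + coef i j k l z * G' k l z * G' i j z \<partial>M2)"
      by (intro Bochner_Integration.integral_cong refl) (simp add: algebra_simps)
    then show "(\<integral>z. coef i j k l z * (G k l z - G' k l z) * (G i j z - G' i j z) \<partial>M2)
      = (\<integral>z. coef i j k l z * G k l z * G i j z \<partial>M2) - (\<integral>z. coef i j k l z * G' k l z * G i j z \<partial>M2)
        - (\<integral>z. coef i j k l z * G k l z * G' i j z \<partial>M2) + (\<integral>z. coef i j k l z * G' k l z * G' i j z \<partial>M2)"
      by (simp add: Q_grad_integrable[of G G, OF G G] Q_grad_integrable[of G G', OF G G']
          Q_grad_integrable[of G' G, OF G' G] Q_grad_integrable[of G' G', OF G' G'])
  qed
  then show ?thesis unfolding Q_grad_def by (simp add: sum.distrib sum_subtractf)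
qed

lemma Q_grad_coercive:
  assumes G: "\<And>k l. G k l \<in> sq_int M2"
  shows "\<alpha>\<^sup>2 * (\<Sum>i\<in>UNIV. \<Sum>j\<in>UNIV. (nrm M2 (G i j))\<^sup>2) \<le> Q_grad G G"
proof -
  have i: "integrable M2 (\<lambda>z. (G i j z)\<^sup>2)" for i j using G[of i j] by auto
  have "\<alpha>\<^sup>2 * (\<Sum>i\<in>UNIV. \<Sum>j\<in>UNIV. (nrm M2 (G i j))\<^sup>2)
      = (\<integral>z. \<alpha>\<^sup>2 * (\<Sum>i\<in>UNIV. \<Sum>j\<in>UNIV. (G i j z)\<^sup>2) \<partial>M2)"
    using i by (simp add: nrm_power2)
  also have "\<dots> \<le> (\<integral>z. (\<Sum>i\<in>UNIV. \<Sum>j\<in>UNIV. \<Sum>k\<in>UNIV. \<Sum>l\<in>UNIV. coef i j k l z * G k l z * G i j z) \<partial>M2)"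
  proof (rule integral_mono_AE)
    show "integrable M2 (\<lambda>z. \<alpha>\<^sup>2 * (\<Sum>i\<in>UNIV. \<Sum>j\<in>UNIV. (G i j z)\<^sup>2))"
      using i by (intro integrable_mult_right Bochner_Integration.integrable_sum)
    show "integrable M2 (\<lambda>z. \<Sum>i\<in>UNIV. \<Sum>j\<in>UNIV. \<Sum>k\<in>UNIV. \<Sum>l\<in>UNIV. coef i j k l z * G k l z * G i j z)"
      by (intro Bochner_Integration.integrable_sum Q_grad_integrable[of G G, OF G G])
    show "AE z in M2. \<alpha>\<^sup>2 * (\<Sum>i\<in>UNIV. \<Sum>j\<in>UNIV. (G i j z)\<^sup>2)
        \<le> (\<Sum>i\<in>UNIV. \<Sum>j\<in>UNIV. \<Sum>k\<in>UNIV. \<Sum>l\<in>UNIV. coef i j k l z * G k l z * G i j z)"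
      using AE_N[OF AE_fst[OF A_symmetric]] AE_N[OF AE_fst[OF A_elliptic]] AE_N[OF AE_snd[OF A_elliptic]]
    proof eventually_elim
      case (elim z)
      then show ?case
        using tensor_elliptic[of "A (fst z)" \<alpha> "A (snd z)" "\<chi> i j. G i j z"] \<alpha>_pos
        by (simp add: coef_def)
    qed
  qed
  also have "\<dots> = Q_grad G G" by (rule Q_grad_integral[OF G G, symmetric])
  finally show ?thesis .
qed

text \<open>Coercivity annihilates the difference of the two mixed gradients. To return to the
  functions, the Poincare inequality is applied to the tensors T n - T' n approximating the
  difference: their mixed gradients tend to 0, so T n and T' n have the same L2 limit.\<close>

lemma deterministic_solution_unique:
  assumes C: "deterministic_solution D A g C" and C': "deterministic_solution D A g C'"
  shows "AE z in M2. C z = C' z"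
proof -
  have H: "C \<in> H11 D" "C' \<in> H11 D" using C C' by (auto simp: deterministic_solution_def)
  obtain T where T: "\<And>n. set (T n) \<subseteq> H10 D \<times> H10 D"
    "(\<lambda>n. nrm M2 (\<lambda>z. tensor_fun (T n) z - C z)) \<longlonglongrightarrow> 0"
    "\<And>i j. (\<lambda>n. nrm M2 (\<lambda>z. tensor_jet D (Some i) (Some j) (T n) z - weak_grad_xy D C z $ i $ j)) \<longlonglongrightarrow> 0"
    "\<And>i j. (\<lambda>z. weak_grad_xy D C z $ i $ j) \<in> sq_int M2"
    using H11_approximation[OF H(1)] by blast
  obtain T' where T': "\<And>n. set (T' n) \<subseteq> H10 D \<times> H10 D"
    "(\<lambda>n. nrm M2 (\<lambda>z. tensor_fun (T' n) z - C' z)) \<longlonglongrightarrow> 0"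
    "\<And>i j. (\<lambda>n. nrm M2 (\<lambda>z. tensor_jet D (Some i) (Some j) (T' n) z - weak_grad_xy D C' z $ i $ j)) \<longlonglongrightarrow> 0"
    "\<And>i j. (\<lambda>z. weak_grad_xy D C' z $ i $ j) \<in> sq_int M2"
    using H11_approximation[OF H(2)] by blast
  define G where "G i j z = weak_grad_xy D C z $ i $ j" for i j z
  define G' where "G' i j z = weak_grad_xy D C' z $ i $ j" for i j z
  have Gs: "G i j \<in> sq_int M2" "G' i j \<in> sq_int M2" for i j
    unfolding G_def[abs_def] G'_def[abs_def] using T(4) T'(4) by auto
  have eq: "Q_form D A C Z = Q_form D A C' Z" if "Z \<in> H11 D" for Z
    using C C' that by (simp add: deterministic_solution_def)
  \<comment> \<open>Both solutions serve as test functions, which makes the four terms of Q at the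
    difference cancel in pairs.\<close>
  have "Q_grad G G = Q_grad G' G" "Q_grad G G' = Q_grad G' G'"
    using eq[OF H(1)] eq[OF H(2)] unfolding Q_form_eq_Q_grad[OF H(1) H(1)] Q_form_eq_Q_grad[OF H(2) H(1)]
      Q_form_eq_Q_grad[OF H(1) H(2)] Q_form_eq_Q_grad[OF H(2) H(2)] G_def[abs_def] G'_def[abs_def] by auto
  then have "Q_grad (\<lambda>k l z. G k l z - G' k l z) (\<lambda>k l z. G k l z - G' k l z) = 0"
    unfolding Q_grad_diff[OF Gs(1) Gs(2)] by simp
  then have "\<alpha>\<^sup>2 * (\<Sum>i\<in>UNIV. \<Sum>j\<in>UNIV. (nrm M2 (\<lambda>z. G i j z - G' i j z))\<^sup>2) \<le> 0"
    using Q_grad_coercive[of "\<lambda>k l z. G k l z - G' k l z", OF sq_int_diff[OF Gs(1) Gs(2)]] by simp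
  then have "(\<Sum>i\<in>UNIV. \<Sum>j\<in>UNIV. (nrm M2 (\<lambda>z. G i j z - G' i j z))\<^sup>2) \<le> 0"
    using \<alpha>_pos by (simp add: mult_le_0_iff)
  then have "(\<Sum>i\<in>UNIV. \<Sum>j\<in>UNIV. (nrm M2 (\<lambda>z. G i j z - G' i j z))\<^sup>2) = 0"
    by (intro order.antisym sum_nonneg) auto
  then have zero: "nrm M2 (\<lambda>z. G i j z - G' i j z) = 0" for i j
    by (simp add: sum_nonneg_eq_0_iff sum_nonneg)
  obtain c where c: "c \<ge> 0" "\<And>u i. u \<in> H10 D \<Longrightarrow> nrm M u \<le> c * nrm M (jet D (Some i) u)"
    using poincare by blast
  \<comment> \<open>One derivative in x_i and one in y_i, in any single direction i, already control
    the function.\<close>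
  fix i :: 'd
  let ?t = "\<lambda>n. tensor_diff (T n) (T' n)"
  have T1: "set (T n) \<subseteq> H1 D \<times> H1 D" "set (T' n) \<subseteq> H1 D \<times> H1 D" for n
    using T(1)[of n] T'(1)[of n] H10_H1 by auto
  have t: "set (?t n) \<subseteq> H10 D \<times> H10 D" for n
    using T(1)[of n] T'(1)[of n] H10_cmult[of _ "-1"] by (fastforce simp: tensor_diff_def)
  note sq = tensor_jet_sq_int[OF T1(1)] tensor_jet_sq_int[OF T1(2)]
  have tn: "nrm N (tensor_jet D e e' (?t n)) = nrm M2 (\<lambda>z. tensor_jet D e e' (T n) z - tensor_jet D e e' (T' n) z)" for e e' n
  proof -
    have "nrm N (tensor_jet D e e' (?t n)) = nrm N (\<lambda>z. tensor_jet D e e' (T n) z - tensor_jet D e e' (T' n) z)"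
      using tensor_jet_diff_AE[OF T1(1) T1(2)] tensor_jet_sq_int[OF tensor_diff_H1[OF T1(1) T1(2)]]
        sq_int_diff[OF sq(1) sq(2)]
      by (intro nrm_cong_AE) (blast dest: sq_intD(1))+
    also have "\<dots> = nrm M2 (\<lambda>z. tensor_jet D e e' (T n) z - tensor_jet D e e' (T' n) z)"
      using sq_int_diff[OF sq(1) sq(2)] by (intro nrm_N) (blast dest: sq_intD(1))
    finally show ?thesis .
  qed
  note sq2 = sq_int_N[OF sq(1)] sq_int_N[OF sq(2)]
  have b: "nrm M2 (\<lambda>z. tensor_jet D (Some i) (Some i) (T n) z - tensor_jet D (Some i) (Some i) (T' n) z)
     \<le> nrm M2 (\<lambda>z. tensor_jet D (Some i) (Some i) (T n) z - G i i z)
      + nrm M2 (\<lambda>z. tensor_jet D (Some i) (Some i) (T' n) z - G' i i z)" for n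
  proof -
    let ?a = "tensor_jet D (Some i) (Some i) (T n)" and ?b = "tensor_jet D (Some i) (Some i) (T' n)"
    have "nrm M2 (\<lambda>z. ?a z - ?b z) \<le> nrm M2 (\<lambda>z. ?a z - G i i z) + nrm M2 (\<lambda>z. G i i z - ?b z)"
      by (rule nrm_triangle_diff[OF sq2(1) Gs(1) sq2(2)])
    moreover have "nrm M2 (\<lambda>z. G i i z - ?b z) \<le> nrm M2 (\<lambda>z. G i i z - G' i i z) + nrm M2 (\<lambda>z. G' i i z - ?b z)"
      by (rule nrm_triangle_diff[OF Gs(1) Gs(2) sq2(2)])
    ultimately show ?thesis
      using zero[of i i] nrm_minus_commute[of M2 "G' i i" ?b] by linarith
  qed
  have f: "nrm M2 (\<lambda>z. tensor_fun (T n) z - tensor_fun (T' n) z)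
      \<le> c\<^sup>2 * (nrm M2 (\<lambda>z. tensor_jet D (Some i) (Some i) (T n) z - G i i z)
      + nrm M2 (\<lambda>z. tensor_jet D (Some i) (Some i) (T' n) z - G' i i z))" for n
  proof -
    have "nrm N (tensor_fun (?t n)) \<le> c\<^sup>2 * nrm N (tensor_jet D (Some i) (Some i) (?t n))"
      by (rule tensor_poincare[OF c(1) c(2) t])
    also have "\<dots> \<le> c\<^sup>2 * (nrm M2 (\<lambda>z. tensor_jet D (Some i) (Some i) (T n) z - G i i z)
      + nrm M2 (\<lambda>z. tensor_jet D (Some i) (Some i) (T' n) z - G' i i z))"
      unfolding tn by (rule mult_left_mono[OF b]) simp
    finally show ?thesis using tn[of None None n] unfolding tensor_jet_None by simp
  qed
  have fs: "tensor_fun (T n) \<in> sq_int M2" "tensor_fun (T' n) \<in> sq_int M2" for n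
    by (rule sq2(1)[of None None, unfolded tensor_jet_None], rule sq2(2)[of None None, unfolded tensor_jet_None])
  have Cs: "C \<in> sq_int M2" "C' \<in> sq_int M2" using H by (simp_all add: H11_def L2_eq)
  have lim: "(\<lambda>n. c\<^sup>2 * (nrm M2 (\<lambda>z. tensor_jet D (Some i) (Some i) (T n) z - G i i z)
      + nrm M2 (\<lambda>z. tensor_jet D (Some i) (Some i) (T' n) z - G' i i z))
      + nrm M2 (\<lambda>z. tensor_fun (T' n) z - C' z)) \<longlonglongrightarrow> c\<^sup>2 * (0 + 0) + 0"
    unfolding G_def G'_def by (intro tendsto_intros T T')
  have bd: "norm (nrm M2 (\<lambda>z. tensor_fun (T n) z - C' z)) \<le>
      c\<^sup>2 * (nrm M2 (\<lambda>z. tensor_jet D (Some i) (Some i) (T n) z - G i i z)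
      + nrm M2 (\<lambda>z. tensor_jet D (Some i) (Some i) (T' n) z - G' i i z))
      + nrm M2 (\<lambda>z. tensor_fun (T' n) z - C' z)" for n
  proof -
    have "nrm M2 (\<lambda>z. tensor_fun (T n) z - C' z)
      \<le> nrm M2 (\<lambda>z. tensor_fun (T n) z - tensor_fun (T' n) z) + nrm M2 (\<lambda>z. tensor_fun (T' n) z - C' z)"
      by (rule nrm_triangle_diff[OF fs(1) fs(2) Cs(2)])
    then show ?thesis using f[of n] by simp
  qed
  have "(\<lambda>n. nrm M2 (\<lambda>z. tensor_fun (T n) z - C' z)) \<longlonglongrightarrow> 0"
    by (rule Lim_null_comparison[OF always_eventually[OF allI[OF bd]]]) (use lim in simp)
  from sq_int_limit_unique[OF fs(1) Cs T(2) this] show ?thesis .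
qed

end

section \<open>Correlation functions of random fields\<close>

text \<open>The bilinear form whose diagonal is \<open>correlation\<close>. It allows differences of
  correlations to be split, and with different jets in its two slots it yields the derivatives of
  the correlation of a simple field.\<close>

definition cross :: "'w measure \<Rightarrow> ('w \<Rightarrow> 'a \<Rightarrow> real) \<Rightarrow> ('w \<Rightarrow> 'a \<Rightarrow> real) \<Rightarrow> 'a \<times> 'a \<Rightarrow> real" where
  "cross P u v z = (\<integral>\<omega>. u \<omega> (fst z) * v \<omega> (snd z) \<partial>P)"

lemma correlation_eq_cross: "correlation P u = cross P u u"
  by (simp add: correlation_def cross_def fun_eq_iff)

text \<open>Here s takes values in a space of functions on which h is an arbitrary functional;
  finiteness of the range takes the place of measurability of h.\<close>

lemma integral_simple_compose:
  fixes h :: "'b \<Rightarrow> real"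
  assumes P: "prob_space P" and s: "simple_function P s"
  shows "(\<integral>\<omega>. h (s \<omega>) \<partial>P) = (\<Sum>v\<in>s ` space P. measure P (s -` {v} \<inter> space P) * h v)"
proof -
  interpret prob_space P by fact
  have fin: "finite (s ` space P)" and set: "s -` {v} \<inter> space P \<in> sets P" for v
    using simple_functionD[OF s] by auto
  have "(\<integral>\<omega>. h (s \<omega>) \<partial>P) = (\<integral>\<omega>. (\<Sum>v\<in>s ` space P. indicator (s -` {v} \<inter> space P) \<omega> * h v) \<partial>P)"
  proof (rule Bochner_Integration.integral_cong[OF refl])
    fix \<omega> assume \<omega>: "\<omega> \<in> space P"
    have "(\<Sum>v\<in>s ` space P. indicator (s -` {v} \<inter> space P) \<omega> * h v) = (\<Sum>v\<in>s ` space P. if v = s \<omega> then h v else 0)"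
      using \<omega> by (intro sum.cong) (auto simp: indicator_def)
    then show "h (s \<omega>) = (\<Sum>v\<in>s ` space P. indicator (s -` {v} \<inter> space P) \<omega> * h v)"
      using \<omega> fin by simp
  qed
  also have "\<dots> = (\<Sum>v\<in>s ` space P. \<integral>\<omega>. indicator (s -` {v} \<inter> space P) \<omega> * h v \<partial>P)"
    using set by (intro Bochner_Integration.integral_sum integrable_mult_left integrable_real_indicator)
      (auto simp: less_top[symmetric])
  also have "\<dots> = (\<Sum>v\<in>s ` space P. measure P (s -` {v} \<inter> space P) * h v)"
    using set by (intro sum.cong) auto
  finally show ?thesis .
qed

locale random_domain = bounded_open D + P: prob_space P for D :: "(real^'d) set" and P :: "'w measure"
begin

abbreviation "PM \<equiv> P \<Otimes>\<^sub>M M"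

sublocale PM: pair_sigma_finite P M ..

lemma cross_measurable:
  assumes "case_prod u \<in> borel_measurable PM" "case_prod v \<in> borel_measurable PM"
  shows "cross P u v \<in> borel_measurable N"
proof -
  have "(\<lambda>p. u (snd p) (fst (fst p)) * v (snd p) (snd (fst p))) \<in> borel_measurable (N \<Otimes>\<^sub>M P)"
  proof (intro borel_measurable_times)
    have "(\<lambda>p. (snd p, fst (fst p))) \<in> measurable (N \<Otimes>\<^sub>M P) PM" by measurable
    from measurable_compose[OF this assms(1)]
    show "(\<lambda>p. u (snd p) (fst (fst p))) \<in> borel_measurable (N \<Otimes>\<^sub>M P)" by simp
    have "(\<lambda>p. (snd p, snd (fst p))) \<in> measurable (N \<Otimes>\<^sub>M P) PM" by measurable
    from measurable_compose[OF this assms(2)]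
    show "(\<lambda>p. v (snd p) (snd (fst p))) \<in> borel_measurable (N \<Otimes>\<^sub>M P)" by simp
  qed
  then have "(\<lambda>z. \<integral>\<omega>. u \<omega> (fst z) * v \<omega> (snd z) \<partial>P) \<in> borel_measurable N"
    by (intro P.borel_measurable_lebesgue_integral) (simp add: case_prod_beta')
  then show ?thesis by (simp add: cross_def[abs_def])
qed

text \<open>Cauchy-Schwarz in \<omega> bounds the square at (x, y) by a product of second moments at
  x and at y, and Tonelli integrates this to a product of squared norms. Nonnegative integrals are
  used because single sections may have infinite second moment.\<close>

lemma cross_sq_int:
  assumes u: "case_prod u \<in> sq_int PM" and v: "case_prod v \<in> sq_int PM"
  shows "cross P u v \<in> sq_int N" "nrm N (cross P u v) \<le> nrm PM (case_prod u) * nrm PM (case_prod v)"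
proof -
  have um: "case_prod u \<in> borel_measurable PM" and vm: "case_prod v \<in> borel_measurable PM"
    using u v by auto
  have cm: "cross P u v \<in> borel_measurable N" by (rule cross_measurable[OF um vm])
  define E where "E w x = (\<integral>\<^sup>+\<omega>. ennreal \<bar>w \<omega> x\<bar> ^ 2 \<partial>P)" for w :: "'w \<Rightarrow> real^'d \<Rightarrow> real" and x
  have swap: "(\<lambda>p. w (snd p) (fst p)) \<in> borel_measurable (M \<Otimes>\<^sub>M P)"
    if "case_prod w \<in> borel_measurable PM" for w :: "'w \<Rightarrow> real^'d \<Rightarrow> real"
  proof -
    have "(\<lambda>p. (snd p, fst p)) \<in> measurable (M \<Otimes>\<^sub>M P) PM" by measurable
    from measurable_compose[OF this that] show ?thesis by simp
  qed
  have Em: "E w \<in> borel_measurable M" if "case_prod w \<in> borel_measurable PM" for w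
  proof -
    have "(\<lambda>p. ennreal \<bar>w (snd p) (fst p)\<bar> ^ 2) \<in> borel_measurable (M \<Otimes>\<^sub>M P)"
      using swap[OF that] by measurable
    from P.borel_measurable_nn_integral_fst[OF this] show ?thesis by (simp add: E_def[abs_def])
  qed
  have Eint: "(\<integral>\<^sup>+x. E w x \<partial>M) = ennreal ((nrm PM (case_prod w))\<^sup>2)" if w: "case_prod w \<in> sq_int PM" for w
  proof -
    have m: "case_prod w \<in> borel_measurable PM" using w by auto
    have "(\<integral>\<^sup>+x. E w x \<partial>M) = (\<integral>\<^sup>+p. ennreal \<bar>case_prod w p\<bar> ^ 2 \<partial>PM)"
    proof -
      have "(\<lambda>p. ennreal \<bar>case_prod w p\<bar> ^ 2) \<in> borel_measurable PM" using m by measurable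
      from PM.nn_integral_snd[OF this] show ?thesis by (simp add: E_def)
    qed
    also have "\<dots> = (\<integral>\<^sup>+p. ennreal ((case_prod w p)\<^sup>2) \<partial>PM)"
      by (simp add: ennreal_power)
    also have "\<dots> = ennreal (\<integral>p. (case_prod w p)\<^sup>2 \<partial>PM)"
      using w by (intro nn_integral_eq_integral) auto
    finally show ?thesis by (simp add: nrm_power2)
  qed
  have sec: "(\<lambda>\<omega>. w \<omega> x) \<in> borel_measurable P"
    if "case_prod w \<in> borel_measurable PM" "x \<in> space M" for w x
    using measurable_compose[OF measurable_Pair2'[OF that(2)] that(1)] by simp
  have le: "ennreal ((cross P u v z)\<^sup>2) \<le> E u (fst z) * E v (snd z)" if z: "z \<in> space N" for z
  proof -
    have su: "(\<lambda>\<omega>. u \<omega> (fst z)) \<in> borel_measurable P" and sv: "(\<lambda>\<omega>. v \<omega> (snd z)) \<in> borel_measurable P"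
      using z by (auto intro!: sec[OF um] sec[OF vm] simp: space_pair_measure)
    have "ennreal \<bar>cross P u v z\<bar> \<le> (\<integral>\<^sup>+\<omega>. ennreal \<bar>u \<omega> (fst z)\<bar> * ennreal \<bar>v \<omega> (snd z)\<bar> \<partial>P)"
    proof (cases "integrable P (\<lambda>\<omega>. u \<omega> (fst z) * v \<omega> (snd z))")
      case True
      from integral_norm_bound_ennreal[OF this] show ?thesis
        by (simp add: cross_def abs_mult ennreal_mult')
    next
      \<comment> \<open>The Bochner integral of a non-integrable function is 0, so the bound is
        trivial.\<close>
      case False
      then show ?thesis by (simp add: cross_def not_integrable_integral_eq)
    qed
    then have "ennreal \<bar>cross P u v z\<bar> ^ 2 \<le> (\<integral>\<^sup>+\<omega>. ennreal \<bar>u \<omega> (fst z)\<bar> * ennreal \<bar>v \<omega> (snd z)\<bar> \<partial>P) ^ 2"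
      by (rule power_mono_ennreal)
    also have "\<dots> \<le> E u (fst z) * E v (snd z)"
    proof -
      have "(\<lambda>\<omega>. ennreal \<bar>u \<omega> (fst z)\<bar>) \<in> borel_measurable P" using su by measurable
      moreover have "(\<lambda>\<omega>. ennreal \<bar>v \<omega> (snd z)\<bar>) \<in> borel_measurable P" using sv by measurable
      ultimately show ?thesis unfolding E_def by (rule Cauchy_Schwarz_nn_integral)
    qed
    finally show ?thesis by (simp add: ennreal_power)
  qed
  have "(\<integral>\<^sup>+z. ennreal ((cross P u v z)\<^sup>2) \<partial>N) \<le> (\<integral>\<^sup>+z. E u (fst z) * E v (snd z) \<partial>N)"
    by (intro nn_integral_mono le)
  also have "\<dots> = (\<integral>\<^sup>+x. \<integral>\<^sup>+y. E u x * E v y \<partial>M \<partial>M)"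
  proof -
    have "(\<lambda>z. E u (fst z) * E v (snd z)) \<in> borel_measurable N"
      by (intro borel_measurable_times_ennreal measurable_compose[OF measurable_fst Em[OF um]]
          measurable_compose[OF measurable_snd Em[OF vm]])
    from nn_integral_fst[OF this] show ?thesis by simp
  qed
  also have "\<dots> = (\<integral>\<^sup>+x. E u x \<partial>M) * (\<integral>\<^sup>+y. E v y \<partial>M)"
    using Em[OF um] Em[OF vm] by (simp add: nn_integral_cmult nn_integral_multc)
  also have "\<dots> = ennreal ((nrm PM (case_prod u) * nrm PM (case_prod v))\<^sup>2)"
    by (simp add: Eint u v power_mult_distrib ennreal_mult)
  finally have key: "(\<integral>\<^sup>+z. ennreal ((cross P u v z)\<^sup>2) \<partial>N) \<le> ennreal ((nrm PM (case_prod u) * nrm PM (case_prod v))\<^sup>2)" .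
  have i: "integrable N (\<lambda>z. (cross P u v z)\<^sup>2)"
    using cm order_le_less_trans[OF key ennreal_less_top] by (intro integrableI_bounded) simp_all
  show "cross P u v \<in> sq_int N" by (rule sq_intI[OF cm i])
  have "ennreal (\<integral>z. (cross P u v z)\<^sup>2 \<partial>N) \<le> ennreal ((nrm PM (case_prod u) * nrm PM (case_prod v))\<^sup>2)"
    using key i by (subst nn_integral_eq_integral[symmetric]) auto
  then have "(nrm N (cross P u v))\<^sup>2 \<le> (nrm PM (case_prod u) * nrm PM (case_prod v))\<^sup>2"
    by (simp add: nrm_power2)
  then show "nrm N (cross P u v) \<le> nrm PM (case_prod u) * nrm PM (case_prod v)"
    by (rule power2_le_imp_le) simp
qed

lemma AE_section_sq_int:
  assumes u: "case_prod u \<in> sq_int PM" shows "AE x in M. (\<lambda>\<omega>. u \<omega> x) \<in> sq_int P"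
proof -
  have "integrable PM (\<lambda>(\<omega>, x). (u \<omega> x)\<^sup>2)"
    using u by (auto simp: sq_int_def case_prod_beta')
  from PM.AE_integrable_snd[OF this] show ?thesis
  proof (rule AE_mp, intro AE_I2 impI sq_intI)
    fix x assume x: "x \<in> space M"
    have um: "case_prod u \<in> borel_measurable PM" using u by auto
    show "(\<lambda>\<omega>. u \<omega> x) \<in> borel_measurable P"
      using measurable_compose[OF measurable_Pair2'[OF x] um] by simp
  qed
qed

text \<open>The splitting u v - u' v' = (u - u') v + u' (v - v') under the expectation. It holds for
  almost every point only, since the sections are square integrable almost everywhere.\<close>

lemma nrm_cross_diff:
  assumes u: "case_prod u \<in> sq_int PM" "case_prod u' \<in> sq_int PM"
    and v: "case_prod v \<in> sq_int PM" "case_prod v' \<in> sq_int PM"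
  shows "nrm N (\<lambda>z. cross P u v z - cross P u' v' z)
    \<le> nrm PM (\<lambda>p. case_prod u p - case_prod u' p) * nrm PM (case_prod v)
      + nrm PM (case_prod u') * nrm PM (\<lambda>p. case_prod v p - case_prod v' p)"
proof -
  define du where "du \<omega> x = u \<omega> x - u' \<omega> x" for \<omega> x
  define dv where "dv \<omega> x = v \<omega> x - v' \<omega> x" for \<omega> x
  have eq: "case_prod du = (\<lambda>p. case_prod u p - case_prod u' p)" "case_prod dv = (\<lambda>p. case_prod v p - case_prod v' p)"
    by (auto simp: du_def dv_def fun_eq_iff)
  have d: "case_prod du \<in> sq_int PM" "case_prod dv \<in> sq_int PM"
    unfolding eq by (intro sq_int_diff u v)+
  have "AE z in N. cross P u v z - cross P u' v' z = cross P du v z + cross P u' dv z"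
    using AE_fst[OF AE_section_sq_int[OF u(1)]] AE_fst[OF AE_section_sq_int[OF u(2)]]
      AE_snd[OF AE_section_sq_int[OF v(1)]] AE_snd[OF AE_section_sq_int[OF v(2)]]
  proof eventually_elim
    case (elim z)
    note i = sq_int_mult_integrable[OF elim(1) elim(3)] sq_int_mult_integrable[OF elim(2) elim(3)]
      sq_int_mult_integrable[OF elim(2) elim(4)]
    then show ?case
      unfolding cross_def du_def dv_def by (simp add: left_diff_distrib right_diff_distrib)
  qed
  then have "nrm N (\<lambda>z. cross P u v z - cross P u' v' z) = nrm N (\<lambda>z. cross P du v z + cross P u' dv z)"
  proof (rule nrm_cong_AE[rotated 2])
    show "(\<lambda>z. cross P u v z - cross P u' v' z) \<in> borel_measurable N"
      by (rule sq_intD(1)[OF sq_int_diff[OF cross_sq_int(1)[OF u(1) v(1)] cross_sq_int(1)[OF u(2) v(2)]]])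
    show "(\<lambda>z. cross P du v z + cross P u' dv z) \<in> borel_measurable N"
      by (rule sq_intD(1)[OF sq_int_add[OF cross_sq_int(1)[OF d(1) v(1)] cross_sq_int(1)[OF u(2) d(2)]]])
  qed
  also have "\<dots> \<le> nrm N (cross P du v) + nrm N (cross P u' dv)"
    by (intro nrm_triangle cross_sq_int u v d)
  also have "\<dots> \<le> nrm PM (case_prod du) * nrm PM (case_prod v) + nrm PM (case_prod u') * nrm PM (case_prod dv)"
    by (intro add_mono cross_sq_int u v d)
  finally show ?thesis unfolding eq .
qed

lemma cross_tendsto:
  assumes u: "\<And>n. case_prod (u n) \<in> sq_int PM" "case_prod u' \<in> sq_int PM"
    and lim: "(\<lambda>n. nrm PM (\<lambda>p. case_prod (u n) p - case_prod u' p)) \<longlonglongrightarrow> 0"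
  shows "(\<lambda>n. nrm N (\<lambda>z. cross P (u n) (u n) z - cross P u' u' z)) \<longlonglongrightarrow> 0"
proof -
  let ?d = "\<lambda>n. nrm PM (\<lambda>p. case_prod (u n) p - case_prod u' p)"
  have b: "norm (nrm N (\<lambda>z. cross P (u n) (u n) z - cross P u' u' z))
      \<le> ?d n * nrm PM (case_prod (u n)) + nrm PM (case_prod u') * ?d n" for n
    using nrm_cross_diff[OF u(1) u(2) u(1) u(2), of n n] by simp
  have "(\<lambda>n. ?d n * nrm PM (case_prod (u n)) + nrm PM (case_prod u') * ?d n)
      \<longlonglongrightarrow> 0 * nrm PM (case_prod u') + nrm PM (case_prod u') * 0"
    by (intro tendsto_intros lim nrm_tendsto u)
  then show ?thesis by (intro Lim_null_comparison[OF always_eventually[OF allI[OF b]]]) simp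
qed

text \<open>The isometry of L2(Omega; L2(D)) into L2(Omega x D), for fields that are jointly
  measurable.\<close>

lemma sq_int_random_field:
  assumes m: "case_prod v \<in> borel_measurable PM"
    and v: "\<And>\<omega>. \<omega> \<in> space P \<Longrightarrow> v \<omega> \<in> sq_int M"
    and i: "integrable P (\<lambda>\<omega>. (nrm M (v \<omega>))\<^sup>2)"
  shows "case_prod v \<in> sq_int PM" "(nrm PM (case_prod v))\<^sup>2 = (\<integral>\<omega>. (nrm M (v \<omega>))\<^sup>2 \<partial>P)"
proof -
  have int: "integrable PM (\<lambda>p. (case_prod v p)\<^sup>2)"
  proof (rule PM.Fubini_integrable)
    show "(\<lambda>p. (case_prod v p)\<^sup>2) \<in> borel_measurable PM" using m by measurable
    show "integrable P (\<lambda>\<omega>. \<integral>y. norm ((case_prod v (\<omega>, y))\<^sup>2) \<partial>M)"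
      using i by (simp add: nrm_power2)
    show "AE \<omega> in P. integrable M (\<lambda>y. (case_prod v (\<omega>, y))\<^sup>2)"
      using v by (intro AE_I2) auto
  qed
  then show "case_prod v \<in> sq_int PM" by (rule sq_intI[OF m])
  show "(nrm PM (case_prod v))\<^sup>2 = (\<integral>\<omega>. (nrm M (v \<omega>))\<^sup>2 \<partial>P)"
    using PM.integral_fst'[OF int] by (simp add: nrm_power2)
qed

section \<open>Simple random fields\<close>

definition simple_field :: "('w \<Rightarrow> real^'d \<Rightarrow> real) \<Rightarrow> bool" where
  "simple_field s \<longleftrightarrow> simple_function P s \<and> s ` space P \<subseteq> H10 D"

lemma simple_fieldD:
  assumes "simple_field s"
  shows "simple_function P s" "finite (s ` space P)" "\<omega> \<in> space P \<Longrightarrow> s \<omega> \<in> H10 D"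
    "\<omega> \<in> space P \<Longrightarrow> s \<omega> \<in> H1 D" "v \<in> s ` space P \<Longrightarrow> v \<in> H10 D"
  using assms simple_functionD(1) H10_H1 by (auto simp: simple_field_def)

lemma simple_compose_integrable:
  fixes h :: "_ \<Rightarrow> real"
  assumes "simple_function P s"
  shows "integrable P (\<lambda>\<omega>. h (s \<omega>))"
proof -
  have s: "simple_function P (\<lambda>\<omega>. h (s \<omega>))" by (rule simple_function_compose1[OF assms])
  then have fin: "finite ((\<lambda>\<omega>. h (s \<omega>)) ` space P)" by (rule simple_functionD)
  then obtain B where B: "\<And>y. y \<in> (\<lambda>\<omega>. h (s \<omega>)) ` space P \<Longrightarrow> \<bar>y\<bar> \<le> B"
    using finite_imp_bounded[of "(\<lambda>\<omega>. h (s \<omega>)) ` space P"] by (auto simp: bounded_iff)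
  show ?thesis
    by (rule P.integrable_const_bound[where B=B]) (use B borel_measurable_simple_function[OF s] in auto)
qed

text \<open>The reason for passing to simple fields: the gradient of such a field is a finite sum of
  indicators in \<omega> times fixed functions of x, and hence jointly measurable.\<close>

lemma simple_field_jet_sq_int:
  assumes s: "simple_field s"
  shows "case_prod (\<lambda>\<omega>. jet D e (s \<omega>)) \<in> sq_int PM"
    "(nrm PM (case_prod (\<lambda>\<omega>. jet D e (s \<omega>))))\<^sup>2 = (\<integral>\<omega>. (nrm M (jet D e (s \<omega>)))\<^sup>2 \<partial>P)"
proof -
  note sD = simple_fieldD[OF s]
  have m: "case_prod (\<lambda>\<omega>. jet D e (s \<omega>)) \<in> borel_measurable PM"
  proof -
    have "(\<lambda>p. \<Sum>v\<in>s ` space P. indicator (s -` {v} \<inter> space P) (fst p) * jet D e v (snd p)) \<in> borel_measurable PM"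
    proof (intro borel_measurable_sum borel_measurable_times)
      fix v assume v: "v \<in> s ` space P"
      show "(\<lambda>p. indicator (s -` {v} \<inter> space P) (fst p)) \<in> borel_measurable PM"
        using simple_functionD(2)[OF sD(1)]
        by (intro measurable_compose[OF measurable_fst borel_measurable_indicator])
      show "(\<lambda>p. jet D e v (snd p)) \<in> borel_measurable PM"
        by (intro measurable_compose[OF measurable_snd] sq_intD(1) jet_sq_int H10_H1 sD(5) v)
    qed
    moreover have "(\<Sum>v\<in>s ` space P. indicator (s -` {v} \<inter> space P) (fst p) * jet D e v (snd p))
        = case_prod (\<lambda>\<omega>. jet D e (s \<omega>)) p" if "p \<in> space PM" for p
    proof -
      have p: "fst p \<in> space P" using that by (auto simp: space_pair_measure)
      have "(\<Sum>v\<in>s ` space P. indicator (s -` {v} \<inter> space P) (fst p) * jet D e v (snd p))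
        = (\<Sum>v\<in>s ` space P. if v = s (fst p) then jet D e v (snd p) else 0)"
        using p by (intro sum.cong) (auto simp: indicator_def)
      then show ?thesis using p sD(2) by (simp add: case_prod_beta')
    qed
    ultimately show ?thesis by (subst measurable_cong[symmetric]) auto
  qed
  have i: "integrable P (\<lambda>\<omega>. (nrm M (jet D e (s \<omega>)))\<^sup>2)"
    by (rule simple_compose_integrable[OF sD(1)])
  show "case_prod (\<lambda>\<omega>. jet D e (s \<omega>)) \<in> sq_int PM"
    "(nrm PM (case_prod (\<lambda>\<omega>. jet D e (s \<omega>))))\<^sup>2 = (\<integral>\<omega>. (nrm M (jet D e (s \<omega>)))\<^sup>2 \<partial>P)"
    by (rule sq_int_random_field[OF m jet_sq_int[OF sD(4)] i]; assumption)+
qed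

lemma simple_field_jet_diff:
  assumes s: "simple_field s" and t: "simple_field t"
  shows "(nrm PM (\<lambda>p. case_prod (\<lambda>\<omega>. jet D e (s \<omega>)) p - case_prod (\<lambda>\<omega>. jet D e (t \<omega>)) p))\<^sup>2
    \<le> (\<integral>\<omega>. (H1_norm D (\<lambda>x. s \<omega> x - t \<omega> x))\<^sup>2 \<partial>P)"
proof -
  let ?v = "\<lambda>\<omega> x. jet D e (s \<omega>) x - jet D e (t \<omega>) x"
  note S = simple_fieldD[OF s] and T = simple_fieldD[OF t]
  have eq: "case_prod ?v = (\<lambda>p. case_prod (\<lambda>\<omega>. jet D e (s \<omega>)) p - case_prod (\<lambda>\<omega>. jet D e (t \<omega>)) p)"
    by (auto simp: fun_eq_iff)
  have sq: "case_prod ?v \<in> sq_int PM"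
    unfolding eq by (intro sq_int_diff simple_field_jet_sq_int s t)
  \<comment> \<open>The pair is again simple, so every functional of the two values is
    integrable.\<close>
  have st: "simple_function P (\<lambda>\<omega>. (s \<omega>, t \<omega>))" by (rule simple_function_Pair[OF S(1) T(1)])
  have i1: "integrable P (\<lambda>\<omega>. (nrm M (?v \<omega>))\<^sup>2)"
    using simple_compose_integrable[OF st, of "\<lambda>(a, b). (nrm M (\<lambda>x. jet D e a x - jet D e b x))\<^sup>2"] by simp
  have i2: "integrable P (\<lambda>\<omega>. (H1_norm D (\<lambda>x. s \<omega> x - t \<omega> x))\<^sup>2)"
    using simple_compose_integrable[OF st, of "\<lambda>(a, b). (H1_norm D (\<lambda>x. a x - b x))\<^sup>2"] by simp
  have "(nrm PM (case_prod ?v))\<^sup>2 = (\<integral>\<omega>. (nrm M (?v \<omega>))\<^sup>2 \<partial>P)"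
    by (rule sq_int_random_field(2)[OF sq_intD(1)[OF sq] sq_int_diff[OF jet_sq_int[OF S(4)] jet_sq_int[OF T(4)]] i1])
  also have "\<dots> \<le> (\<integral>\<omega>. (H1_norm D (\<lambda>x. s \<omega> x - t \<omega> x))\<^sup>2 \<partial>P)"
    by (intro integral_mono i1 i2 power_mono nrm_jet_diff_le S T) auto
  finally show ?thesis unfolding eq .
qed

(* Represents E[s (x) s] = sum over the values v of P(s = v) v (x) v. *)
definition simple_tensor :: "('w \<Rightarrow> real^'d \<Rightarrow> real) \<Rightarrow> (real^'d) tensor" where
  "simple_tensor s = map (\<lambda>v. (\<lambda>x. measure P (s -` {v} \<inter> space P) * v x, v))
     (SOME xs. set xs = s ` space P \<and> distinct xs)"

lemma simple_tensor_sum: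
  fixes h :: "(real^'d \<Rightarrow> real) \<times> (real^'d \<Rightarrow> real) \<Rightarrow> real"
  assumes s: "simple_field s"
  shows "set (simple_tensor s) \<subseteq> H10 D \<times> H10 D"
    "(\<Sum>ab\<leftarrow>simple_tensor s. h ab) = (\<Sum>v\<in>s ` space P. h (\<lambda>x. measure P (s -` {v} \<inter> space P) * v x, v))"
proof -
  define xs where "xs = (SOME xs. set xs = s ` space P \<and> distinct xs)"
  have "set xs = s ` space P \<and> distinct xs"
    unfolding xs_def using finite_distinct_list[OF simple_fieldD(2)[OF s]] by (rule someI_ex)
  moreover have T: "simple_tensor s = map (\<lambda>v. (\<lambda>x. measure P (s -` {v} \<inter> space P) * v x, v)) xs"
    by (simp add: simple_tensor_def xs_def)
  ultimately show "set (simple_tensor s) \<subseteq> H10 D \<times> H10 D"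
    "(\<Sum>ab\<leftarrow>simple_tensor s. h ab) = (\<Sum>v\<in>s ` space P. h (\<lambda>x. measure P (s -` {v} \<inter> space P) * v x, v))"
    using simple_fieldD(5)[OF s] H10_cmult by (auto simp: comp_def sum_list_distinct_conv_sum_set)
qed

lemma simple_tensor_jet:
  assumes s: "simple_field s"
  shows "AE z in N. tensor_jet D e e' (simple_tensor s) z
    = cross P (\<lambda>\<omega>. jet D e (s \<omega>)) (\<lambda>\<omega>. jet D e' (s \<omega>)) z"
proof -
  let ?p = "\<lambda>v. measure P (s -` {v} \<inter> space P)"
  \<comment> \<open>The field takes finitely many values, so one null set serves all of
    them.\<close>
  have "AE x in M. \<forall>v\<in>s ` space P. jet D e (\<lambda>x. ?p v * v x) x = ?p v * jet D e v x"
    using simple_fieldD[OF s] jet_cmult_AE[OF H10_H1] by (intro AE_finite_allI) auto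
  from AE_fst[OF this] show ?thesis
  proof eventually_elim
    case (elim z)
    have "tensor_jet D e e' (simple_tensor s) z
        = (\<Sum>v\<in>s ` space P. jet D e (\<lambda>x. ?p v * v x) (fst z) * jet D e' v (snd z))"
      unfolding tensor_jet_def
      using simple_tensor_sum(2)[OF s, of "\<lambda>(a, b). jet D e a (fst z) * jet D e' b (snd z)"] by simp
    also have "\<dots> = (\<Sum>v\<in>s ` space P. ?p v * (jet D e v (fst z) * jet D e' v (snd z)))"
      using elim by (intro sum.cong) auto
    also have "\<dots> = cross P (\<lambda>\<omega>. jet D e (s \<omega>)) (\<lambda>\<omega>. jet D e' (s \<omega>)) z"
      unfolding cross_def
      using integral_simple_compose[OF P.prob_space_axioms simple_fieldD(1)[OF s], of "\<lambda>v. jet D e v (fst z) * jet D e' v (snd z)"]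
      by simp
    finally show ?case .
  qed
qed

end

section \<open>Bochner fields with values in \<open>H10 D\<close> and their simple
  approximations\<close>

context random_domain begin

abbreviation "H10_fields \<equiv> L2_random P D (H10 D) (H1_norm D)"

lemma H10_fieldD:
  assumes "u \<in> H10_fields"
  shows "\<omega> \<in> space P \<Longrightarrow> u \<omega> \<in> H10 D" "\<omega> \<in> space P \<Longrightarrow> u \<omega> \<in> H1 D"
    "case_prod u \<in> borel_measurable PM" "integrable P (\<lambda>\<omega>. (H1_norm D (u \<omega>))\<^sup>2)"
    "(\<lambda>\<omega>. H1_norm D (u \<omega>)) \<in> borel_measurable P"
proof -
  show H: "\<omega> \<in> space P \<Longrightarrow> u \<omega> \<in> H10 D" "\<omega> \<in> space P \<Longrightarrow> u \<omega> \<in> H1 D" for \<omega>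
    using assms H10_H1 by (auto simp: L2_random_def)
  show "case_prod u \<in> borel_measurable PM" and i: "integrable P (\<lambda>\<omega>. (H1_norm D (u \<omega>))\<^sup>2)"
    using assms by (auto simp: L2_random_def)
  \<comment> \<open>Only the square of the norm is known to be measurable, through its
    integrability; the nonnegative norm is recovered as its root.\<close>
  have "(\<lambda>\<omega>. sqrt ((H1_norm D (u \<omega>))\<^sup>2)) \<in> borel_measurable P"
    using borel_measurable_integrable[OF i] by measurable
  moreover have "sqrt ((H1_norm D (u \<omega>))\<^sup>2) = H1_norm D (u \<omega>)" if "\<omega> \<in> space P" for \<omega>
    using H1_norm_nonneg[OF H(2)[OF that]] by simp
  ultimately show "(\<lambda>\<omega>. H1_norm D (u \<omega>)) \<in> borel_measurable P"
    by (subst measurable_cong[symmetric]) auto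
qed

lemma H10_field_sq_int:
  assumes u: "u \<in> H10_fields" shows "case_prod u \<in> sq_int PM"
proof (rule sq_int_random_field(1)[OF H10_fieldD(3)[OF u] H1_sq_int[OF H10_fieldD(2)[OF u]]])
  have "(\<lambda>\<omega>. \<integral>x. (u \<omega> x)\<^sup>2 \<partial>M) \<in> borel_measurable P"
    using H10_fieldD(3)[OF u] by (intro borel_measurable_lebesgue_integral) (simp add: case_prod_beta')
  then have m: "(\<lambda>\<omega>. (nrm M (u \<omega>))\<^sup>2) \<in> borel_measurable P" by (simp add: nrm_power2)
  show "integrable P (\<lambda>\<omega>. (nrm M (u \<omega>))\<^sup>2)"
  proof (rule Bochner_Integration.integrable_bound[OF H10_fieldD(4)[OF u] m], rule AE_I2)
    fix \<omega> assume "\<omega> \<in> space P"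
    then have "nrm M (u \<omega>) \<le> H1_norm D (u \<omega>)"
      using nrm_jet_le[OF H10_fieldD(2)[OF u], of \<omega> None] by simp
    then show "norm ((nrm M (u \<omega>))\<^sup>2) \<le> norm ((H1_norm D (u \<omega>))\<^sup>2)" by (simp add: power_mono)
  qed
qed

(* Bochner's truncation: where the H1 norm of s n exceeds twice that of u, the simple approximation is replaced by 0,
   which makes it dominated by u while keeping pointwise convergence. *)
lemma simple_field_approximation:
  assumes u: "u \<in> H10_fields"
  obtains s where "\<And>n. simple_field (s n)"
    "\<And>n \<omega>. \<omega> \<in> space P \<Longrightarrow> H1_norm D (s n \<omega>) \<le> 2 * H1_norm D (u \<omega>)"
    "\<And>\<omega>. \<omega> \<in> space P \<Longrightarrow> (\<lambda>n. H1_norm D (\<lambda>x. s n \<omega> x - u \<omega> x)) \<longlonglongrightarrow> 0"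
    "\<And>n. integrable P (\<lambda>\<omega>. (H1_norm D (\<lambda>x. s n \<omega> x - u \<omega> x))\<^sup>2)"
    "(\<lambda>n. \<integral>\<omega>. (H1_norm D (\<lambda>x. s n \<omega> x - u \<omega> x))\<^sup>2 \<partial>P) \<longlonglongrightarrow> 0"
proof -
  note U = H10_fieldD[OF u]
  obtain r where r: "\<And>n. simple_field (r n)"
    "\<And>\<omega>. \<omega> \<in> space P \<Longrightarrow> (\<lambda>n. H1_norm D (\<lambda>x. r n \<omega> x - u \<omega> x)) \<longlonglongrightarrow> 0"
    using u unfolding L2_random_def simple_field_def by blast
  note R = simple_fieldD[OF r(1)]
  define s where "s n \<omega> = (if H1_norm D (r n \<omega>) \<le> 2 * H1_norm D (u \<omega>) then r n \<omega> else (\<lambda>x. 0))" for n \<omega>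
  have ss: "simple_function P (s n)" for n
    unfolding s_def[abs_def]
  proof (rule simple_function_If[OF R(1) simple_function_const])
    have "(\<lambda>\<omega>. H1_norm D (r n \<omega>)) \<in> borel_measurable P"
      by (rule borel_measurable_simple_function[OF simple_function_compose1[OF R(1)]])
    then show "{\<omega> \<in> space P. H1_norm D (r n \<omega>) \<le> 2 * H1_norm D (u \<omega>)} \<in> sets P"
      using U(5) by measurable
  qed
  have s1: "simple_field (s n)" for n
    using ss R(3) H10_zero by (auto simp: simple_field_def s_def)
  note S = simple_fieldD[OF s1]
  have s2: "H1_norm D (s n \<omega>) \<le> 2 * H1_norm D (u \<omega>)" if "\<omega> \<in> space P" for n \<omega>
    using H1_norm_nonneg[OF U(2)[OF that]] by (simp add: s_def H1_norm_zero)
  have s3: "(\<lambda>n. H1_norm D (\<lambda>x. s n \<omega> x - u \<omega> x)) \<longlonglongrightarrow> 0" if w: "\<omega> \<in> space P" for \<omega>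
  proof (cases "H1_norm D (u \<omega>) = 0")
    \<comment> \<open>Where u has norm 0 the truncation forces norm 0 on \<open>s n\<close> too; the
      strict comparison in the other case needs a positive norm.\<close>
    case True
    have "H1_norm D (\<lambda>x. s n \<omega> x - u \<omega> x) = 0" for n
    proof -
      have "H1_norm D (\<lambda>x. s n \<omega> x - u \<omega> x) \<le> H1_norm D (s n \<omega>) + H1_norm D (u \<omega>)"
        by (rule H1_norm_diff_le[OF S(4)[OF w] U(2)[OF w]])
      then show ?thesis
        using s2[OF w, of n] True H1_norm_nonneg[OF H1_diff[OF S(4)[OF w] U(2)[OF w]], of n] by simp
    qed
    then show ?thesis by simp
  next
    case False
    then have pos: "H1_norm D (u \<omega>) > 0" using H1_norm_nonneg[OF U(2)[OF w]] by simp
    \<comment> \<open>Once \<open>r n\<close> is closer to u than the norm of u, its own norm is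
      less than twice that of u and the truncation is inactive.\<close>
    have "\<forall>\<^sub>F n in sequentially. H1_norm D (\<lambda>x. r n \<omega> x - u \<omega> x) < H1_norm D (u \<omega>)"
      using order_tendstoD(2)[OF r(2)[OF w] pos] .
    then have "\<forall>\<^sub>F n in sequentially. H1_norm D (\<lambda>x. r n \<omega> x - u \<omega> x) = H1_norm D (\<lambda>x. s n \<omega> x - u \<omega> x)"
    proof eventually_elim
      case (elim n)
      have "H1_norm D (\<lambda>x. 1 * (r n \<omega> x - u \<omega> x) + 1 * u \<omega> x)
          \<le> \<bar>1\<bar> * H1_norm D (\<lambda>x. r n \<omega> x - u \<omega> x) + \<bar>1\<bar> * H1_norm D (u \<omega>)"
        by (rule H1_norm_lincomb_le[OF H1_diff[OF R(4)[OF w] U(2)[OF w]] U(2)[OF w]])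
      then show ?case using elim by (simp add: s_def)
    qed
    then show ?thesis by (rule Lim_transform_eventually[OF r(2)[OF w]])
  qed
  \<comment> \<open>The distance to u is the pointwise limit, as m grows, of the distances to
    \<open>r m\<close>, and these are simple functions of \<omega>.\<close>
  have meas: "(\<lambda>\<omega>. H1_norm D (\<lambda>x. s n \<omega> x - u \<omega> x)) \<in> borel_measurable P" for n
  proof (rule borel_measurable_LIMSEQ_real)
    fix \<omega> assume w: "\<omega> \<in> space P"
    have "\<bar>H1_norm D (\<lambda>x. s n \<omega> x - r m \<omega> x) - H1_norm D (\<lambda>x. s n \<omega> x - u \<omega> x)\<bar>
        \<le> H1_norm D (\<lambda>x. r m \<omega> x - u \<omega> x)" for m
      using H1_norm_triangle_diff[OF S(4)[OF w] R(4)[OF w] U(2)[OF w], of n m]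
        H1_norm_triangle_diff[OF S(4)[OF w] U(2)[OF w] R(4)[OF w], of n m]
        H1_norm_diff_commute[OF U(2)[OF w] R(4)[OF w], of m] by linarith
    then have b: "norm (H1_norm D (\<lambda>x. s n \<omega> x - r m \<omega> x) - H1_norm D (\<lambda>x. s n \<omega> x - u \<omega> x))
        \<le> H1_norm D (\<lambda>x. r m \<omega> x - u \<omega> x)" for m by simp
    have "(\<lambda>m. H1_norm D (\<lambda>x. s n \<omega> x - r m \<omega> x) - H1_norm D (\<lambda>x. s n \<omega> x - u \<omega> x)) \<longlonglongrightarrow> 0"
      by (rule Lim_null_comparison[OF always_eventually[OF allI[OF b]] r(2)[OF w]])
    then show "(\<lambda>m. H1_norm D (\<lambda>x. s n \<omega> x - r m \<omega> x)) \<longlonglongrightarrow> H1_norm D (\<lambda>x. s n \<omega> x - u \<omega> x)"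
      by (simp add: LIM_zero_iff)
  next
    show "(\<lambda>\<omega>. H1_norm D (\<lambda>x. s n \<omega> x - r m \<omega> x)) \<in> borel_measurable P" for m
      by (rule borel_measurable_simple_function[OF simple_function_compose2[OF ss R(1), where h="\<lambda>a b. H1_norm D (\<lambda>x. a x - b x)"]])
  qed
  \<comment> \<open>9 = (2 + 1)^2, with 2 from the truncated field and 1 from u.\<close>
  have bound: "norm ((H1_norm D (\<lambda>x. s n \<omega> x - u \<omega> x))\<^sup>2) \<le> 9 * (H1_norm D (u \<omega>))\<^sup>2" if w: "\<omega> \<in> space P" for n \<omega>
  proof -
    have "H1_norm D (\<lambda>x. s n \<omega> x - u \<omega> x) \<le> H1_norm D (s n \<omega>) + H1_norm D (u \<omega>)"
      by (rule H1_norm_diff_le[OF S(4)[OF w] U(2)[OF w]])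
    then have "H1_norm D (\<lambda>x. s n \<omega> x - u \<omega> x) \<le> 3 * H1_norm D (u \<omega>)" using s2[OF w, of n] by simp
    then have "(H1_norm D (\<lambda>x. s n \<omega> x - u \<omega> x))\<^sup>2 \<le> (3 * H1_norm D (u \<omega>))\<^sup>2"
      using H1_norm_nonneg[OF H1_diff[OF S(4)[OF w] U(2)[OF w]], of n] by (intro power_mono)
    then show ?thesis by (simp add: power_mult_distrib)
  qed
  have dom: "integrable P (\<lambda>\<omega>. 9 * (H1_norm D (u \<omega>))\<^sup>2)" using U(4) by simp
  have s4: "integrable P (\<lambda>\<omega>. (H1_norm D (\<lambda>x. s n \<omega> x - u \<omega> x))\<^sup>2)" for n
    using bound meas[of n] by (intro Bochner_Integration.integrable_bound[OF dom]) auto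
  have "(\<lambda>n. \<integral>\<omega>. (H1_norm D (\<lambda>x. s n \<omega> x - u \<omega> x))\<^sup>2 \<partial>P) \<longlonglongrightarrow> (\<integral>\<omega>. 0 \<partial>P)"
  proof (rule integral_dominated_convergence[OF _ _ dom])
    show "AE \<omega> in P. (\<lambda>n. (H1_norm D (\<lambda>x. s n \<omega> x - u \<omega> x))\<^sup>2) \<longlonglongrightarrow> 0"
    proof (rule AE_I2)
      fix \<omega> assume "\<omega> \<in> space P"
      from tendsto_power[OF s3[OF this], of 2]
      show "(\<lambda>n. (H1_norm D (\<lambda>x. s n \<omega> x - u \<omega> x))\<^sup>2) \<longlonglongrightarrow> 0" by simp
    qed
    show "AE \<omega> in P. norm ((H1_norm D (\<lambda>x. s n \<omega> x - u \<omega> x))\<^sup>2) \<le> 9 * (H1_norm D (u \<omega>))\<^sup>2" for n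
      using bound by (intro AE_I2)
    show "(\<lambda>\<omega>. (H1_norm D (\<lambda>x. s n \<omega> x - u \<omega> x))\<^sup>2) \<in> borel_measurable P" for n
      using meas[of n] by measurable
  qed simp
  then show ?thesis using that[of s] s1 s2 s3 s4 by simp
qed

section \<open>The correlation as an element of the tensor product space\<close>

lemma correlation_sq_int:
  assumes "case_prod u \<in> sq_int PM" shows "correlation P u \<in> sq_int N"
  unfolding correlation_eq_cross by (rule cross_sq_int(1)[OF assms assms])

text \<open>The jets of the simple fields are Cauchy in L2(Omega x D), so by bilinearity the jets of
  their tensors are Cauchy as well, while the functions converge to the correlation. Jets of u
  itself are never placed in the product space; the comparison with u goes through the H1 norm at
  each \<omega>.\<close>

lemma correlation_H11:
  assumes u: "u \<in> H10_fields" and s: "\<And>n. simple_field (s n)"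
    and i: "\<And>n. integrable P (\<lambda>\<omega>. (H1_norm D (\<lambda>x. s n \<omega> x - u \<omega> x))\<^sup>2)"
    and lim: "(\<lambda>n. \<integral>\<omega>. (H1_norm D (\<lambda>x. s n \<omega> x - u \<omega> x))\<^sup>2 \<partial>P) \<longlonglongrightarrow> 0"
  shows "correlation P u \<in> H11 D"
    "(\<lambda>n. nrm M2 (\<lambda>z. tensor_jet D (Some k) (Some l) (simple_tensor (s n)) z
        - weak_grad_xy D (correlation P u) z $ k $ l)) \<longlonglongrightarrow> 0"
    "(\<lambda>z. weak_grad_xy D (correlation P u) z $ k $ l) \<in> sq_int M2"
proof -
  define C where "C = correlation P u"
  define T where "T n = simple_tensor (s n)" for n
  define E where "E n = (\<integral>\<omega>. (H1_norm D (\<lambda>x. s n \<omega> x - u \<omega> x))\<^sup>2 \<partial>P)" for n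
  define js where "js e n = case_prod (\<lambda>\<omega>. jet D e (s n \<omega>))" for e n
  note U = H10_fieldD[OF u] and S = simple_fieldD[OF s]
  have usq: "case_prod u \<in> sq_int PM" by (rule H10_field_sq_int[OF u])
  have jsq: "js e n \<in> sq_int PM" for e n
    unfolding js_def by (rule simple_field_jet_sq_int(1)[OF s])
  have E0: "E n \<ge> 0" for n unfolding E_def by simp
  have Csq: "C \<in> sq_int N" unfolding C_def by (rule correlation_sq_int[OF usq])
  have T10: "set (T n) \<subseteq> H10 D \<times> H10 D" for n unfolding T_def by (rule simple_tensor_sum(1)[OF s])
  have T1: "set (T n) \<subseteq> H1 D \<times> H1 D" for n using T10[of n] H10_H1 by auto
  note Tsq = tensor_jet_sq_int[OF T1]
  let ?c = "\<lambda>e e' n. cross P (\<lambda>\<omega>. jet D e (s n \<omega>)) (\<lambda>\<omega>. jet D e' (s n \<omega>))"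
  have csq: "?c e e' n \<in> sq_int N" for e e' n
    by (intro cross_sq_int simple_field_jet_sq_int s)
  have Tc: "AE z in N. tensor_jet D e e' (T n) z = ?c e e' n z" for e e' n
    unfolding T_def by (rule simple_tensor_jet[OF s])
  have nT: "nrm N (\<lambda>z. tensor_jet D e e' (T m) z - tensor_jet D e e' (T n) z) = nrm N (\<lambda>z. ?c e e' m z - ?c e e' n z)" for e e' m n
  proof (rule nrm_cong_AE)
    show "AE z in N. tensor_jet D e e' (T m) z - tensor_jet D e e' (T n) z = ?c e e' m z - ?c e e' n z"
      using Tc[of e e' m] Tc[of e e' n] by eventually_elim simp
  qed (rule sq_intD(1)[OF sq_int_diff[OF Tsq Tsq]], rule sq_intD(1)[OF sq_int_diff[OF csq csq]])
  \<comment> \<open>The distance of two approximations is compared with their H1 distances to u by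
    the triangle inequality and (a + b)^2 \<le> 2 a^2 + 2 b^2.\<close>
  have Emn: "(nrm PM (\<lambda>p. js e m p - js e n p))\<^sup>2 \<le> 2 * E m + 2 * E n" for e m n
  proof -
    have st: "simple_function P (\<lambda>\<omega>. (s m \<omega>, s n \<omega>))" by (rule simple_function_Pair[OF S(1) S(1)])
    have i2: "integrable P (\<lambda>\<omega>. (H1_norm D (\<lambda>x. s m \<omega> x - s n \<omega> x))\<^sup>2)"
      using simple_compose_integrable[OF st, of "\<lambda>(a, b). (H1_norm D (\<lambda>x. a x - b x))\<^sup>2"] by simp
    have "(nrm PM (\<lambda>p. js e m p - js e n p))\<^sup>2 \<le> (\<integral>\<omega>. (H1_norm D (\<lambda>x. s m \<omega> x - s n \<omega> x))\<^sup>2 \<partial>P)"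
      unfolding js_def by (rule simple_field_jet_diff[OF s s])
    also have "\<dots> \<le> (\<integral>\<omega>. 2 * (H1_norm D (\<lambda>x. s m \<omega> x - u \<omega> x))\<^sup>2 + 2 * (H1_norm D (\<lambda>x. s n \<omega> x - u \<omega> x))\<^sup>2 \<partial>P)"
    proof (rule integral_mono[OF i2])
      show "integrable P (\<lambda>\<omega>. 2 * (H1_norm D (\<lambda>x. s m \<omega> x - u \<omega> x))\<^sup>2 + 2 * (H1_norm D (\<lambda>x. s n \<omega> x - u \<omega> x))\<^sup>2)"
        using i by simp
      fix \<omega> assume w: "\<omega> \<in> space P"
      let ?a = "H1_norm D (\<lambda>x. s m \<omega> x - u \<omega> x)" and ?b = "H1_norm D (\<lambda>x. s n \<omega> x - u \<omega> x)"
      have "H1_norm D (\<lambda>x. s m \<omega> x - s n \<omega> x) \<le> ?a + ?b"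
        using H1_norm_triangle_diff[OF S(4)[OF w] U(2)[OF w] S(4)[OF w], of m n]
          H1_norm_diff_commute[OF U(2)[OF w] S(4)[OF w], of n] by simp
      then have "(H1_norm D (\<lambda>x. s m \<omega> x - s n \<omega> x))\<^sup>2 \<le> (?a + ?b)\<^sup>2"
        using H1_norm_nonneg[OF H1_diff[OF S(4)[OF w] S(4)[OF w]], of m n] by (intro power_mono)
      also have "\<dots> \<le> 2 * ?a\<^sup>2 + 2 * ?b\<^sup>2"
        using zero_le_power2[of "?a - ?b"] by (simp add: power2_sum power2_diff)
      finally show "(H1_norm D (\<lambda>x. s m \<omega> x - s n \<omega> x))\<^sup>2 \<le> 2 * ?a\<^sup>2 + 2 * ?b\<^sup>2" .
    qed
    also have "\<dots> = 2 * E m + 2 * E n" using i by (simp add: E_def)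
    finally show ?thesis .
  qed
  have Elim: "E \<longlonglongrightarrow> 0" using lim unfolding E_def .
  then obtain B where B: "\<And>n. E n \<le> B" by (metis Bseq_def convergent_imp_Bseq convergentI abs_le_D1 real_norm_def)
  obtain L where L: "\<And>e n. nrm PM (js e n) \<le> L"
  proof -
    \<comment> \<open>A bound for each jet index; the maximum over the finitely many indices makes
      it uniform.\<close>
    define b where "b e = nrm PM (js e 0) + sqrt (2 * B + 2 * B)" for e
    have "nrm PM (js e n) \<le> Max (range b)" for e n
    proof -
      have "(nrm PM (\<lambda>p. js e n p - js e 0 p))\<^sup>2 \<le> 2 * B + 2 * B"
        using Emn[of e n 0] B[of n] B[of 0] by linarith
      then have "nrm PM (\<lambda>p. js e n p - js e 0 p) \<le> sqrt (2 * B + 2 * B)" by (rule real_le_rsqrt)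
      then have "nrm PM (js e n) \<le> b e"
        using nrm_triangle_diff_abs[OF jsq jsq, of e n e 0] unfolding b_def by linarith
      also have "\<dots> \<le> Max (range b)" by (rule Max_ge) auto
      finally show ?thesis .
    qed
    then show ?thesis using that by blast
  qed
  have L0: "L \<ge> 0" using L[of None 0] nrm_nonneg order_trans by blast
  have cd: "nrm N (\<lambda>z. ?c e e' m z - ?c e e' n z) \<le> 2 * L * sqrt (2 * E m + 2 * E n)" for e e' m n
  proof -
    have d: "nrm PM (\<lambda>p. js e m p - js e n p) \<le> sqrt (2 * E m + 2 * E n)" for e
      by (rule real_le_rsqrt[OF Emn])
    have "nrm N (\<lambda>z. ?c e e' m z - ?c e e' n z) \<le> nrm PM (\<lambda>p. js e m p - js e n p) * nrm PM (js e' m)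
        + nrm PM (js e n) * nrm PM (\<lambda>p. js e' m p - js e' n p)"
      unfolding js_def by (intro nrm_cross_diff simple_field_jet_sq_int s)
    also have "\<dots> \<le> sqrt (2 * E m + 2 * E n) * L + L * sqrt (2 * E m + 2 * E n)"
      using E0 L0 by (intro add_mono mult_mono d L) auto
    finally show ?thesis by (simp add: algebra_simps)
  qed
  have cauchy: "\<exists>K. \<forall>m\<ge>K. \<forall>n\<ge>K. tensor_norm (H1_inner D) (tensor_diff (T m) (T n)) < \<epsilon>" if "\<epsilon> > 0" for \<epsilon>
  proof -
    \<comment> \<open>There are (d+1)^2 pairs of jet indices, and squaring the estimate
      \<open>cd\<close> yields the factor 4 L^2 for each.\<close>
    define c where "c = real CARD('d option) * real CARD('d option) * (4 * L\<^sup>2)"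
    have c0: "c \<ge> 0" by (simp add: c_def)
    have tn: "(tensor_norm (H1_inner D) (tensor_diff (T m) (T n)))\<^sup>2 \<le> c * (2 * E m + 2 * E n)" for m n
    proof -
      have "(nrm N (\<lambda>z. tensor_jet D e e' (T m) z - tensor_jet D e e' (T n) z))\<^sup>2 \<le> 4 * L\<^sup>2 * (2 * E m + 2 * E n)" for e e'
      proof -
        have "(nrm N (\<lambda>z. tensor_jet D e e' (T m) z - tensor_jet D e e' (T n) z))\<^sup>2 \<le> (2 * L * sqrt (2 * E m + 2 * E n))\<^sup>2"
          unfolding nT by (intro power_mono cd) simp
        then show ?thesis using E0 by (simp add: power_mult_distrib)
      qed
      then have "(\<Sum>e\<in>UNIV. \<Sum>e'\<in>UNIV. (nrm N (\<lambda>z. tensor_jet D e e' (T m) z - tensor_jet D e e' (T n) z))\<^sup>2)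
          \<le> (\<Sum>e\<in>(UNIV::'d option set). \<Sum>e'\<in>(UNIV::'d option set). 4 * L\<^sup>2 * (2 * E m + 2 * E n))"
        by (intro sum_mono)
      then show ?thesis unfolding tensor_norm_diff[OF T1 T1] by (simp add: c_def mult_ac)
    qed
    have "(\<lambda>n. c * (4 * E n)) \<longlonglongrightarrow> c * (4 * 0)" by (intro tendsto_intros Elim)
    then have "\<forall>\<^sub>F n in sequentially. c * (4 * E n) < \<epsilon>\<^sup>2" using that by (intro order_tendstoD(2)) auto
    then obtain K where K: "\<And>n. n \<ge> K \<Longrightarrow> c * (4 * E n) < \<epsilon>\<^sup>2" by (auto simp: eventually_sequentially)
    have "tensor_norm (H1_inner D) (tensor_diff (T m) (T n)) < \<epsilon>" if "m \<ge> K" "n \<ge> K" for m n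
    proof (rule power2_less_imp_less)
      have "c * (2 * E m + 2 * E n) = (c * (4 * E m) + c * (4 * E n)) / 2" by (simp add: algebra_simps)
      also have "\<dots> < \<epsilon>\<^sup>2" using K[OF that(1)] K[OF that(2)] by simp
      finally show "(tensor_norm (H1_inner D) (tensor_diff (T m) (T n)))\<^sup>2 < \<epsilon>\<^sup>2" using tn[of m n] by linarith
    qed (use \<open>\<epsilon> > 0\<close> in simp)
    then show ?thesis by blast
  qed
  have jN: "js None n = case_prod (s n)" for n by (simp add: js_def)
  \<comment> \<open>For the functions, unlike for their gradients, the distance to u can be taken on
    Omega x D, since u is jointly measurable.\<close>
  have ud: "nrm PM (\<lambda>p. case_prod (s n) p - case_prod u p) \<le> sqrt (E n)" for n
  proof -
    let ?v = "\<lambda>\<omega> x. s n \<omega> x - u \<omega> x"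
    have eq: "case_prod ?v = (\<lambda>p. case_prod (s n) p - case_prod u p)" by (auto simp: fun_eq_iff)
    have sq: "case_prod ?v \<in> sq_int PM" unfolding eq using jsq[of None n] jN[of n] usq by (intro sq_int_diff) auto
    have le: "nrm M (?v \<omega>) \<le> H1_norm D (?v \<omega>)" if "\<omega> \<in> space P" for \<omega>
      using nrm_jet_diff_le[OF S(4)[OF that] U(2)[OF that], of None] by simp
    have ip: "integrable PM (\<lambda>p. (case_prod ?v p)\<^sup>2)" using sq by auto
    have "(nrm PM (case_prod ?v))\<^sup>2 = (\<integral>\<omega>. (nrm M (?v \<omega>))\<^sup>2 \<partial>P)"
      using PM.integral_fst'[OF ip] by (simp add: nrm_power2)
    also have "\<dots> \<le> E n" unfolding E_def
    proof (rule integral_mono[OF _ i])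
      show "integrable P (\<lambda>\<omega>. (nrm M (?v \<omega>))\<^sup>2)"
        using PM.integrable_fst'[OF ip] by (simp add: nrm_power2)
    qed (intro power_mono le; simp)
    finally show ?thesis unfolding eq by (rule real_le_rsqrt)
  qed
  have sE: "(\<lambda>n. sqrt (E n)) \<longlonglongrightarrow> 0" using tendsto_real_sqrt[OF Elim] by simp
  have ud': "norm (nrm PM (\<lambda>p. case_prod (s n) p - case_prod u p)) \<le> sqrt (E n)" for n using ud[of n] by simp
  have lim0: "(\<lambda>n. nrm PM (\<lambda>p. case_prod (s n) p - case_prod u p)) \<longlonglongrightarrow> 0"
    by (rule Lim_null_comparison[OF always_eventually[OF allI[OF ud']] sE])
  have ssq: "case_prod (s n) \<in> sq_int PM" for n using jsq[of None n] jN[of n] by simp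
  have cl: "(\<lambda>n. nrm N (\<lambda>z. cross P (s n) (s n) z - cross P u u z)) \<longlonglongrightarrow> 0"
    by (rule cross_tendsto[OF ssq usq lim0])
  have "nrm M2 (\<lambda>z. tensor_fun (T n) z - C z) = nrm N (\<lambda>z. cross P (s n) (s n) z - cross P u u z)" for n
  proof -
    have Tn: "tensor_fun (T n) \<in> sq_int N" using Tsq[of None None n] by (simp add: tensor_jet_None)
    have cn: "cross P (s n) (s n) \<in> sq_int N" by (rule cross_sq_int(1)[OF ssq ssq])
    have "nrm M2 (\<lambda>z. tensor_fun (T n) z - C z) = nrm N (\<lambda>z. tensor_fun (T n) z - C z)"
      by (intro nrm_N[symmetric] sq_intD(1)[OF sq_int_diff[OF Tn Csq]])
    also have "\<dots> = nrm N (\<lambda>z. cross P (s n) (s n) z - cross P u u z)"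
    proof (rule nrm_cong_AE)
      show "AE z in N. tensor_fun (T n) z - C z = cross P (s n) (s n) z - cross P u u z"
        using Tc[of None None n] by (simp add: tensor_jet_None C_def correlation_eq_cross)
    qed (rule sq_intD(1)[OF sq_int_diff[OF Tn Csq]],
        rule sq_intD(1)[OF sq_int_diff[OF cn cross_sq_int(1)[OF usq usq]]])
    finally show ?thesis .
  qed
  then have lim2: "(\<lambda>n. nrm M2 (\<lambda>z. tensor_fun (T n) z - C z)) \<longlonglongrightarrow> 0" using cl by simp
  have C2: "C \<in> sq_int M2" by (rule sq_int_N[OF Csq])
  show "correlation P u \<in> H11 D"
    unfolding H11_def L2_eq L2_norm_eq using C2 T10 cauchy lim2 unfolding C_def by blast
  show "(\<lambda>n. nrm M2 (\<lambda>z. tensor_jet D (Some k) (Some l) (simple_tensor (s n)) z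
        - weak_grad_xy D (correlation P u) z $ k $ l)) \<longlonglongrightarrow> 0"
    using weak_grad_xy_tensor_limit(1)[OF C2 T10 cauchy lim2] unfolding C_def T_def by blast
  show "(\<lambda>z. weak_grad_xy D (correlation P u) z $ k $ l) \<in> sq_int M2"
    using weak_grad_xy_tensor_limit(2)[OF C2 T10 cauchy lim2] unfolding C_def by blast
qed

end

section \<open>The energy form and its tensor square\<close>

context elliptic begin

definition energy :: "(real^'d \<Rightarrow> real) \<Rightarrow> (real^'d \<Rightarrow> real) \<Rightarrow> real" where
  "energy u v = (\<integral>x. weak_grad D v x \<bullet> (A x *v weak_grad D u x) \<partial>M)"

lemma energy_term_sq_int:
  assumes "g \<in> sq_int M"
  shows "(\<lambda>x. A x $ i $ k * g x) \<in> sq_int M" "nrm M (\<lambda>x. A x $ i $ k * g x) \<le> \<bar>K\<bar> * nrm M g"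
  by (rule sq_int_bounded_mult[OF assms A_entry])+

lemma energy_term_integrable:
  assumes "u \<in> H1 D" "v \<in> H1 D"
  shows "integrable M (\<lambda>x. A x $ i $ k * jet D (Some k) u x * jet D (Some i) v x)"
  by (intro sq_int_mult_integrable energy_term_sq_int jet_sq_int assms)

lemma energy_sum:
  assumes u: "u \<in> H1 D" and v: "v \<in> H1 D"
  shows "energy u v = (\<Sum>i\<in>UNIV. \<Sum>k\<in>UNIV. \<integral>x. A x $ i $ k * jet D (Some k) u x * jet D (Some i) v x \<partial>M)"
proof -
  have "energy u v = (\<integral>x. (\<Sum>i\<in>UNIV. \<Sum>k\<in>UNIV. A x $ i $ k * jet D (Some k) u x * jet D (Some i) v x) \<partial>M)"
    unfolding energy_def
    by (intro Bochner_Integration.integral_cong refl)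
      (simp add: inner_vec_def matrix_vector_mult_def sum_distrib_left mult_ac)
  also have "\<dots> = (\<Sum>i\<in>UNIV. \<Sum>k\<in>UNIV. \<integral>x. A x $ i $ k * jet D (Some k) u x * jet D (Some i) v x \<partial>M)"
    using energy_term_integrable[OF u v] by (simp del: jet_simps)
  finally show ?thesis .
qed

lemma energy_cmult:
  assumes u: "u \<in> H1 D" and v: "v \<in> H1 D"
  shows "energy (\<lambda>x. c * u x) v = c * energy u v"
proof -
  have cu: "(\<lambda>x. c * u x) \<in> H1 D" using H1_lincomb(1)[OF u u, of c 0] by simp
  have "(\<integral>x. A x $ i $ k * jet D (Some k) (\<lambda>x. c * u x) x * jet D (Some i) v x \<partial>M)
      = c * (\<integral>x. A x $ i $ k * jet D (Some k) u x * jet D (Some i) v x \<partial>M)" for i k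
  proof -
    have "(\<integral>x. A x $ i $ k * jet D (Some k) (\<lambda>x. c * u x) x * jet D (Some i) v x \<partial>M)
        = (\<integral>x. c * (A x $ i $ k * jet D (Some k) u x * jet D (Some i) v x) \<partial>M)"
    proof (rule integral_cong_AE)
      show "AE x in M. A x $ i $ k * jet D (Some k) (\<lambda>x. c * u x) x * jet D (Some i) v x
          = c * (A x $ i $ k * jet D (Some k) u x * jet D (Some i) v x)"
        using jet_cmult_AE[OF u, of "Some k" c] by eventually_elim simp
    qed (intro borel_measurable_integrable integrable_mult_right energy_term_integrable cu u v)+
    then show ?thesis by simp
  qed
  then show ?thesis unfolding energy_sum[OF cu v] energy_sum[OF u v] by (simp add: sum_distrib_left)
qed

lemma energy_diff:
  assumes u: "u \<in> H1 D" and u': "u' \<in> H1 D" and v: "v \<in> H1 D"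
  shows "energy (\<lambda>x. u x - u' x) v = energy u v - energy u' v"
proof -
  note d = H1_diff[OF u u']
  have "(\<integral>x. A x $ i $ k * jet D (Some k) (\<lambda>x. u x - u' x) x * jet D (Some i) v x \<partial>M)
      = (\<integral>x. A x $ i $ k * jet D (Some k) u x * jet D (Some i) v x \<partial>M)
        - (\<integral>x. A x $ i $ k * jet D (Some k) u' x * jet D (Some i) v x \<partial>M)" for i k
  proof -
    have "(\<integral>x. A x $ i $ k * jet D (Some k) (\<lambda>x. u x - u' x) x * jet D (Some i) v x \<partial>M)
        = (\<integral>x. A x $ i $ k * jet D (Some k) u x * jet D (Some i) v x
            - A x $ i $ k * jet D (Some k) u' x * jet D (Some i) v x \<partial>M)"
    proof (rule integral_cong_AE)
      show "AE x in M. A x $ i $ k * jet D (Some k) (\<lambda>x. u x - u' x) x * jet D (Some i) v x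
          = A x $ i $ k * jet D (Some k) u x * jet D (Some i) v x - A x $ i $ k * jet D (Some k) u' x * jet D (Some i) v x"
        using jet_diff_AE[OF u u', of "Some k"]
        by eventually_elim (simp only: right_diff_distrib left_diff_distrib)
    qed (intro borel_measurable_integrable Bochner_Integration.integrable_diff energy_term_integrable d u u' v)+
    then show ?thesis
      using energy_term_integrable[OF u v, of i k] energy_term_integrable[OF u' v, of i k] by simp
  qed
  then show ?thesis
    unfolding energy_sum[OF d v] energy_sum[OF u v] energy_sum[OF u' v] by (simp add: sum_subtractf)
qed

lemma energy_bounded:
  obtains c where "c \<ge> 0" "\<And>u v. u \<in> H1 D \<Longrightarrow> v \<in> H1 D \<Longrightarrow> \<bar>energy u v\<bar> \<le> c * H1_norm D u * H1_norm D v"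
proof
  define c where "c = real CARD('d) * real CARD('d) * \<bar>K\<bar>"
  show "c \<ge> 0" by (simp add: c_def)
  fix u v assume u: "u \<in> H1 D" and v: "v \<in> H1 D"
  have t: "\<bar>\<integral>x. A x $ i $ k * jet D (Some k) u x * jet D (Some i) v x \<partial>M\<bar> \<le> \<bar>K\<bar> * H1_norm D u * H1_norm D v" for i k
  proof -
    have "\<bar>\<integral>x. A x $ i $ k * jet D (Some k) u x * jet D (Some i) v x \<partial>M\<bar>
        \<le> nrm M (\<lambda>x. A x $ i $ k * jet D (Some k) u x) * nrm M (jet D (Some i) v)"
      by (intro nrm_Cauchy_Schwarz energy_term_sq_int jet_sq_int u v)
    also have "\<dots> \<le> (\<bar>K\<bar> * H1_norm D u) * H1_norm D v"
    proof (intro mult_mono)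
      show "nrm M (\<lambda>x. A x $ i $ k * jet D (Some k) u x) \<le> \<bar>K\<bar> * H1_norm D u"
        by (rule order_trans[OF energy_term_sq_int(2)[OF jet_sq_int[OF u]] mult_left_mono[OF nrm_jet_le[OF u]]]) simp
      show "nrm M (jet D (Some i) v) \<le> H1_norm D v" by (rule nrm_jet_le[OF v])
    qed (simp_all add: H1_norm_nonneg[OF u])
    finally show ?thesis .
  qed
  have "\<bar>energy u v\<bar> \<le> (\<Sum>i\<in>(UNIV::'d set). \<Sum>k\<in>(UNIV::'d set). \<bar>K\<bar> * H1_norm D u * H1_norm D v)"
    unfolding energy_sum[OF u v] by (intro order_trans[OF sum_abs] sum_mono t)
  then show "\<bar>energy u v\<bar> \<le> c * H1_norm D u * H1_norm D v" by (simp add: c_def mult_ac)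
qed

section \<open>Q on mixed gradients of algebraic tensors\<close>

definition elem_grad :: "(real^'d \<Rightarrow> real) \<Rightarrow> (real^'d \<Rightarrow> real) \<Rightarrow> 'd \<Rightarrow> 'd \<Rightarrow> (real^'d) \<times> (real^'d) \<Rightarrow> real" where
  "elem_grad a b i j z = jet D (Some i) a (fst z) * jet D (Some j) b (snd z)"

abbreviation tensor_grad :: "(real^'d) tensor \<Rightarrow> 'd \<Rightarrow> 'd \<Rightarrow> (real^'d) \<times> (real^'d) \<Rightarrow> real" where
  "tensor_grad T i j \<equiv> tensor_jet D (Some i) (Some j) T"

lemma elem_grad_sq_int: "a \<in> H1 D \<Longrightarrow> b \<in> H1 D \<Longrightarrow> elem_grad a b i j \<in> sq_int M2"
  unfolding elem_grad_def[abs_def] by (intro sq_int_N sq_int_tensor jet_sq_int)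

lemma tensor_grad_sq_int: "set T \<subseteq> H1 D \<times> H1 D \<Longrightarrow> tensor_grad T i j \<in> sq_int M2"
  by (intro sq_int_N tensor_jet_sq_int)

lemma Q_grad_elem:
  assumes c: "c \<in> H1 D" "d \<in> H1 D" and a: "a \<in> H1 D" "b \<in> H1 D"
  shows "Q_grad (elem_grad c d) (elem_grad a b) = energy c a * energy d b"
proof -
  let ?f = "\<lambda>i k. \<integral>x. A x $ i $ k * jet D (Some k) c x * jet D (Some i) a x \<partial>M"
  let ?g = "\<lambda>j l. \<integral>y. A y $ j $ l * jet D (Some l) d y * jet D (Some j) b y \<partial>M"
  have "(\<integral>z. coef i j k l z * elem_grad c d k l z * elem_grad a b i j z \<partial>M2) = ?f i k * ?g j l" for i j k l
  proof -
    have eq: "(\<lambda>z. coef i j k l z * elem_grad c d k l z * elem_grad a b i j z)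
      = (\<lambda>z. (A (fst z) $ i $ k * jet D (Some k) c (fst z) * jet D (Some i) a (fst z))
          * (A (snd z) $ j $ l * jet D (Some l) d (snd z) * jet D (Some j) b (snd z)))"
      by (simp add: coef_def elem_grad_def fun_eq_iff del: jet_simps)
    note t = integral_tensor[OF energy_term_integrable[OF c(1) a(1), of i k] energy_term_integrable[OF c(2) a(2), of j l]]
    show ?thesis unfolding eq using integral_N[OF borel_measurable_integrable[OF t(1)]] t(2) by simp
  qed
  then have "Q_grad (elem_grad c d) (elem_grad a b) = (\<Sum>i\<in>UNIV. \<Sum>j\<in>UNIV. \<Sum>k\<in>UNIV. \<Sum>l\<in>UNIV. ?f i k * ?g j l)"
    by (simp add: Q_grad_def)
  also have "\<dots> = (\<Sum>i\<in>UNIV. \<Sum>j\<in>UNIV. (\<Sum>k\<in>UNIV. ?f i k) * (\<Sum>l\<in>UNIV. ?g j l))"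
    by (simp only: sum_product)
  also have "\<dots> = (\<Sum>i\<in>UNIV. \<Sum>k\<in>UNIV. ?f i k) * (\<Sum>j\<in>UNIV. \<Sum>l\<in>UNIV. ?g j l)"
    by (simp only: sum_product)
  finally show ?thesis by (simp only: energy_sum[OF c(1) a(1)] energy_sum[OF c(2) a(2)])
qed

lemma Q_grad_add:
  assumes G: "\<And>k l. G k l \<in> sq_int M2" and G': "\<And>k l. G' k l \<in> sq_int M2" and H: "\<And>k l. H k l \<in> sq_int M2"
  shows "Q_grad (\<lambda>k l z. G k l z + G' k l z) H = Q_grad G H + Q_grad G' H"
    "Q_grad H (\<lambda>k l z. G k l z + G' k l z) = Q_grad H G + Q_grad H G'"
  unfolding Q_grad_def
  using Q_grad_integrable[of G H, OF G H] Q_grad_integrable[of G' H, OF G' H]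
    Q_grad_integrable[of H G, OF H G] Q_grad_integrable[of H G', OF H G']
  by (simp_all add: distrib_left distrib_right sum.distrib)

lemma Q_grad_tensor_Cons:
  assumes G: "\<And>k l. G k l \<in> sq_int M2" and a: "a \<in> H1 D" "b \<in> H1 D" and T: "set T \<subseteq> H1 D \<times> H1 D"
  shows "Q_grad (tensor_grad ((a, b) # T)) G = Q_grad (elem_grad a b) G + Q_grad (tensor_grad T) G"
    "Q_grad G (tensor_grad ((a, b) # T)) = Q_grad G (elem_grad a b) + Q_grad G (tensor_grad T)"
proof -
  have eq: "tensor_grad ((a, b) # T) = (\<lambda>i j z. elem_grad a b i j z + tensor_grad T i j z)"
    by (simp add: fun_eq_iff elem_grad_def del: jet_simps)
  show "Q_grad (tensor_grad ((a, b) # T)) G = Q_grad (elem_grad a b) G + Q_grad (tensor_grad T) G"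
    "Q_grad G (tensor_grad ((a, b) # T)) = Q_grad G (elem_grad a b) + Q_grad G (tensor_grad T)"
    unfolding eq
    using Q_grad_add[of "elem_grad a b" "tensor_grad T" G, OF elem_grad_sq_int[OF a] tensor_grad_sq_int[OF T] G] by auto
qed

lemma Q_grad_tensor_elem:
  assumes T: "set T \<subseteq> H1 D \<times> H1 D" and a: "a \<in> H1 D" "b \<in> H1 D"
  shows "Q_grad (tensor_grad T) (elem_grad a b) = (\<Sum>(c, d)\<leftarrow>T. energy c a * energy d b)"
  using T
proof (induction T)
  case Nil
  then show ?case by (simp add: Q_grad_def)
next
  case (Cons cd T)
  obtain c d where cd: "cd = (c, d)" by (cases cd)
  have c: "c \<in> H1 D" "d \<in> H1 D" and T: "set T \<subseteq> H1 D \<times> H1 D" using Cons.prems cd by auto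
  show ?case
    unfolding cd Q_grad_tensor_Cons(1)[of "elem_grad a b", OF elem_grad_sq_int[OF a] c T] Q_grad_elem[OF c a]
    using Cons.IH[OF T] by simp
qed

end

section \<open>The random elliptic problem\<close>

locale random_elliptic = elliptic D A K \<alpha> + random_domain D P
  for D :: "(real^'d) set" and A :: "real^'d \<Rightarrow> real^'d^'d" and K \<alpha> :: real and P :: "'w measure" +
  fixes f u :: "'w \<Rightarrow> real^'d \<Rightarrow> real"
  assumes f: "f \<in> L2_random P D (L2 D) (L2_norm D)"
    and u: "random_solution P D A f u"
begin

definition load :: "(real^'d \<Rightarrow> real) \<Rightarrow> 'w \<Rightarrow> real" where
  "load a \<omega> = (\<integral>x. f \<omega> x * a x \<partial>M)"

lemma u_field: "u \<in> H10_fields"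
  using u by (simp add: random_solution_def)

lemma data_field:
  shows "\<omega> \<in> space P \<Longrightarrow> f \<omega> \<in> sq_int M" "case_prod f \<in> borel_measurable PM"
    "integrable P (\<lambda>\<omega>. (nrm M (f \<omega>))\<^sup>2)" "case_prod f \<in> sq_int PM"
proof -
  show 1: "\<omega> \<in> space P \<Longrightarrow> f \<omega> \<in> sq_int M" for \<omega>
    using f by (simp add: L2_random_def L2_eq)
  show 2: "case_prod f \<in> borel_measurable PM" and 3: "integrable P (\<lambda>\<omega>. (nrm M (f \<omega>))\<^sup>2)"
    using f by (simp_all add: L2_random_def L2_norm_eq)
  show "case_prod f \<in> sq_int PM" by (rule sq_int_random_field(1)[OF 2 1 3])
qed

lemma load_measurable:
  assumes "a \<in> sq_int M" shows "load a \<in> borel_measurable P"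
proof -
  have "(\<lambda>p. case_prod f p * a (snd p)) \<in> borel_measurable PM"
    using assms by (intro borel_measurable_times data_field measurable_compose[OF measurable_snd]) auto
  then have "(\<lambda>\<omega>. \<integral>x. f \<omega> x * a x \<partial>M) \<in> borel_measurable P"
    by (intro borel_measurable_lebesgue_integral) (simp add: case_prod_beta')
  then show ?thesis by (simp add: load_def[abs_def])
qed

lemma load_bound: "a \<in> sq_int M \<Longrightarrow> \<omega> \<in> space P \<Longrightarrow> \<bar>load a \<omega>\<bar> \<le> nrm M (f \<omega>) * nrm M a"
  unfolding load_def by (rule nrm_Cauchy_Schwarz[OF data_field(1)])

lemma load_sq_int:
  assumes "a \<in> sq_int M" shows "load a \<in> sq_int P"
proof (rule sq_intI[OF load_measurable[OF assms]])
  have i: "integrable P (\<lambda>\<omega>. (nrm M a)\<^sup>2 * (nrm M (f \<omega>))\<^sup>2)" using data_field(3) by simp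
  show "integrable P (\<lambda>\<omega>. (load a \<omega>)\<^sup>2)"
  proof (rule Bochner_Integration.integrable_bound[OF i])
    show "(\<lambda>\<omega>. (load a \<omega>)\<^sup>2) \<in> borel_measurable P" using load_measurable[OF assms] by measurable
    show "AE \<omega> in P. norm ((load a \<omega>)\<^sup>2) \<le> norm ((nrm M a)\<^sup>2 * (nrm M (f \<omega>))\<^sup>2)"
    proof (rule AE_I2)
      fix \<omega> assume "\<omega> \<in> space P"
      from power_mono[OF load_bound[OF assms this] abs_ge_zero, of 2]
      show "norm ((load a \<omega>)\<^sup>2) \<le> norm ((nrm M a)\<^sup>2 * (nrm M (f \<omega>))\<^sup>2)"
        by (simp add: power_mult_distrib mult.commute)
    qed
  qed
qed

text \<open>Measurability in \<omega> cannot be read off the integrand. By continuity of the energy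
  form in the H1 norm the energy is a pointwise limit of energies of simple fields, which are simple
  functions.\<close>

lemma energy_field_measurable:
  assumes a: "a \<in> H1 D" and s: "\<And>n. simple_field (s n)"
    and lim: "\<And>\<omega>. \<omega> \<in> space P \<Longrightarrow> (\<lambda>n. H1_norm D (\<lambda>x. s n \<omega> x - u \<omega> x)) \<longlonglongrightarrow> 0"
  shows "\<And>\<omega>. \<omega> \<in> space P \<Longrightarrow> (\<lambda>n. energy (s n \<omega>) a) \<longlonglongrightarrow> energy (u \<omega>) a"
    "(\<lambda>\<omega>. energy (u \<omega>) a) \<in> borel_measurable P"
proof -
  note S = simple_fieldD[OF s] and U = H10_fieldD[OF u_field]
  obtain c where c: "c \<ge> 0" "\<And>u v. u \<in> H1 D \<Longrightarrow> v \<in> H1 D \<Longrightarrow> \<bar>energy u v\<bar> \<le> c * H1_norm D u * H1_norm D v"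
    using energy_bounded by blast
  show l: "(\<lambda>n. energy (s n \<omega>) a) \<longlonglongrightarrow> energy (u \<omega>) a" if w: "\<omega> \<in> space P" for \<omega>
  proof -
    have b: "norm (energy (s n \<omega>) a - energy (u \<omega>) a) \<le> c * H1_norm D (\<lambda>x. s n \<omega> x - u \<omega> x) * H1_norm D a" for n
      using c(2)[OF H1_diff[OF S(4)[OF w] U(2)[OF w]] a] energy_diff[OF S(4)[OF w] U(2)[OF w] a] by simp
    have "(\<lambda>n. c * H1_norm D (\<lambda>x. s n \<omega> x - u \<omega> x) * H1_norm D a) \<longlonglongrightarrow> c * 0 * H1_norm D a"
      by (intro tendsto_intros lim w)
    then have "(\<lambda>n. energy (s n \<omega>) a - energy (u \<omega>) a) \<longlonglongrightarrow> 0"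
      by (intro Lim_null_comparison[OF always_eventually[OF allI[OF b]]]) simp
    then show ?thesis by (simp add: LIM_zero_iff)
  qed
  show "(\<lambda>\<omega>. energy (u \<omega>) a) \<in> borel_measurable P"
  proof (rule borel_measurable_LIMSEQ_real)
    show "(\<lambda>n. energy (s n \<omega>) a) \<longlonglongrightarrow> energy (u \<omega>) a" if "\<omega> \<in> space P" for \<omega> by (rule l[OF that])
    show "(\<lambda>\<omega>. energy (s n \<omega>) a) \<in> borel_measurable P" for n
      by (rule borel_measurable_simple_function[OF simple_function_compose1[OF S(1)]])
  qed
qed

lemma energy_bounded_left:
  assumes a: "a \<in> H1 D"
  obtains c where "c \<ge> 0" "\<And>v. v \<in> H1 D \<Longrightarrow> \<bar>energy v a\<bar> \<le> c * H1_norm D v"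
proof -
  obtain c where c: "c \<ge> 0" "\<And>u v. u \<in> H1 D \<Longrightarrow> v \<in> H1 D \<Longrightarrow> \<bar>energy u v\<bar> \<le> c * H1_norm D u * H1_norm D v"
    using energy_bounded by blast
  show ?thesis
    by (rule that[of "c * H1_norm D a"]) (use c H1_norm_nonneg[OF a] c(2)[OF _ a] in \<open>auto simp: mult_ac\<close>)
qed

lemma energy_field_sq_int:
  assumes a: "a \<in> H1 D" shows "(\<lambda>\<omega>. energy (u \<omega>) a) \<in> sq_int P"
proof -
  note U = H10_fieldD[OF u_field]
  obtain s where s: "\<And>n. simple_field (s n)"
    "\<And>n \<omega>. \<omega> \<in> space P \<Longrightarrow> H1_norm D (s n \<omega>) \<le> 2 * H1_norm D (u \<omega>)"
    "\<And>\<omega>. \<omega> \<in> space P \<Longrightarrow> (\<lambda>n. H1_norm D (\<lambda>x. s n \<omega> x - u \<omega> x)) \<longlonglongrightarrow> 0"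
    "\<And>n. integrable P (\<lambda>\<omega>. (H1_norm D (\<lambda>x. s n \<omega> x - u \<omega> x))\<^sup>2)"
    "(\<lambda>n. \<integral>\<omega>. (H1_norm D (\<lambda>x. s n \<omega> x - u \<omega> x))\<^sup>2 \<partial>P) \<longlonglongrightarrow> 0"
    by (rule simple_field_approximation[OF u_field]) (rule that)
  obtain c where c: "c \<ge> 0" "\<And>v. v \<in> H1 D \<Longrightarrow> \<bar>energy v a\<bar> \<le> c * H1_norm D v"
    using energy_bounded_left[OF a] by blast
  have m: "(\<lambda>\<omega>. energy (u \<omega>) a) \<in> borel_measurable P" by (rule energy_field_measurable(2)[OF a s(1,3)])
  have i: "integrable P (\<lambda>\<omega>. c\<^sup>2 * (H1_norm D (u \<omega>))\<^sup>2)" using U(4) by simp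
  have "integrable P (\<lambda>\<omega>. (energy (u \<omega>) a)\<^sup>2)"
  proof (rule Bochner_Integration.integrable_bound[OF i])
    show "(\<lambda>\<omega>. (energy (u \<omega>) a)\<^sup>2) \<in> borel_measurable P" using m by measurable
    show "AE \<omega> in P. norm ((energy (u \<omega>) a)\<^sup>2) \<le> norm (c\<^sup>2 * (H1_norm D (u \<omega>))\<^sup>2)"
    proof (rule AE_I2)
      fix \<omega> assume "\<omega> \<in> space P"
      from power_mono[OF c(2)[OF U(2)[OF this]] abs_ge_zero, of 2]
      show "norm ((energy (u \<omega>) a)\<^sup>2) \<le> norm (c\<^sup>2 * (H1_norm D (u \<omega>))\<^sup>2)"
        by (simp add: power_mult_distrib)
    qed
  qed
  then show ?thesis by (rule sq_intI[OF m])
qed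

(* Testing with the fields 1_E(omega) a(x) localises the random equation in omega. *)
lemma pathwise_equation:
  assumes a: "a \<in> H10 D" shows "AE \<omega> in P. energy (u \<omega>) a = load a \<omega>"
proof (rule density_unique_real)
  note a1 = H10_H1[OF a]
  show "integrable P (\<lambda>\<omega>. energy (u \<omega>) a)"
    by (rule P.square_integrable_imp_integrable[OF sq_intD[OF energy_field_sq_int[OF a1]]])
  show "integrable P (load a)"
    by (rule P.square_integrable_imp_integrable[OF sq_intD[OF load_sq_int[OF H1_sq_int[OF a1]]]])
  fix E assume E: "E \<in> sets P"
  define v where "v \<omega> x = indicator E \<omega> * a x" for \<omega> x
  have v01: "v \<omega> = (if \<omega> \<in> E then a else (\<lambda>x. 0))" for \<omega> by (auto simp: v_def fun_eq_iff)
  have vH: "v \<omega> \<in> H10 D" for \<omega> using a H10_zero by (simp add: v01)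
  have vs: "simple_function P v"
    unfolding v01[abs_def] using E by (intro simple_function_If) auto
  have "v \<in> H10_fields"
    unfolding L2_random_def
  \<comment> \<open>The field takes at most two values, so the constant sequence is an approximation
    by simple functions.\<close>
  proof (intro CollectI conjI ballI exI[of _ "\<lambda>n. v"] allI)
    show "v \<omega> \<in> H10 D" for \<omega> by (rule vH)
    have "(\<lambda>p. indicator E (fst p) * a (snd p)) \<in> borel_measurable PM"
      using E H1_sq_int[OF a1]
      by (intro borel_measurable_times measurable_compose[OF measurable_fst borel_measurable_indicator]
          measurable_compose[OF measurable_snd]) auto
    then show "case_prod v \<in> borel_measurable PM" by (simp add: v_def case_prod_beta')
    show "simple_function P v" by (rule vs)
    show "v ` space P \<subseteq> H10 D" using vH by auto
    show "(\<lambda>n. H1_norm D (\<lambda>x. v \<omega> x - v \<omega> x)) \<longlonglongrightarrow> 0" for \<omega> by (simp add: H1_norm_zero)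
    show "integrable P (\<lambda>\<omega>. (H1_norm D (v \<omega>))\<^sup>2)" by (rule simple_compose_integrable[OF vs])
  qed
  with u have eq: "(\<integral>\<omega>. energy (u \<omega>) (v \<omega>) \<partial>P) = (\<integral>\<omega>. load (v \<omega>) \<omega> \<partial>P)"
    by (simp add: random_solution_def energy_def load_def)
  \<comment> \<open>The chosen gradient of the zero function vanishes only almost everywhere, so
    this is derived from boundedness of the form.\<close>
  have e0: "energy w (\<lambda>x. 0) = 0" if "w \<in> H1 D" for w
  proof -
    obtain c where "c \<ge> 0" "\<And>u v. u \<in> H1 D \<Longrightarrow> v \<in> H1 D \<Longrightarrow> \<bar>energy u v\<bar> \<le> c * H1_norm D u * H1_norm D v"
      using energy_bounded by blast
    from this(2)[OF that H10_H1[OF H10_zero]] show ?thesis by (simp add: H1_norm_zero)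
  qed
  have "(\<integral>\<omega>. energy (u \<omega>) (v \<omega>) \<partial>P) = set_lebesgue_integral P E (\<lambda>\<omega>. energy (u \<omega>) a)"
    unfolding set_lebesgue_integral_def
    by (intro Bochner_Integration.integral_cong refl)
      (use e0 H10_fieldD(2)[OF u_field] in \<open>auto simp: v01 indicator_def\<close>)
  moreover have "(\<integral>\<omega>. load (v \<omega>) \<omega> \<partial>P) = set_lebesgue_integral P E (load a)"
    unfolding set_lebesgue_integral_def
    by (intro Bochner_Integration.integral_cong refl) (auto simp: v01 indicator_def load_def)
  ultimately show "set_lebesgue_integral P E (\<lambda>\<omega>. energy (u \<omega>) a) = set_lebesgue_integral P E (load a)"
    using eq by simp
qed

text \<open>Fubini on Omega x D x D: integrating over x and y first factorises the integrand into
  two loads, integrating over \<omega> first produces the correlation.\<close>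

lemma integral_correlation_elem:
  assumes a: "a \<in> sq_int M" and b: "b \<in> sq_int M"
  shows "(\<integral>z. correlation P f z * (a (fst z) * b (snd z)) \<partial>N) = (\<integral>\<omega>. load a \<omega> * load b \<omega> \<partial>P)"
proof -
  interpret PN: pair_sigma_finite P N ..
  let ?h = "\<lambda>p. (f (fst p) (fst (snd p)) * a (fst (snd p))) * (f (fst p) (snd (snd p)) * b (snd (snd p)))"
  have am: "a \<in> borel_measurable M" and bm: "b \<in> borel_measurable M" using a b by auto
  have hm: "?h \<in> borel_measurable (P \<Otimes>\<^sub>M N)"
  proof -
    have "(\<lambda>p. (fst p, fst (snd p))) \<in> measurable (P \<Otimes>\<^sub>M N) PM" by measurable
    from measurable_compose[OF this data_field(2)]
    have 1: "(\<lambda>p. f (fst p) (fst (snd p))) \<in> borel_measurable (P \<Otimes>\<^sub>M N)" by simp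
    have "(\<lambda>p. (fst p, snd (snd p))) \<in> measurable (P \<Otimes>\<^sub>M N) PM" by measurable
    from measurable_compose[OF this data_field(2)]
    have 2: "(\<lambda>p. f (fst p) (snd (snd p))) \<in> borel_measurable (P \<Otimes>\<^sub>M N)" by simp
    have 3: "(\<lambda>p. a (fst (snd p))) \<in> borel_measurable (P \<Otimes>\<^sub>M N)" using am by measurable
    have 4: "(\<lambda>p. b (snd (snd p))) \<in> borel_measurable (P \<Otimes>\<^sub>M N)" using bm by measurable
    show ?thesis by (intro borel_measurable_times 1 2 3 4)
  qed
  have fa: "integrable M (\<lambda>x. f \<omega> x * a x)" "integrable M (\<lambda>x. f \<omega> x * b x)" if "\<omega> \<in> space P" for \<omega>
    by (intro sq_int_mult_integrable data_field(1)[OF that] a b)+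
  have int: "integrable (P \<Otimes>\<^sub>M N) ?h"
  proof (rule PN.Fubini_integrable[OF hm])
    \<comment> \<open>For fixed \<omega> the absolute integral over (x, y) factorises, and
      Cauchy-Schwarz in each variable contributes one norm of f.\<close>
    have dom: "integrable P (\<lambda>\<omega>. (nrm M (f \<omega>))\<^sup>2 * (nrm M a * nrm M b))" using data_field(3) by simp
    show "integrable P (\<lambda>\<omega>. \<integral>y. norm (?h (\<omega>, y)) \<partial>N)"
    proof (rule Bochner_Integration.integrable_bound[OF dom])
      have "(\<lambda>p. norm (?h p)) \<in> borel_measurable (P \<Otimes>\<^sub>M N)" using hm by measurable
      then show "(\<lambda>\<omega>. \<integral>y. norm (?h (\<omega>, y)) \<partial>N) \<in> borel_measurable P"
        by (intro pair.P.borel_measurable_lebesgue_integral) (simp add: case_prod_beta')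
      show "AE \<omega> in P. norm (\<integral>y. norm (?h (\<omega>, y)) \<partial>N) \<le> norm ((nrm M (f \<omega>))\<^sup>2 * (nrm M a * nrm M b))"
      proof (rule AE_I2)
        fix \<omega> assume w: "\<omega> \<in> space P"
        have abs: "(\<lambda>x. \<bar>g x\<bar>) \<in> sq_int M \<and> nrm M (\<lambda>x. \<bar>g x\<bar>) = nrm M g" if "g \<in> sq_int M" for g
          using that by (auto simp: sq_int_def nrm_def)
        have le: "(\<integral>x. \<bar>f \<omega> x * g x\<bar> \<partial>M) \<le> nrm M (f \<omega>) * nrm M g" if g: "g \<in> sq_int M" for g
          using nrm_Cauchy_Schwarz[of "\<lambda>x. \<bar>f \<omega> x\<bar>" M "\<lambda>x. \<bar>g x\<bar>"] abs[OF g] abs[OF data_field(1)[OF w]]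
          by (simp add: abs_mult)
        have "(\<integral>y. norm (?h (\<omega>, y)) \<partial>N) = (\<integral>x. \<bar>f \<omega> x * a x\<bar> \<partial>M) * (\<integral>x. \<bar>f \<omega> x * b x\<bar> \<partial>M)"
          using integral_tensor(2)[OF integrable_abs[OF fa(1)[OF w]] integrable_abs[OF fa(2)[OF w]]]
          by (simp add: abs_mult)
        also have "\<dots> \<le> (nrm M (f \<omega>) * nrm M a) * (nrm M (f \<omega>) * nrm M b)"
          by (intro mult_mono le a b) auto
        finally show "norm (\<integral>y. norm (?h (\<omega>, y)) \<partial>N) \<le> norm ((nrm M (f \<omega>))\<^sup>2 * (nrm M a * nrm M b))"
          by (simp add: power2_eq_square mult_ac)
      qed
    qed
    show "AE \<omega> in P. integrable N (\<lambda>y. ?h (\<omega>, y))"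
      using integral_tensor(1)[OF fa(1) fa(2)] by (intro AE_I2) simp
  qed
  have "(\<integral>\<omega>. load a \<omega> * load b \<omega> \<partial>P) = (\<integral>\<omega>. \<integral>z. ?h (\<omega>, z) \<partial>N \<partial>P)"
    by (intro Bochner_Integration.integral_cong refl)
      (use integral_tensor(2)[OF fa(1) fa(2)] in \<open>simp add: load_def\<close>)
  also have "\<dots> = integral\<^sup>L (P \<Otimes>\<^sub>M N) ?h" by (rule PN.integral_fst'[OF int])
  also have "\<dots> = (\<integral>z. \<integral>\<omega>. ?h (\<omega>, z) \<partial>P \<partial>N)"
    using PN.integral_snd[of "\<lambda>\<omega> z. ?h (\<omega>, z)"] int by (simp add: case_prod_beta')
  also have "\<dots> = (\<integral>z. correlation P f z * (a (fst z) * b (snd z)) \<partial>N)"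
  proof (intro Bochner_Integration.integral_cong refl)
    fix z
    have "(\<lambda>\<omega>. ?h (\<omega>, z)) = (\<lambda>\<omega>. (f \<omega> (fst z) * f \<omega> (snd z)) * (a (fst z) * b (snd z)))"
      by (auto simp: fun_eq_iff)
    then show "(\<integral>\<omega>. ?h (\<omega>, z) \<partial>P) = correlation P f z * (a (fst z) * b (snd z))"
      unfolding correlation_eq_cross cross_def by simp
  qed
  finally show ?thesis by simp
qed

lemma deterministic_solution_correlation:
  "deterministic_solution D A (correlation P f) (correlation P u)"
proof -
  note U = H10_fieldD[OF u_field]
  obtain s where s: "\<And>n. simple_field (s n)"
    "\<And>n \<omega>. \<omega> \<in> space P \<Longrightarrow> H1_norm D (s n \<omega>) \<le> 2 * H1_norm D (u \<omega>)"
    "\<And>\<omega>. \<omega> \<in> space P \<Longrightarrow> (\<lambda>n. H1_norm D (\<lambda>x. s n \<omega> x - u \<omega> x)) \<longlonglongrightarrow> 0"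
    "\<And>n. integrable P (\<lambda>\<omega>. (H1_norm D (\<lambda>x. s n \<omega> x - u \<omega> x))\<^sup>2)"
    "(\<lambda>n. \<integral>\<omega>. (H1_norm D (\<lambda>x. s n \<omega> x - u \<omega> x))\<^sup>2 \<partial>P) \<longlonglongrightarrow> 0"
    by (rule simple_field_approximation[OF u_field]) (rule that)
  note S = simple_fieldD[OF s(1)]
  note C = correlation_H11[OF u_field s(1,4,5)]
  define G where "G k l z = weak_grad_xy D (correlation P u) z $ k $ l" for k l z
  have Gs: "G k l \<in> sq_int M2" for k l unfolding G_def[abs_def] by (rule C(3))
  have T10: "set (simple_tensor (s n)) \<subseteq> H10 D \<times> H10 D" for n by (rule simple_tensor_sum(1)[OF s(1)])
  have T1: "set (simple_tensor (s n)) \<subseteq> H1 D \<times> H1 D" for n using T10[of n] H10_H1 by auto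
  have fN: "correlation P f \<in> sq_int N" by (rule correlation_sq_int[OF data_field(4)])
  have elem: "Q_grad G (elem_grad a b) = (\<integral>z. correlation P f z * (a (fst z) * b (snd z)) \<partial>N)"
    if a: "a \<in> H10 D" and b: "b \<in> H10 D" for a b
  proof -
    note a1 = H10_H1[OF a] and b1 = H10_H1[OF b]
    \<comment> \<open>The values of Q along the simple tensors are followed in two ways: here
      through convergence of the mixed gradients, below through the expectation of energies.\<close>
    have lim1: "(\<lambda>n. Q_grad (tensor_grad (simple_tensor (s n))) (elem_grad a b)) \<longlonglongrightarrow> Q_grad G (elem_grad a b)"
    proof (rule Q_grad_tendsto[OF tensor_grad_sq_int[OF T1] Gs elem_grad_sq_int[OF a1 b1] elem_grad_sq_int[OF a1 b1]])
      show "(\<lambda>n. nrm M2 (\<lambda>z. tensor_grad (simple_tensor (s n)) k l z - G k l z)) \<longlonglongrightarrow> 0" for k l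
        unfolding G_def by (rule C(2))
      show "(\<lambda>n. nrm M2 (\<lambda>z. elem_grad a b i j z - elem_grad a b i j z)) \<longlonglongrightarrow> 0" for i j
        by (simp add: nrm_def)
    qed
    \<comment> \<open>The probability weight sits in the first factor of each elementary tensor;
      pulling it out of the energy leaves the finite sum for an expectation.\<close>
    have Qn: "Q_grad (tensor_grad (simple_tensor (s n))) (elem_grad a b) = (\<integral>\<omega>. energy (s n \<omega>) a * energy (s n \<omega>) b \<partial>P)" for n
    proof -
      let ?p = "\<lambda>v. measure P (s n -` {v} \<inter> space P)"
      have "Q_grad (tensor_grad (simple_tensor (s n))) (elem_grad a b)
          = (\<Sum>v\<in>s n ` space P. energy (\<lambda>x. ?p v * v x) a * energy v b)"
        unfolding Q_grad_tensor_elem[OF T1 a1 b1]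
        using simple_tensor_sum(2)[OF s(1)[of n], of "\<lambda>(c, d). energy c a * energy d b"] by simp
      also have "\<dots> = (\<Sum>v\<in>s n ` space P. ?p v * (energy v a * energy v b))"
        using S(5) by (intro sum.cong refl) (simp add: energy_cmult[OF H10_H1 a1])
      also have "\<dots> = (\<integral>\<omega>. energy (s n \<omega>) a * energy (s n \<omega>) b \<partial>P)"
        by (rule integral_simple_compose[OF P.prob_space_axioms S(1), of "\<lambda>v. energy v a * energy v b", symmetric])
      finally show ?thesis .
    qed
    obtain c where c: "c \<ge> 0" "\<And>v. v \<in> H1 D \<Longrightarrow> \<bar>energy v a\<bar> \<le> c * H1_norm D v"
      using energy_bounded_left[OF a1] by blast
    obtain c' where c': "c' \<ge> 0" "\<And>v. v \<in> H1 D \<Longrightarrow> \<bar>energy v b\<bar> \<le> c' * H1_norm D v"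
      using energy_bounded_left[OF b1] by blast
    \<comment> \<open>The truncation bounds the norm of \<open>s n\<close> by twice that of u, which
      turns the product of the two energies into the factor (2 c) (2 c').\<close>
    have dom: "integrable P (\<lambda>\<omega>. (4 * c * c') * (H1_norm D (u \<omega>))\<^sup>2)" using U(4) by simp
    have lim2: "(\<lambda>n. \<integral>\<omega>. energy (s n \<omega>) a * energy (s n \<omega>) b \<partial>P) \<longlonglongrightarrow> (\<integral>\<omega>. energy (u \<omega>) a * energy (u \<omega>) b \<partial>P)"
    proof (rule integral_dominated_convergence[OF _ _ dom])
      show "(\<lambda>\<omega>. energy (u \<omega>) a * energy (u \<omega>) b) \<in> borel_measurable P"
        by (intro borel_measurable_times energy_field_measurable(2)[OF a1 s(1,3)] energy_field_measurable(2)[OF b1 s(1,3)])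
      show "(\<lambda>\<omega>. energy (s n \<omega>) a * energy (s n \<omega>) b) \<in> borel_measurable P" for n
        using simple_compose_integrable[OF S(1), of "\<lambda>v. energy v a * energy v b" n] by (rule borel_measurable_integrable)
      show "AE \<omega> in P. (\<lambda>n. energy (s n \<omega>) a * energy (s n \<omega>) b) \<longlonglongrightarrow> energy (u \<omega>) a * energy (u \<omega>) b"
        by (intro AE_I2 tendsto_mult energy_field_measurable(1)[OF a1 s(1,3)] energy_field_measurable(1)[OF b1 s(1,3)])
      show "AE \<omega> in P. norm (energy (s n \<omega>) a * energy (s n \<omega>) b) \<le> (4 * c * c') * (H1_norm D (u \<omega>))\<^sup>2" for n
      proof (rule AE_I2)
        fix \<omega> assume w: "\<omega> \<in> space P"
        have "\<bar>energy (s n \<omega>) a\<bar> \<le> c * (2 * H1_norm D (u \<omega>))"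
          by (rule order_trans[OF c(2)[OF S(4)[OF w]] mult_left_mono[OF s(2)[OF w] c(1)]])
        moreover have "\<bar>energy (s n \<omega>) b\<bar> \<le> c' * (2 * H1_norm D (u \<omega>))"
          by (rule order_trans[OF c'(2)[OF S(4)[OF w]] mult_left_mono[OF s(2)[OF w] c'(1)]])
        ultimately have "\<bar>energy (s n \<omega>) a\<bar> * \<bar>energy (s n \<omega>) b\<bar> \<le> (c * (2 * H1_norm D (u \<omega>))) * (c' * (2 * H1_norm D (u \<omega>)))"
          using c(1) H1_norm_nonneg[OF U(2)[OF w]] by (intro mult_mono) auto
        then show "norm (energy (s n \<omega>) a * energy (s n \<omega>) b) \<le> (4 * c * c') * (H1_norm D (u \<omega>))\<^sup>2"
          by (simp add: abs_mult power2_eq_square mult_ac)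
      qed
    qed
    have "Q_grad G (elem_grad a b) = (\<integral>\<omega>. energy (u \<omega>) a * energy (u \<omega>) b \<partial>P)"
      using LIMSEQ_unique[OF lim1] lim2 by (simp add: Qn)
    also have "\<dots> = (\<integral>\<omega>. load a \<omega> * load b \<omega> \<partial>P)"
    proof (rule integral_cong_AE)
      \<comment> \<open>The exceptional null set depends on a and b, which is harmless as both are
        fixed under the expectation.\<close>
      show "AE \<omega> in P. energy (u \<omega>) a * energy (u \<omega>) b = load a \<omega> * load b \<omega>"
        using pathwise_equation[OF a] pathwise_equation[OF b] by eventually_elim simp
      show "(\<lambda>\<omega>. energy (u \<omega>) a * energy (u \<omega>) b) \<in> borel_measurable P"
        by (intro borel_measurable_times energy_field_measurable(2)[OF a1 s(1,3)] energy_field_measurable(2)[OF b1 s(1,3)])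
      show "(\<lambda>\<omega>. load a \<omega> * load b \<omega>) \<in> borel_measurable P"
        by (intro borel_measurable_times load_measurable H1_sq_int a1 b1)
    qed
    also have "\<dots> = (\<integral>z. correlation P f z * (a (fst z) * b (snd z)) \<partial>N)"
      by (rule integral_correlation_elem[OF H1_sq_int[OF a1] H1_sq_int[OF b1], symmetric])
    finally show ?thesis .
  qed
  have alg: "Q_grad G (tensor_grad T) = (\<integral>z. correlation P f z * tensor_fun T z \<partial>N)"
    if "set T \<subseteq> H10 D \<times> H10 D" for T
    using that
  proof (induction T)
    case Nil
    then show ?case by (simp add: Q_grad_def tensor_fun_def)
  next
    case (Cons ab T)
    obtain a b where ab: "ab = (a, b)" by (cases ab)
    have a: "a \<in> H10 D" "b \<in> H10 D" and T: "set T \<subseteq> H10 D \<times> H10 D" using Cons.prems ab by auto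
    have T': "set T \<subseteq> H1 D \<times> H1 D" using T H10_H1 by auto
    note a1 = H10_H1[OF a(1)] and b1 = H10_H1[OF a(2)]
    have "integrable N (\<lambda>z. correlation P f z * (a (fst z) * b (snd z)))"
      by (intro sq_int_mult_integrable fN sq_int_tensor H1_sq_int a1 b1)
    moreover have "integrable N (\<lambda>z. correlation P f z * tensor_fun T z)"
      by (intro sq_int_mult_integrable fN tensor_jet_sq_int[OF T', of None None, unfolded tensor_jet_None])
    moreover have "tensor_fun (ab # T) z = a (fst z) * b (snd z) + tensor_fun T z" for z
      by (simp add: tensor_fun_def ab case_prod_beta')
    ultimately have "(\<integral>z. correlation P f z * tensor_fun (ab # T) z \<partial>N)
        = (\<integral>z. correlation P f z * (a (fst z) * b (snd z)) \<partial>N) + (\<integral>z. correlation P f z * tensor_fun T z \<partial>N)"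
      by (simp add: distrib_left)
    then show ?case
      unfolding ab Q_grad_tensor_Cons(2)[of G, OF Gs a1 b1 T'] using elem[OF a] Cons.IH[OF T] by simp
  qed
  \<comment> \<open>Both sides are continuous along tensors that approximate Z together with its
    mixed gradient, so the identity for algebraic tensors passes to the limit.\<close>
  have "Q_form D A (correlation P u) Z = (\<integral>z. correlation P f z * Z z \<partial>M2)" if Z: "Z \<in> H11 D" for Z
  proof -
    obtain T where T: "\<And>n. set (T n) \<subseteq> H10 D \<times> H10 D"
      "(\<lambda>n. nrm M2 (\<lambda>z. tensor_fun (T n) z - Z z)) \<longlonglongrightarrow> 0"
      "\<And>i j. (\<lambda>n. nrm M2 (\<lambda>z. tensor_grad (T n) i j z - weak_grad_xy D Z z $ i $ j)) \<longlonglongrightarrow> 0"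
      "\<And>i j. (\<lambda>z. weak_grad_xy D Z z $ i $ j) \<in> sq_int M2"
      using H11_approximation[OF Z] by blast
    have T': "set (T n) \<subseteq> H1 D \<times> H1 D" for n using T(1)[of n] H10_H1 by auto
    have Tn: "tensor_fun (T n) \<in> sq_int N" for n by (rule tensor_jet_sq_int[OF T', of None None, unfolded tensor_jet_None])
    have Zs: "Z \<in> sq_int M2" using Z by (simp add: H11_def L2_eq)
    have "(\<lambda>n. Q_grad G (tensor_grad (T n))) \<longlonglongrightarrow> Q_grad G (\<lambda>i j z. weak_grad_xy D Z z $ i $ j)"
      by (rule Q_grad_tendsto[OF Gs Gs tensor_grad_sq_int[OF T'] T(4) _ T(3)]) (simp add: nrm_def)
    moreover have "(\<lambda>n. \<integral>z. correlation P f z * tensor_fun (T n) z \<partial>M2) \<longlonglongrightarrow> (\<integral>z. correlation P f z * Z z \<partial>M2)"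
      by (rule sq_int_product_tendsto[OF sq_int_N[OF fN] sq_int_N[OF fN] sq_int_N[OF Tn] Zs _ T(2)]) (simp add: nrm_def)
    moreover have "Q_grad G (tensor_grad (T n)) = (\<integral>z. correlation P f z * tensor_fun (T n) z \<partial>M2)" for n
    proof -
      have "(\<lambda>z. correlation P f z * tensor_fun (T n) z) \<in> borel_measurable N"
        by (intro borel_measurable_times sq_intD(1)[OF fN] sq_intD(1)[OF Tn])
      then show ?thesis unfolding alg[OF T(1)] by (rule integral_N)
    qed
    ultimately have "Q_grad G (\<lambda>i j z. weak_grad_xy D Z z $ i $ j) = (\<integral>z. correlation P f z * Z z \<partial>M2)"
      by (simp add: LIMSEQ_unique)
    then show ?thesis unfolding Q_form_eq_Q_grad[OF C(1) Z] G_def[abs_def] .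
  qed
  then show ?thesis using C(1) by (simp add: deterministic_solution_def)
qed

end

theorem proposition4p1:
  fixes D :: "(real^'d) set"
    and P :: "'w measure"
    and A :: "real^'d \<Rightarrow> real^'d^'d"
    and f u :: "'w \<Rightarrow> real^'d \<Rightarrow> real"
    and \<alpha> \<beta> :: real
  assumes "bounded_lipschitz_domain D"
    and "prob_space P"
    and "A \<in> borel_measurable (lebesgue_on D)"
    and "\<exists>K. AE x in lebesgue_on D. norm (A x) \<le> K"
    and "AE x in lebesgue_on D. transpose (A x) = A x"
    and "\<alpha> > 0" and "\<beta> > 0"
    and "AE x in lebesgue_on D. \<forall>\<xi>.
           \<alpha> * (norm \<xi>)\<^sup>2 \<le> \<xi> \<bullet> (A x *v \<xi>) \<and> \<xi> \<bullet> (A x *v \<xi>) \<le> \<beta> * (norm \<xi>)\<^sup>2"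
    and "f \<in> L2_random P D (L2 D) (L2_norm D)"
    and "random_solution P D A f u"
  shows "deterministic_solution D A (correlation P f) (correlation P u)
    \<and> (\<forall>C. deterministic_solution D A (correlation P f) C
          \<longrightarrow> (AE z in lebesgue_on (D \<times> D). C z = correlation P u z))"
proof -
  obtain K where K: "AE x in lebesgue_on D. norm (A x) \<le> K" using assms(4) by blast
  have D: "open D" "bounded D" using assms(1) by (auto simp: bounded_lipschitz_domain_def)
  have e: "AE x in lebesgue_on D. \<forall>\<xi>. \<alpha> * (norm \<xi>)\<^sup>2 \<le> \<xi> \<bullet> (A x *v \<xi>)"
    using assms(8) by eventually_elim blast
  interpret prob_space P by fact
  interpret random_elliptic D A K \<alpha> P f u
    by unfold_locales (use D assms(3,5,6,9,10) K e in auto)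
  show ?thesis
    using deterministic_solution_correlation deterministic_solution_unique by blast
qed

end
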